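(* Let $C$ be the non-complete intersection Gorenstein monomial curve $x_i=t^{n_i}$ ($1\le i\le4$) in $\mathbb{A}^4(K)$, with $n_1<n_2<n_3<n_4$. Suppose that $I(C)$ is given as in case 2(a), i.e. $I(C)$ is minimally generated by $$f_1=x_1^{a_1}-x_2^{a_{12}}x_3^{a_{13}},\quad f_2=x_2^{a_2}-x_3^{a_{23}}x_4^{a_{24}},\quad f_3=x_3^{a_3}-x_1^{a_{31}}x_4^{a_{34}},$$ $$f_4=x_4^{a_4}-x_1^{a_{41}}x_2^{a_{42}},\quad f_5=x_1^{a_{41}}x_3^{a_{23}}-x_2^{a_{12}}x_4^{a_{34}},$$ and also that $a_{34}\le a_{24}$. Then $C$ has Cohen-Macaulay tangent cone at the origin if and only if (1) $a_3\le a_{31}+a_{34}$, (2) $a_{12}+a_{34}\le a_{41}+a_{23}$, and (3) either $a_{23}<a_{13}$ and $a_2+a_{12}\le a_{41}+2a_{23}+a_{24}-a_{34}$, or $a_{13}\le a_{23}$ and $a_2+a_{12}\le a_1+a_{23}-a_{13}+a_{24}$.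
   Context: $K$ is a field and $n_1,\dots,n_4$ are positive integers with $\gcd(n_1,\dots,n_4)=1$. $I(C)$ is the kernel of the $K$-algebra homomorphism $K[x_1,\dots,x_4]\to K[t]$, $x_i\mapsto t^{n_i}$. $C$ is Gorenstein if the semigroup $\mathcal{S}=\{g_1n_1+\cdots+g_4n_4: g_i\in\mathbb{N}\}$ is symmetric ($\mathbb{N}$ = non-negative integers). In the description of $I(C)$, all exponents are integers with $0<a_{ij}<a_j$, and (by Bresinsky) $a_1=a_{31}+a_{41}$, $a_2=a_{12}+a_{42}$, $a_3=a_{13}+a_{23}$, $a_4=a_{24}+a_{34}$. $C$ has Cohen-Macaulay tangent cone at the origin if the ring $K[x_1,\dots,x_4]/I(C)_*$ is Cohen-Macaulay, where $I(C)_*$ is generated by the homogeneous (standard grading) summands $f_*$ of least degree of the polynomials $f\in I(C)$. *)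

theory Defs
  imports
    "HOL-Library.Poly_Mapping"
    "HOL-Library.Numeral_Type"
    "HOL-Library.Extended_Nat"
    "HOL-Computational_Algebra.Polynomial"
    "HOL-Algebra.QuotRing"
    "HOL-Algebra.Ring_Divisibility"
    "HOL-Algebra.Algebraic_Closure_Type"
begin

section \<open>Cohen--Macaulay rings\<close>

definition krull_dim :: "('a, 'b) ring_scheme \<Rightarrow> enat" where
  "krull_dim R = Sup {enat k | k. \<exists>P :: nat \<Rightarrow> 'a set.
     (\<forall>i\<le>k. primeideal (P i) R) \<and> (\<forall>i<k. P i \<subset> P (Suc i))}"

text \<open>The first conjunct after the carrier condition says that \<open>xs ! i\<close> is not a zero divisor
  on \<open>R / (xs ! 0, \<dots>, xs ! (i - 1))\<close>; the last one says that \<open>R / (xs) \<noteq> 0\<close>.\<close>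

definition regular_sequence :: "('a, 'b) ring_scheme \<Rightarrow> 'a list \<Rightarrow> bool" where
  "regular_sequence R xs \<longleftrightarrow>
     set xs \<subseteq> carrier R \<and>
     (\<forall>i<length xs. \<forall>y\<in>carrier R.
        (xs ! i) \<otimes>\<^bsub>R\<^esub> y \<in> Idl\<^bsub>R\<^esub> (set (take i xs)) \<longrightarrow> y \<in> Idl\<^bsub>R\<^esub> (set (take i xs))) \<and>
     Idl\<^bsub>R\<^esub> (set xs) \<noteq> carrier R"

definition depth :: "('a, 'b) ring_scheme \<Rightarrow> 'a set \<Rightarrow> enat" where
  "depth R I = Sup {enat (length xs) | xs. set xs \<subseteq> I \<and> regular_sequence R xs}"

text \<open>The localization of \<open>R\<close> at a prime ideal \<open>p\<close>: \<open>loc_frac R p a s\<close> is the fraction \<open>a / s\<close>, i.e. the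
  class of \<open>(a, s)\<close>, where \<open>a / s = b / t\<close> iff \<open>u (a t - b s) = 0\<close> for some \<open>u \<notin> p\<close>. The
  operations are defined on classes as unions over all representatives, which all contribute
  the same class.\<close>

definition loc_frac :: "('a, 'b) ring_scheme \<Rightarrow> 'a set \<Rightarrow> 'a \<Rightarrow> 'a \<Rightarrow> ('a \<times> 'a) set" where
  "loc_frac R p a s = {(b, t). b \<in> carrier R \<and> t \<in> carrier R - p \<and>
     (\<exists>u\<in>carrier R - p. u \<otimes>\<^bsub>R\<^esub> ((a \<otimes>\<^bsub>R\<^esub> t) \<ominus>\<^bsub>R\<^esub> (b \<otimes>\<^bsub>R\<^esub> s)) = \<zero>\<^bsub>R\<^esub>)}"

definition localization :: "('a, 'b) ring_scheme \<Rightarrow> 'a set \<Rightarrow> ('a \<times> 'a) set ring" where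
  "localization R p =
     \<lparr>carrier = {loc_frac R p a s | a s. a \<in> carrier R \<and> s \<in> carrier R - p},
      monoid.mult = (\<lambda>A B. \<Union>(a, s)\<in>A. \<Union>(b, t)\<in>B. loc_frac R p (a \<otimes>\<^bsub>R\<^esub> b) (s \<otimes>\<^bsub>R\<^esub> t)),
      one = loc_frac R p \<one>\<^bsub>R\<^esub> \<one>\<^bsub>R\<^esub>,
      ring.zero = loc_frac R p \<zero>\<^bsub>R\<^esub> \<one>\<^bsub>R\<^esub>,
      add = (\<lambda>A B. \<Union>(a, s)\<in>A. \<Union>(b, t)\<in>B.
               loc_frac R p ((a \<otimes>\<^bsub>R\<^esub> t) \<oplus>\<^bsub>R\<^esub> (b \<otimes>\<^bsub>R\<^esub> s)) (s \<otimes>\<^bsub>R\<^esub> t))\<rparr>"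

text \<open>To be used for Noetherian rings only; the Noetherian hypothesis is imposed on the global
  ring in \<open>cohen_macaulay\<close> and is inherited by localizations.\<close>

definition cohen_macaulay_local :: "('a, 'b) ring_scheme \<Rightarrow> bool" where
  "cohen_macaulay_local R \<longleftrightarrow> (\<exists>m. {M. maximalideal M R} = {m} \<and> depth R m = krull_dim R)"

definition cohen_macaulay :: "('a, 'b) ring_scheme \<Rightarrow> bool" where
  "cohen_macaulay R \<longleftrightarrow> cring R \<and> noetherian_ring R \<and>
     (\<forall>m. maximalideal m R \<longrightarrow> cohen_macaulay_local (localization R m))"


section \<open>Polynomials in four variables\<close>

text \<open>Variables are indexed by the four-element type \<open>4\<close>, whose elements are written
  \<open>1, 2, 3, 4\<close> (note that \<open>4 = 0\<close> in this type). Since every exponent vector has finite support,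
  the type \<open>'k mpoly4\<close> is all of \<open>K[x_1, x_2, x_3, x_4]\<close>.\<close>

type_synonym 'k mpoly4 = "(4 \<Rightarrow>\<^sub>0 nat) \<Rightarrow>\<^sub>0 'k"

definition indet :: "4 \<Rightarrow> 'k::field mpoly4" where
  "indet i = Poly_Mapping.single (Poly_Mapping.single i 1) 1"

abbreviation poly_ring :: "'k::field mpoly4 ring" where
  "poly_ring \<equiv> ring_of_type_algebra"

definition minimally_generates :: "'k::field mpoly4 list \<Rightarrow> 'k mpoly4 set \<Rightarrow> bool" where
  "minimally_generates fs I \<longleftrightarrow>
     distinct fs \<and> Idl\<^bsub>poly_ring\<^esub> (set fs) = I \<and>
     (\<forall>S. S \<subset> set fs \<longrightarrow> Idl\<^bsub>poly_ring\<^esub> S \<noteq> I)"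

definition total_degree :: "(4 \<Rightarrow>\<^sub>0 nat) \<Rightarrow> nat" where
  "total_degree m = (\<Sum>i\<in>UNIV. Poly_Mapping.lookup m i)"

definition homogeneous_component :: "nat \<Rightarrow> 'k::field mpoly4 \<Rightarrow> 'k mpoly4" where
  "homogeneous_component d f =
     (\<Sum>m | m \<in> Poly_Mapping.keys f \<and> total_degree m = d. Poly_Mapping.single m (Poly_Mapping.lookup f m))"

text \<open>The homogeneous summand of least degree (for \<open>f = 0\<close> this is \<open>0\<close>, since the sum is
  then empty in every degree).\<close>

definition initial_form :: "'k::field mpoly4 \<Rightarrow> 'k mpoly4" where
  "initial_form f = homogeneous_component (Min (total_degree ` Poly_Mapping.keys f)) f"

definition tangent_cone_ideal :: "'k::field mpoly4 set \<Rightarrow> 'k mpoly4 set" where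
  "tangent_cone_ideal I = Idl\<^bsub>poly_ring\<^esub> (initial_form ` I)"


section \<open>Monomial curves\<close>

text \<open>The curve \<open>x_i = t^{n_i}\<close> is represented by its exponents \<open>n\<close>.
  The \<open>K\<close>-algebra homomorphism with \<open>x_i \<mapsto> t^{n_i}\<close>:\<close>

definition curve_hom :: "(4 \<Rightarrow> nat) \<Rightarrow> 'k::field mpoly4 \<Rightarrow> 'k poly" where
  "curve_hom n f =
     (\<Sum>m\<in>Poly_Mapping.keys f. smult (Poly_Mapping.lookup f m) (\<Prod>i\<in>UNIV. (Polynomial.monom 1 (n i)) ^ Poly_Mapping.lookup m i))"

definition curve_ideal :: "(4 \<Rightarrow> nat) \<Rightarrow> 'k::field mpoly4 set" where
  "curve_ideal n = {f. curve_hom n f = 0}"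

text \<open>The ideal has height \<open>3\<close>, so a complete intersection is one generated by \<open>3\<close> elements.\<close>

definition complete_intersection :: "'k::field mpoly4 set \<Rightarrow> bool" where
  "complete_intersection I \<longleftrightarrow> (\<exists>S. finite S \<and> card S = 3 \<and> Idl\<^bsub>poly_ring\<^esub> S = I)"

definition semigroup_of :: "(4 \<Rightarrow> nat) \<Rightarrow> nat set" where
  "semigroup_of n = {\<Sum>i\<in>UNIV. g i * n i | g. True}"

text \<open>\<open>F\<close> is the Frobenius number, the largest integer outside the semigroup (\<open>- 1\<close> if the
  semigroup is all of \<open>\<nat>\<close>).\<close>

definition symmetric_semigroup :: "nat set \<Rightarrow> bool" where
  "symmetric_semigroup S \<longleftrightarrow>
     (\<exists>F::int. F \<notin> int ` S \<and> (\<forall>z>F. z \<in> int ` S) \<and>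
               (\<forall>z. z \<notin> int ` S \<longrightarrow> F - z \<in> int ` S))"

definition gorenstein_curve :: "(4 \<Rightarrow> nat) \<Rightarrow> bool" where
  "gorenstein_curve n \<longleftrightarrow> symmetric_semigroup (semigroup_of n)"

definition cohen_macaulay_tangent_cone :: "'k::field mpoly4 set \<Rightarrow> bool" where
  "cohen_macaulay_tangent_cone I \<longleftrightarrow> cohen_macaulay (poly_ring Quot (tangent_cone_ideal I))"

end

theory Submission
  imports Defs
begin

text \<open>Let \<open>S\<close> be the semigroup generated by \<open>n 1, \<dots>, n 4\<close>. A monomial has a weight, the exponent of its image
in \<open>K[t]\<close>, and a total degree; call it maximal if no monomial of the same weight has larger degree.
In \<open>K[x] / I(C)\<^sub>*\<close> the monomials that are not maximal vanish, because they are initial forms of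
binomials, and maximal monomials of equal weight are identified. So this ring has a basis indexed
by \<open>S\<close>, and \<open>I(C)\<^sub>*\<close> consists of the polynomials whose coefficients over the maximal monomials of each
weight add up to zero (\<open>tangent_cone_ideal_eq\<close>).

Since \<open>n 1\<close> is smallest, \<open>x\<^sub>2, x\<^sub>3, x\<^sub>4\<close> are nilpotent on the tangent cone while the powers of \<open>x\<^sub>1\<close> stay
independent: the tangent cone is a line with nilpotents. All its local rings have dimension one, and
they are Cohen--Macaulay as soon as they have a regular non-unit. If \<open>x\<^sub>1\<close> is regular, then so is every
nonzero polynomial in \<open>x\<^sub>1\<close>, and each maximal ideal contains one. If \<open>x\<^sub>1\<close> is not regular, multiplying
an element killed by \<open>x\<^sub>1\<close> by the nilpotent variables as long as possible leaves a socle element at the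
origin. Hence the tangent cone is Cohen--Macaulay iff multiplication by \<open>x\<^sub>1\<close> preserves maximal
monomials (\<open>cohen_macaulay_tangent_cone_iff\<close>).

The rest is combinatorics of exponent vectors. That \<open>f\<^sub>1, \<dots>, f\<^sub>5\<close> generate \<open>I(C)\<close> means that two monomials
of equal weight are connected by the corresponding moves
(\<open>invariant_constant_on_weights\<close>); the relations \<open>a1 = a31 + a41\<close>, etc. follow from this and from the
weights of the \<open>f\<^sub>i\<close> (\<open>exponent_relations\<close>). If \<open>x\<^sub>1\<close> preserves maximality, then every weight class that
contains a multiple of \<open>x\<^sub>1\<close> has one of largest degree. Applied to the classes of \<open>x\<^sub>3\<^bsup>a3\<^esup>\<close>,
\<open>x\<^sub>2\<^bsup>a12\<^esup> x\<^sub>4\<^bsup>a34\<^esup>\<close> and \<open>x\<^sub>2\<^bsup>a2 + a12\<^esup>\<close>, which are small enough to be listed, this gives the three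
conditions. Conversely, the conditions say that the moves, together with a sixth one for
\<open>x\<^sub>2\<^bsup>a2 + a12\<^esup>\<close>, can be oriented so that they never decrease the degree and always replace monomials in
\<open>x\<^sub>2, x\<^sub>3, x\<^sub>4\<close> only. All critical pairs of the oriented moves are joinable (this is a standard basis
computation), so any two monomials of equal weight have a common reduct: it has at least the degree
of both, and it is a multiple of \<open>x\<^sub>1\<close> if one of them is (\<open>regular_iff\<close>).\<close>

section \<open>Local rings that are discrete valuation rings modulo nilpotents\<close>

definition (in cring) radical :: "'a set \<Rightarrow> 'a set" where
  "radical I = {a \<in> carrier R. \<exists>k::nat. a [^] k \<in> I}"

text \<open>The extra factor \<open>c\<close> replaces the binomial theorem: one factor \<open>a \<oplus> b\<close> is split off, and its summands
are absorbed into \<open>c\<close>, which lowers \<open>m\<close> in one half and \<open>n\<close> in the other.\<close>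

lemma (in cring) mult_power_add_mem:
  fixes m n :: nat
  assumes I: "ideal I R" and "a \<in> carrier R" "b \<in> carrier R"
  shows "c \<in> carrier R \<Longrightarrow> a [^] m \<otimes> c \<in> I \<Longrightarrow> b [^] n \<otimes> c \<in> I \<Longrightarrow> (a \<oplus> b) [^] (m + n) \<otimes> c \<in> I"
proof (induction "m + n" arbitrary: m n c)
  case 0
  then show ?case by simp
next
  case (Suc k)
  interpret ideal I R by (fact I)
  note [simp] = assms(2,3) Suc.prems(1)
  consider "m = 0" | "n = 0" | m' n' where "m = Suc m'" "n = Suc n'"
    by (metis not0_implies_Suc)
  then show ?case
  proof cases
    case 1
    then show ?thesis using Suc.prems I_l_closed[of c "(a \<oplus> b) [^] n"] by simp
  next
    case 2
    then show ?thesis using Suc.prems I_l_closed[of c "(a \<oplus> b) [^] m"] by simp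
  next
    case 3
    have "a [^] m' \<otimes> (a \<otimes> c) \<in> I" using Suc.prems 3 by (simp add: m_assoc)
    moreover have "b [^] n \<otimes> (a \<otimes> c) \<in> I"
      using I_l_closed[OF Suc.prems(3), of a] by (simp add: m_ac)
    ultimately have 1: "(a \<oplus> b) [^] (m' + n) \<otimes> (a \<otimes> c) \<in> I"
      using Suc.hyps(2) 3 by (intro Suc.hyps(1)) simp_all
    have "a [^] m \<otimes> (b \<otimes> c) \<in> I"
      using I_l_closed[OF Suc.prems(2), of b] by (simp add: m_ac)
    moreover have "b [^] n' \<otimes> (b \<otimes> c) \<in> I" using Suc.prems 3 by (simp add: m_assoc)
    ultimately have 2: "(a \<oplus> b) [^] (m + n') \<otimes> (b \<otimes> c) \<in> I"
      using Suc.hyps(2) 3 by (intro Suc.hyps(1)) simp_all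
    have "(a \<oplus> b) [^] (m + n) \<otimes> c = (a \<oplus> b) [^] (m' + n) \<otimes> (a \<oplus> b) \<otimes> c"
      using 3 by simp
    also have "\<dots> = (a \<oplus> b) [^] (m' + n) \<otimes> (a \<otimes> c) \<oplus> (a \<oplus> b) [^] (m' + n) \<otimes> (b \<otimes> c)"
      by (simp add: l_distr r_distr m_assoc)
    finally show ?thesis using 1 2 3 by simp
  qed
qed

lemma (in cring) radical_ideal:
  assumes "ideal I R"
  shows "ideal (radical I) R"
proof -
  interpret ideal I R by fact
  have add: "a \<oplus> b \<in> radical I" if "a \<in> radical I" "b \<in> radical I" for a b
  proof -
    from that obtain m n :: nat where "a \<in> carrier R" "b \<in> carrier R" "a [^] m \<in> I" "b [^] n \<in> I"
      by (auto simp: radical_def)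
    then show ?thesis
      using mult_power_add_mem[OF assms, of a b \<one> m n] by (auto simp: radical_def)
  qed
  have mult: "x \<otimes> a \<in> radical I" if "a \<in> radical I" "x \<in> carrier R" for a x
  proof -
    from that obtain m :: nat where "a \<in> carrier R" "a [^] m \<in> I"
      by (auto simp: radical_def)
    then have "(x \<otimes> a) [^] m \<in> I"
      using that by (simp add: nat_pow_distrib I_l_closed)
    then show ?thesis using that \<open>a \<in> carrier R\<close> by (auto simp: radical_def)
  qed
  have neg: "\<ominus> a \<in> radical I" if "a \<in> radical I" for a
  proof -
    have "a \<in> carrier R" using that by (auto simp: radical_def)
    then have "\<ominus> a = \<ominus> \<one> \<otimes> a" by (simp add: l_minus)
    then show ?thesis using mult[OF that, of "\<ominus> \<one>"] by simp
  qed
  have zero: "\<zero> \<in> radical I" unfolding radical_def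
    by (intro CollectI conjI exI[of _ "1::nat"]) simp_all
  show ?thesis
  proof (rule idealI)
    show "subgroup (radical I) (add_monoid R)"
      using add neg zero by unfold_locales (auto simp: radical_def simp flip: a_inv_def)
    show "x \<otimes> a \<in> radical I" "a \<otimes> x \<in> radical I" if "a \<in> radical I" "x \<in> carrier R" for a x
      using mult[OF that] that by (auto simp: radical_def m_comm)
  qed (rule ring_axioms)
qed

lemma (in primeideal) power_mem_imp_mem:
  "a \<in> carrier R \<Longrightarrow> a [^] (k::nat) \<in> I \<Longrightarrow> a \<in> I"
proof (induction k)
  case 0
  then show ?case using one_imp_carrier I_notcarr by simp
next
  case (Suc k)
  then show ?case using I_prime[of "a [^] k" a] by auto
qed

lemma (in cring) mem_cgenideal_iff: "x \<in> PIdl a \<longleftrightarrow> (\<exists>y\<in>carrier R. x = y \<otimes> a)"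
  by (auto simp: cgenideal_def)

text \<open>A ring whose reduction is a discrete valuation ring with uniformizer \<open>w\<close> satisfies these axioms: up to
nilpotents, every non-nilpotent element is a unit times a power of \<open>w\<close>. They suffice to know all prime ideals, so
that Krull dimension and depth can be read off from their definitions.\<close>

locale almost_dvr = cring +
  fixes w
  assumes w_carrier [simp]: "w \<in> carrier R"
    and w_nonunit: "w \<notin> Units R"
    and w_not_nilpotent: "w [^] (j::nat) \<noteq> \<zero>"
    and divides_power: "z \<in> carrier R \<Longrightarrow>
      (\<exists>k::nat. z [^] k = \<zero>) \<or> (\<exists>j::nat. \<exists>y\<in>carrier R. w [^] j = y \<otimes> z)"
    and power_divided: "z \<in> carrier R \<Longrightarrow> z \<notin> Units R \<Longrightarrow> \<exists>k::nat. \<exists>y\<in>carrier R. z [^] k = y \<otimes> w"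
begin

abbreviation "nilrad \<equiv> radical {\<zero>}"
abbreviation "nonunits \<equiv> carrier R - Units R"

lemma mem_nilrad_iff: "x \<in> nilrad \<longleftrightarrow> x \<in> carrier R \<and> (\<exists>k::nat. x [^] k = \<zero>)"
  unfolding radical_def by blast

lemma nilrad_ideal: "ideal nilrad R"
  by (rule radical_ideal[OF zeroideal])

lemma Units_power_D: "z \<in> carrier R \<Longrightarrow> z [^] (k::nat) = y \<otimes> w \<Longrightarrow> y \<in> carrier R \<Longrightarrow> z \<notin> Units R"
  by (metis Units_pow_closed m_comm unit_factor w_carrier w_nonunit)

text \<open>Being a radical, the set of non-units is an ideal, so the ring is local.\<close>

lemma nonunits_eq: "nonunits = radical (PIdl w)"
  unfolding radical_def
  using power_divided Units_power_D by (auto simp: mem_cgenideal_iff) 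

lemma nonunits_ideal: "ideal nonunits R"
  unfolding nonunits_eq by (intro radical_ideal cgenideal_ideal) simp

lemma one_not_zero: "\<one> \<noteq> \<zero>"
  using w_not_nilpotent[of 0] by simp

lemma proper_ideal_subset: "ideal I R \<Longrightarrow> I \<noteq> carrier R \<Longrightarrow> I \<subseteq> nonunits"
proof
  fix x assume I: "ideal I R" "I \<noteq> carrier R" and x: "x \<in> I"
  interpret ideal I R by fact
  have "x \<notin> Units R"
  proof
    assume "x \<in> Units R"
    then have "inv x \<otimes> x = \<one>" "inv x \<in> carrier R" by auto
    then have "\<one> \<in> I" using I_l_closed[OF x] by metis
    then show False using one_imp_carrier I(2) by blast
  qed
  then show "x \<in> nonunits" using Icarr[OF x] by blast
qed

lemma nonunits_prime: "primeideal nonunits R"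
proof (rule primeidealI[OF nonunits_ideal is_cring])
  show "carrier R \<noteq> nonunits" using Units_one_closed by blast
  show "a \<in> nonunits \<or> b \<in> nonunits" if "a \<in> carrier R" "b \<in> carrier R" "a \<otimes> b \<in> nonunits" for a b
    using that by auto
qed

lemma w_notin_nilrad: "w \<notin> nilrad"
  using w_not_nilpotent by (auto simp: radical_def)

lemma nilrad_prime: "primeideal nilrad R"
proof (rule primeidealI[OF nilrad_ideal is_cring])
  interpret N: ideal nilrad R by (rule nilrad_ideal)
  show "carrier R \<noteq> nilrad" using w_notin_nilrad w_carrier by blast
  fix a b assume ab: "a \<in> carrier R" "b \<in> carrier R" "a \<otimes> b \<in> nilrad"
  show "a \<in> nilrad \<or> b \<in> nilrad"
  proof (rule ccontr)
    assume "\<not> (a \<in> nilrad \<or> b \<in> nilrad)"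
    then obtain i j :: nat and x y where xy: "x \<in> carrier R" "y \<in> carrier R"
      and eq: "w [^] i = x \<otimes> a" "w [^] j = y \<otimes> b"
      using divides_power[OF ab(1)] divides_power[OF ab(2)] ab(1,2) mem_nilrad_iff by blast
    have "w [^] (i + j) = (x \<otimes> a) \<otimes> (y \<otimes> b)"
      using eq by (simp add: nat_pow_mult[symmetric])
    also have "\<dots> = (x \<otimes> y) \<otimes> (a \<otimes> b)"
      using xy ab by (simp add: m_ac)
    finally have "w [^] (i + j) \<in> nilrad"
      using xy ab N.I_l_closed[of "a \<otimes> b" "x \<otimes> y"] by simp
    then obtain k :: nat where "(w [^] (i + j)) [^] k = \<zero>"
      using mem_nilrad_iff by blast
    then show False using w_not_nilpotent by (simp add: nat_pow_pow)
  qed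
qed

lemma nilrad_subset_nonunits: "nilrad \<subset> nonunits"
proof
  show "nilrad \<subseteq> nonunits"
    using proper_ideal_subset[OF nilrad_ideal] w_notin_nilrad w_carrier by blast
  show "nilrad \<noteq> nonunits" using w_notin_nilrad w_nonunit w_carrier by blast
qed

text \<open>A prime ideal contains the nilpotents; if it contains anything else, it contains a power of \<open>w\<close>, hence
\<open>w\<close>, hence all non-units.\<close>

lemma prime_cases:
  assumes "primeideal Q R"
  shows "Q = nilrad \<or> Q = nonunits"
proof -
  interpret Q: primeideal Q R by fact
  have sub: "nilrad \<subseteq> Q"
  proof
    fix x assume "x \<in> nilrad"
    then obtain k :: nat where "x \<in> carrier R" "x [^] k = \<zero>"
      unfolding radical_def by blast
    then show "x \<in> Q" using Q.power_mem_imp_mem[of x k] Q.zero_closed by simp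
  qed
  have sup: "Q \<subseteq> nonunits"
    using proper_ideal_subset[OF Q.is_ideal] Q.I_notcarr by blast
  have "nonunits \<subseteq> Q" if "z \<in> Q" "z \<notin> nilrad" for z
  proof -
    have z: "z \<in> carrier R" using that(1) by (rule Q.Icarr)
    with that obtain j :: nat and y where "y \<in> carrier R" "w [^] j = y \<otimes> z"
      using divides_power[of z] by (auto simp: radical_def)
    then have "w \<in> Q" using Q.I_l_closed[OF that(1)] Q.power_mem_imp_mem[of w j] by simp
    show ?thesis
    proof
      fix x assume x: "x \<in> nonunits"
      then obtain k :: nat and y where "y \<in> carrier R" "x [^] k = y \<otimes> w"
        using power_divided[of x] by auto
      then have "x [^] k \<in> Q" using \<open>w \<in> Q\<close> Q.I_l_closed by simp
      then show "x \<in> Q" using x Q.power_mem_imp_mem by blast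
    qed
  qed
  then show ?thesis using sub sup by blast
qed

lemma krull_dim_eq_1: "krull_dim R = 1"
  unfolding krull_dim_def
proof (rule antisym)
  let ?A = "{enat k |k. \<exists>P :: nat \<Rightarrow> 'a set. (\<forall>i\<le>k. primeideal (P i) R) \<and> (\<forall>i<k. P i \<subset> P (Suc i))}"
  show "Sup ?A \<le> 1"
  proof (rule Sup_least, clarify)
    fix k P assume P: "\<forall>i\<le>k. primeideal (P i) R" "\<forall>i<k. P i \<subset> P (Suc i)"
    show "enat k \<le> 1"
    proof (rule ccontr)
      assume "\<not> enat k \<le> 1"
      then have "2 \<le> k" by (simp add: one_enat_def)
      then have "P 0 \<subset> P 1" "P 1 \<subset> P 2" "P 0 = nilrad \<or> P 0 = nonunits"
        "P 1 = nilrad \<or> P 1 = nonunits" "P 2 = nilrad \<or> P 2 = nonunits"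
        using P prime_cases by (auto simp: numeral_2_eq_2)
      then show False using nilrad_subset_nonunits by blast
    qed
  qed
  define P where "P = (\<lambda>i::nat. case i of 0 \<Rightarrow> nilrad | Suc _ \<Rightarrow> nonunits)"
  have P: "P 0 = nilrad" "P (Suc i) = nonunits" for i
    by (simp_all only: P_def nat.case)
  have "primeideal (P i) R" for i
    using nilrad_prime nonunits_prime P by (cases i) metis+
  moreover have "P i \<subset> P (Suc i)" if "i < 1" for i
    using nilrad_subset_nonunits P that by (metis less_one)
  ultimately have "enat 1 \<in> ?A" by blast
  then show "1 \<le> Sup ?A" by (simp add: Sup_upper one_enat_def)
qed

lemma maximalideals: "{M. maximalideal M R} = {nonunits}"
proof -
  have "maximalideal nonunits R"
  proof (rule maximalidealI[OF nonunits_ideal])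
    show "carrier R \<noteq> nonunits" using Units_one_closed by blast
    show "J = nonunits \<or> J = carrier R" if "ideal J R" "nonunits \<subseteq> J" for J
      using proper_ideal_subset that by blast
  qed
  moreover have "M = nonunits" if "maximalideal M R" for M
  proof -
    interpret M: maximalideal M R by fact
    have "M \<subseteq> nonunits" using proper_ideal_subset[OF M.is_ideal] M.I_notcarr by blast
    then show ?thesis using M.I_maximal[OF nonunits_ideal] Units_one_closed by blast
  qed
  ultimately show ?thesis by blast
qed

text \<open>If \<open>a, b\<close> begin a regular sequence, then \<open>a\<close> is not nilpotent, so \<open>a\<close> divides a power of \<open>w\<close>, which in turn
divides a power of \<open>b\<close>. Regularity of \<open>b\<close> modulo \<open>a\<close> then removes the factors \<open>b\<close> one by one until \<open>a\<close>
divides \<open>1\<close>.\<close>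

lemma regular_sequence_length:
  assumes "regular_sequence R xs" "set xs \<subseteq> nonunits"
  shows "length xs \<le> 1"
proof (rule ccontr)
  assume "\<not> length xs \<le> 1"
  then obtain a b ys where xs: "xs = a # b # ys"
    by (cases xs; cases "tl xs") auto
  have ab: "a \<in> nonunits" "b \<in> nonunits" using assms(2) xs by auto
  have a: "y \<in> Idl {}" if "y \<in> carrier R" "a \<otimes> y \<in> Idl {}" for y
    using assms(1) that xs by (auto simp: regular_sequence_def)
  have Idl0: "Idl {} = {\<zero>}"
    using genideal_minimal[OF zeroideal, of "{}"] additive_subgroup.zero_closed[OF ideal.axioms(1)[OF genideal_ideal[of "{}"]]]
    by auto
  have b: "y \<in> PIdl a" if "y \<in> carrier R" "b \<otimes> y \<in> PIdl a" for y
  proof -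
    have "\<forall>y\<in>carrier R. b \<otimes> y \<in> Idl {a} \<longrightarrow> y \<in> Idl {a}"
      using assms(1) xs unfolding regular_sequence_def by (auto dest!: spec[of _ "1::nat"])
    then show ?thesis using that ab cgenideal_eq_genideal[of a] by auto
  qed
  have "a [^] k \<noteq> \<zero>" for k :: nat
  proof (induction k)
    case (Suc k)
    then show ?case using a[of "a [^] k"] ab Idl0 by (auto simp: m_comm)
  qed (simp add: one_not_zero)
  then obtain j :: nat and y where y: "y \<in> carrier R" "w [^] j = y \<otimes> a"
    using divides_power[of a] ab by auto
  obtain k :: nat and x where x: "x \<in> carrier R" "b [^] k = x \<otimes> w"
    using power_divided[of b] ab by auto
  \<comment> \<open>The chain of divisibilities from \<open>a\<close> through \<open>w\<close> to \<open>b\<close>.\<close>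
  have "b [^] (k * j) = (x [^] j \<otimes> y) \<otimes> a"
    using x y ab by (simp add: nat_pow_pow[symmetric] nat_pow_distrib m_assoc)
  then have "b [^] (k * j) \<in> PIdl a"
    using x y by (auto simp: mem_cgenideal_iff)
  moreover have "b [^] i \<notin> PIdl a" for i :: nat
  proof (induction i)
    case 0
    show ?case
    proof
      assume "b [^] (0::nat) \<in> PIdl a"
      then obtain v where "v \<in> carrier R" "\<one> = v \<otimes> a" by (auto simp: mem_cgenideal_iff)
      then show False using ab by (metis DiffD1 DiffD2 Units_one_closed m_comm unit_factor)
    qed
  next
    case (Suc i)
    then show ?case using b[of "b [^] i"] ab by (auto simp: m_comm)
  qed
  ultimately show False by blast
qed

lemma cohen_macaulay_local_iff:
  "cohen_macaulay_local R \<longleftrightarrow> (\<exists>z\<in>nonunits. \<forall>y\<in>carrier R. z \<otimes> y = \<zero> \<longrightarrow> y = \<zero>)"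
proof -
  let ?D = "{enat (length xs) |xs. set xs \<subseteq> nonunits \<and> regular_sequence R xs}"
  have Idl0: "Idl {} = {\<zero>}"
    using genideal_minimal[OF zeroideal, of "{}"] additive_subgroup.zero_closed[OF ideal.axioms(1)[OF genideal_ideal[of "{}"]]]
    by auto
  have "depth R nonunits = 1 \<longleftrightarrow> (\<exists>z\<in>nonunits. \<forall>y\<in>carrier R. z \<otimes> y = \<zero> \<longrightarrow> y = \<zero>)"
  proof
    assume "depth R nonunits = 1"
    then have "\<not> Sup ?D \<le> 0" by (simp add: depth_def)
    then obtain xs where xs: "set xs \<subseteq> nonunits" "regular_sequence R xs" "length xs \<noteq> 0"
      by (auto simp: Sup_le_iff zero_enat_def)
    then obtain z zs where "xs = z # zs" by (cases xs) auto
    then have "z \<in> nonunits" "\<forall>y\<in>carrier R. z \<otimes> y \<in> Idl {} \<longrightarrow> y \<in> Idl {}"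
      using xs by (auto simp: regular_sequence_def)
    then show "\<exists>z\<in>nonunits. \<forall>y\<in>carrier R. z \<otimes> y = \<zero> \<longrightarrow> y = \<zero>"
      unfolding Idl0 by blast
  next
    assume "\<exists>z\<in>nonunits. \<forall>y\<in>carrier R. z \<otimes> y = \<zero> \<longrightarrow> y = \<zero>"
    then obtain z where z: "z \<in> nonunits" "\<forall>y\<in>carrier R. z \<otimes> y = \<zero> \<longrightarrow> y = \<zero>" by blast
    have "Idl {z} \<subseteq> nonunits"
      using z genideal_minimal[OF nonunits_ideal] by blast
    then have "Idl {z} \<noteq> carrier R" using Units_one_closed one_closed by blast
    then have "regular_sequence R [z]"
      using z by (auto simp: regular_sequence_def Idl0)
    then have "enat (length [z]) \<in> ?D" using z(1) by (intro CollectI exI[of _ "[z]"]) auto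
    then have "1 \<le> Sup ?D" by (simp add: Sup_upper one_enat_def)
    moreover have "Sup ?D \<le> 1"
      using regular_sequence_length by (intro Sup_least) (auto simp: one_enat_def)
    ultimately show "depth R nonunits = 1" by (simp add: depth_def)
  qed
  then show ?thesis
    unfolding cohen_macaulay_local_def maximalideals krull_dim_eq_1 by auto
qed

end

section \<open>Localization at a prime ideal\<close>

context primeideal
begin

abbreviation "S \<equiv> carrier R - I"
abbreviation "loc \<equiv> loc_frac R I"
abbreviation "L \<equiv> localization R I"

lemma one_S: "\<one> \<in> S"
  using one_imp_carrier I_notcarr by blast

lemma mult_S: "s \<in> S \<Longrightarrow> t \<in> S \<Longrightarrow> s \<otimes> t \<in> S"
  using I_prime by blast

lemma mult_notin: "s \<in> carrier R \<Longrightarrow> s \<notin> I \<Longrightarrow> t \<in> carrier R \<Longrightarrow> t \<notin> I \<Longrightarrow> s \<otimes> t \<notin> I"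
  using I_prime by blast

lemma pow_S: "s \<in> S \<Longrightarrow> s [^] (k::nat) \<in> S"
  using power_mem_imp_mem by blast

lemma S_carrier: "s \<in> S \<Longrightarrow> s \<in> carrier R"
  by blast

text \<open>The equality of fractions, written without subtraction so that it can be handled by rearranging
products.\<close>

definition loc_rel :: "'a \<Rightarrow> 'a \<Rightarrow> 'a \<Rightarrow> 'a \<Rightarrow> bool" where
  "loc_rel a s b t \<longleftrightarrow> (\<exists>u\<in>S. u \<otimes> (a \<otimes> t) = u \<otimes> (b \<otimes> s))"

lemma loc_rel_iff:
  assumes "a \<in> carrier R" "b \<in> carrier R" "s \<in> S" "t \<in> S"
  shows "loc_rel a s b t \<longleftrightarrow> (\<exists>u\<in>S. u \<otimes> ((a \<otimes> t) \<ominus> (b \<otimes> s)) = \<zero>)"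
proof -
  have "u \<otimes> ((a \<otimes> t) \<ominus> (b \<otimes> s)) = \<zero> \<longleftrightarrow> u \<otimes> (a \<otimes> t) = u \<otimes> (b \<otimes> s)" if "u \<in> S" for u
  proof -
    have c: "u \<in> carrier R" "s \<in> carrier R" "t \<in> carrier R" using that assms S_carrier by blast+
    have "u \<otimes> ((a \<otimes> t) \<ominus> (b \<otimes> s)) = u \<otimes> (a \<otimes> t) \<ominus> u \<otimes> (b \<otimes> s)"
      using c assms(1,2) by (simp add: minus_eq r_distr r_minus)
    then show ?thesis using c assms(1,2) by (simp add: r_right_minus_eq)
  qed
  then show ?thesis unfolding loc_rel_def by blast
qed

lemma mem_loc_iff:
  assumes "a \<in> carrier R" "s \<in> S"
  shows "(b, t) \<in> loc a s \<longleftrightarrow> b \<in> carrier R \<and> t \<in> S \<and> loc_rel a s b t"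
  using assms loc_rel_iff unfolding loc_frac_def by fastforce

lemma loc_rel_refl: "a \<in> carrier R \<Longrightarrow> s \<in> S \<Longrightarrow> loc_rel a s a s"
  unfolding loc_rel_def using one_S by blast

lemma loc_rel_sym: "loc_rel a s b t \<Longrightarrow> loc_rel b t a s"
  unfolding loc_rel_def by metis

lemma loc_rel_trans:
  assumes "loc_rel a s b t" "loc_rel b t c r"
    and "a \<in> carrier R" "b \<in> carrier R" "c \<in> carrier R" "s \<in> S" "t \<in> S" "r \<in> S"
  shows "loc_rel a s c r"
proof -
  obtain u v where uv: "u \<in> S" "v \<in> S" "u \<otimes> (a \<otimes> t) = u \<otimes> (b \<otimes> s)" "v \<otimes> (b \<otimes> r) = v \<otimes> (c \<otimes> t)"
    using assms(1,2) unfolding loc_rel_def by blast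
  have c: "u \<in> carrier R" "v \<in> carrier R" "s \<in> carrier R" "t \<in> carrier R" "r \<in> carrier R"
    using uv assms S_carrier by blast+
  have "(u \<otimes> v \<otimes> t) \<otimes> (a \<otimes> r) = (v \<otimes> r) \<otimes> (u \<otimes> (a \<otimes> t))"
    using c assms(3-5) by (simp add: m_ac)
  also have "\<dots> = (u \<otimes> s) \<otimes> (v \<otimes> (b \<otimes> r))"
    unfolding uv(3) using c assms(3-5) by (simp add: m_ac)
  also have "\<dots> = (u \<otimes> v \<otimes> t) \<otimes> (c \<otimes> s)"
    unfolding uv(4) using c assms(3-5) by (simp add: m_ac)
  finally show ?thesis
    unfolding loc_rel_def using mult_S[OF mult_S] uv(1,2) assms(7) by blast
qed

lemma loc_eq_iff:
  assumes "a \<in> carrier R" "b \<in> carrier R" "s \<in> S" "t \<in> S"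
  shows "loc a s = loc b t \<longleftrightarrow> loc_rel a s b t"
proof
  assume "loc a s = loc b t"
  then have "(b, t) \<in> loc a s"
    using assms mem_loc_iff loc_rel_refl by blast
  then show "loc_rel a s b t" using assms mem_loc_iff by blast
next
  assume rel: "loc_rel a s b t"
  have "(c, r) \<in> loc a s \<longleftrightarrow> (c, r) \<in> loc b t" for c r
    using assms rel loc_rel_trans[OF _ _ assms(1,2) _ assms(3,4)] loc_rel_sym[OF rel]
      loc_rel_trans[OF _ _ assms(2,1) _ assms(4,3)] mem_loc_iff by metis
  then show "loc a s = loc b t" by auto
qed

lemma L_carrier: "carrier L = {loc a s |a s. a \<in> carrier R \<and> s \<in> S}"
  by (simp add: localization_def)

lemma L_cases:
  assumes "z \<in> carrier L"
  obtains a s where "a \<in> carrier R" "s \<in> S" "z = loc a s"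
  using assms unfolding L_carrier by blast

lemma loc_closed [intro]: "a \<in> carrier R \<Longrightarrow> s \<in> S \<Longrightarrow> loc a s \<in> carrier L"
  unfolding L_carrier by blast

lemma L_one: "\<one>\<^bsub>L\<^esub> = loc \<one> \<one>" and L_zero: "\<zero>\<^bsub>L\<^esub> = loc \<zero> \<one>"
  by (simp_all add: localization_def)

lemma UN_const_on:
  assumes "x0 \<in> A" "\<And>x. x \<in> A \<Longrightarrow> F x = c"
  shows "(\<Union>x\<in>A. F x) = c"
  using assms by auto

lemma L_mult:
  assumes a: "a \<in> carrier R" and b: "b \<in> carrier R" and s: "s \<in> S" and t: "t \<in> S"
  shows "loc a s \<otimes>\<^bsub>L\<^esub> loc b t = loc (a \<otimes> b) (s \<otimes> t)"
proof -
  have eq: "loc (a' \<otimes> b') (s' \<otimes> t') = loc (a \<otimes> b) (s \<otimes> t)"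
    if "(a', s') \<in> loc a s" "(b', t') \<in> loc b t" for a' s' b' t'
  proof -
    have car: "a' \<in> carrier R" "b' \<in> carrier R" "s' \<in> S" "t' \<in> S"
      and "loc_rel a s a' s'" "loc_rel b t b' t'"
      using that mem_loc_iff a b s t by blast+
    then obtain u v where uv: "u \<in> S" "v \<in> S" "u \<otimes> (a \<otimes> s') = u \<otimes> (a' \<otimes> s)"
      "v \<otimes> (b \<otimes> t') = v \<otimes> (b' \<otimes> t)"
      unfolding loc_rel_def by blast
    have c: "u \<in> carrier R" "v \<in> carrier R" "s \<in> carrier R" "t \<in> carrier R" "s' \<in> carrier R" "t' \<in> carrier R"
      using uv car s t S_carrier by blast+
    have "(u \<otimes> v) \<otimes> ((a \<otimes> b) \<otimes> (s' \<otimes> t')) = (u \<otimes> (a \<otimes> s')) \<otimes> (v \<otimes> (b \<otimes> t'))"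
      using c car(1,2) a b by (simp add: m_ac)
    also have "\<dots> = (u \<otimes> v) \<otimes> ((a' \<otimes> b') \<otimes> (s \<otimes> t))"
      unfolding uv using c car(1,2) a b by (simp add: m_ac)
    finally have "loc_rel (a \<otimes> b) (s \<otimes> t) (a' \<otimes> b') (s' \<otimes> t')"
      unfolding loc_rel_def using mult_S uv(1,2) by blast
    then show ?thesis
      using loc_eq_iff[OF _ _ mult_S mult_S] a b s t car loc_rel_sym by simp
  qed
  have as: "(a, s) \<in> loc a s" "(b, t) \<in> loc b t"
    using mem_loc_iff loc_rel_refl a b s t by blast+
  have "loc a s \<otimes>\<^bsub>L\<^esub> loc b t = (\<Union>x\<in>loc a s. \<Union>y\<in>loc b t. loc (fst x \<otimes> fst y) (snd x \<otimes> snd y))"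
    by (simp add: localization_def case_prod_beta)
  also have "\<dots> = loc (a \<otimes> b) (s \<otimes> t)"
    by (rule UN_const_on[OF as(1)], rule UN_const_on[OF as(2)]) (simp add: eq)
  finally show ?thesis .
qed

lemma L_add:
  assumes a: "a \<in> carrier R" and b: "b \<in> carrier R" and s: "s \<in> S" and t: "t \<in> S"
  shows "loc a s \<oplus>\<^bsub>L\<^esub> loc b t = loc (a \<otimes> t \<oplus> b \<otimes> s) (s \<otimes> t)"
proof -
  have eq: "loc (a' \<otimes> t' \<oplus> b' \<otimes> s') (s' \<otimes> t') = loc (a \<otimes> t \<oplus> b \<otimes> s) (s \<otimes> t)"
    if "(a', s') \<in> loc a s" "(b', t') \<in> loc b t" for a' s' b' t'
  proof -
    have car: "a' \<in> carrier R" "b' \<in> carrier R" "s' \<in> S" "t' \<in> S"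
      and "loc_rel a s a' s'" "loc_rel b t b' t'"
      using that mem_loc_iff a b s t by blast+
    then obtain u v where uv: "u \<in> S" "v \<in> S" "u \<otimes> (a \<otimes> s') = u \<otimes> (a' \<otimes> s)"
      "v \<otimes> (b \<otimes> t') = v \<otimes> (b' \<otimes> t)"
      unfolding loc_rel_def by blast
    have c: "u \<in> carrier R" "v \<in> carrier R" "s \<in> carrier R" "t \<in> carrier R" "s' \<in> carrier R" "t' \<in> carrier R"
      using uv car s t S_carrier by blast+
    have "(u \<otimes> v) \<otimes> ((a \<otimes> t \<oplus> b \<otimes> s) \<otimes> (s' \<otimes> t'))
        = (v \<otimes> t \<otimes> t') \<otimes> (u \<otimes> (a \<otimes> s')) \<oplus> (u \<otimes> s \<otimes> s') \<otimes> (v \<otimes> (b \<otimes> t'))"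
      using c car(1,2) a b by (simp add: m_ac l_distr r_distr)
    also have "\<dots> = (u \<otimes> v) \<otimes> ((a' \<otimes> t' \<oplus> b' \<otimes> s') \<otimes> (s \<otimes> t))"
      unfolding uv using c car(1,2) a b by (simp add: m_ac l_distr r_distr)
    finally have "loc_rel (a \<otimes> t \<oplus> b \<otimes> s) (s \<otimes> t) (a' \<otimes> t' \<oplus> b' \<otimes> s') (s' \<otimes> t')"
      unfolding loc_rel_def using mult_S uv(1,2) by blast
    then show ?thesis
      using loc_eq_iff[OF _ _ mult_S mult_S] a b c s t car loc_rel_sym by simp
  qed
  have as: "(a, s) \<in> loc a s" "(b, t) \<in> loc b t"
    using mem_loc_iff loc_rel_refl a b s t by blast+
  have "loc a s \<oplus>\<^bsub>L\<^esub> loc b t = (\<Union>x\<in>loc a s. \<Union>y\<in>loc b t.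
      loc (fst x \<otimes> snd y \<oplus> fst y \<otimes> snd x) (snd x \<otimes> snd y))"
    by (simp add: localization_def case_prod_beta)
  also have "\<dots> = loc (a \<otimes> t \<oplus> b \<otimes> s) (s \<otimes> t)"
    by (rule UN_const_on[OF as(1)], rule UN_const_on[OF as(2)]) (simp add: eq)
  finally show ?thesis .
qed

lemma loc_eqI:
  assumes "a \<otimes> t = b \<otimes> s" "a \<in> carrier R" "b \<in> carrier R" "s \<in> S" "t \<in> S"
  shows "loc a s = loc b t"
  using assms loc_eq_iff one_S unfolding loc_rel_def by metis

lemma loc_eq_zero_iff:
  assumes "a \<in> carrier R" "s \<in> S"
  shows "loc a s = \<zero>\<^bsub>L\<^esub> \<longleftrightarrow> (\<exists>u\<in>S. u \<otimes> a = \<zero>)"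
  unfolding L_zero using assms loc_eq_iff[OF assms(1) _ assms(2) one_S] S_carrier
  by (auto simp: loc_rel_def)

lemma localization_cring: "cring L"
proof (rule cringI)
  show "abelian_group L"
  proof (rule abelian_groupI)
    show "x \<oplus>\<^bsub>L\<^esub> y \<in> carrier L" if "x \<in> carrier L" "y \<in> carrier L" for x y
      using that by (elim L_cases) (simp add: L_add, intro loc_closed mult_S; simp)
    show "\<zero>\<^bsub>L\<^esub> \<in> carrier L" unfolding L_zero using one_S by blast
    show "x \<oplus>\<^bsub>L\<^esub> y \<oplus>\<^bsub>L\<^esub> z = x \<oplus>\<^bsub>L\<^esub> (y \<oplus>\<^bsub>L\<^esub> z)"
      if xyz: "x \<in> carrier L" "y \<in> carrier L" "z \<in> carrier L" for x y z
    proof -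
      obtain a s where as: "a \<in> carrier R" "s \<in> S" "x = loc a s" by (rule L_cases[OF xyz(1)])
      obtain b t where bt: "b \<in> carrier R" "t \<in> S" "y = loc b t" by (rule L_cases[OF xyz(2)])
      obtain c r where cr: "c \<in> carrier R" "r \<in> S" "z = loc c r" by (rule L_cases[OF xyz(3)])
      have car: "s \<in> carrier R" "t \<in> carrier R" "r \<in> carrier R" using as bt cr by blast+
      have "x \<oplus>\<^bsub>L\<^esub> y \<oplus>\<^bsub>L\<^esub> z = loc ((a \<otimes> t \<oplus> b \<otimes> s) \<otimes> r \<oplus> c \<otimes> (s \<otimes> t)) (s \<otimes> t \<otimes> r)"
        unfolding as(3) bt(3) cr(3)
        by (simp only: L_add as bt cr mult_S a_closed m_closed car)
      moreover have "x \<oplus>\<^bsub>L\<^esub> (y \<oplus>\<^bsub>L\<^esub> z) = loc (a \<otimes> (t \<otimes> r) \<oplus> (b \<otimes> r \<oplus> c \<otimes> t) \<otimes> s) (s \<otimes> (t \<otimes> r))"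
        unfolding as(3) bt(3) cr(3)
        by (simp only: L_add as bt cr mult_S a_closed m_closed car)
      moreover have "(a \<otimes> t \<oplus> b \<otimes> s) \<otimes> r \<oplus> c \<otimes> (s \<otimes> t) = a \<otimes> (t \<otimes> r) \<oplus> (b \<otimes> r \<oplus> c \<otimes> t) \<otimes> s"
        using as(1) bt(1) cr(1) car by algebra
      moreover have "s \<otimes> t \<otimes> r = s \<otimes> (t \<otimes> r)"
        using car by (simp add: m_assoc)
      ultimately show ?thesis by simp
    qed
    show "x \<oplus>\<^bsub>L\<^esub> y = y \<oplus>\<^bsub>L\<^esub> x" if "x \<in> carrier L" "y \<in> carrier L" for x y
      using that by (elim L_cases) (simp add: L_add S_carrier m_ac a_ac)
    show "\<zero>\<^bsub>L\<^esub> \<oplus>\<^bsub>L\<^esub> x = x" if "x \<in> carrier L" for x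
      using that one_S by (elim L_cases) (simp add: L_zero L_add)
    show "\<exists>y\<in>carrier L. y \<oplus>\<^bsub>L\<^esub> x = \<zero>\<^bsub>L\<^esub>" if x: "x \<in> carrier L" for x
    proof -
      obtain a s where as: "a \<in> carrier R" "s \<in> S" "x = loc a s" by (rule L_cases[OF x])
      then have "loc (\<ominus> a) s \<oplus>\<^bsub>L\<^esub> x = loc ((\<ominus> a) \<otimes> s \<oplus> a \<otimes> s) (s \<otimes> s)"
        by (simp add: L_add)
      also have "\<dots> = \<zero>\<^bsub>L\<^esub>"
        unfolding L_zero using as S_carrier mult_S one_S
        by (intro loc_eqI) (simp_all add: l_minus l_neg)
      finally show ?thesis using as by blast
    qed
  qed
  show "comm_monoid L"
  proof (rule comm_monoidI)
    show "x \<otimes>\<^bsub>L\<^esub> y \<in> carrier L" if "x \<in> carrier L" "y \<in> carrier L" for x y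
      using that by (elim L_cases) (simp add: L_mult, intro loc_closed mult_S; simp)
    show "\<one>\<^bsub>L\<^esub> \<in> carrier L" unfolding L_one using one_S by blast
    show "x \<otimes>\<^bsub>L\<^esub> y \<otimes>\<^bsub>L\<^esub> z = x \<otimes>\<^bsub>L\<^esub> (y \<otimes>\<^bsub>L\<^esub> z)"
      if "x \<in> carrier L" "y \<in> carrier L" "z \<in> carrier L" for x y z
      using that by (elim L_cases) (simp add: L_mult mult_notin m_ac)
    show "\<one>\<^bsub>L\<^esub> \<otimes>\<^bsub>L\<^esub> x = x" if "x \<in> carrier L" for x
      using that one_S by (elim L_cases) (simp add: L_one L_mult)
    show "x \<otimes>\<^bsub>L\<^esub> y = y \<otimes>\<^bsub>L\<^esub> x" if "x \<in> carrier L" "y \<in> carrier L" for x y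
      using that by (elim L_cases) (simp add: L_mult S_carrier m_ac)
  qed
  show "(x \<oplus>\<^bsub>L\<^esub> y) \<otimes>\<^bsub>L\<^esub> z = x \<otimes>\<^bsub>L\<^esub> z \<oplus>\<^bsub>L\<^esub> y \<otimes>\<^bsub>L\<^esub> z"
    if xyz: "x \<in> carrier L" "y \<in> carrier L" "z \<in> carrier L" for x y z
  proof -
    obtain a s where as: "a \<in> carrier R" "s \<in> S" "x = loc a s" by (rule L_cases[OF xyz(1)])
    obtain b t where bt: "b \<in> carrier R" "t \<in> S" "y = loc b t" by (rule L_cases[OF xyz(2)])
    obtain c r where cr: "c \<in> carrier R" "r \<in> S" "z = loc c r" by (rule L_cases[OF xyz(3)])
    note car = S_carrier[OF as(2)] S_carrier[OF bt(2)] S_carrier[OF cr(2)]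
    have "(x \<oplus>\<^bsub>L\<^esub> y) \<otimes>\<^bsub>L\<^esub> z = loc ((a \<otimes> t \<oplus> b \<otimes> s) \<otimes> c) (s \<otimes> t \<otimes> r)"
      unfolding as(3) bt(3) cr(3)
      by (simp only: L_add L_mult as bt cr mult_S a_closed m_closed car)
    moreover have "x \<otimes>\<^bsub>L\<^esub> z \<oplus>\<^bsub>L\<^esub> y \<otimes>\<^bsub>L\<^esub> z
        = loc (a \<otimes> c \<otimes> (t \<otimes> r) \<oplus> b \<otimes> c \<otimes> (s \<otimes> r)) (s \<otimes> r \<otimes> (t \<otimes> r))"
      unfolding as(3) bt(3) cr(3)
      by (simp only: L_add L_mult as bt cr mult_S a_closed m_closed car)
    moreover have "\<dots> = loc ((a \<otimes> t \<oplus> b \<otimes> s) \<otimes> c) (s \<otimes> t \<otimes> r)"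
      using as(1,2) bt(1,2) cr(1,2) car
      by (intro loc_eqI mult_S) (simp_all add: l_distr r_distr m_ac)
    ultimately show ?thesis by simp
  qed
qed

lemma loc_pow: "a \<in> carrier R \<Longrightarrow> s \<in> S \<Longrightarrow> loc a s [^]\<^bsub>L\<^esub> (k::nat) = loc (a [^] k) (s [^] k)"
proof (induction k)
  case 0
  show ?case by (simp add: L_one)
next
  case (Suc k)
  then show ?case using pow_S by (simp add: L_mult)
qed

lemma loc_mem_Units_iff:
  assumes "a \<in> carrier R" "s \<in> S"
  shows "loc a s \<in> Units L \<longleftrightarrow> a \<notin> I"
proof
  assume "loc a s \<in> Units L"
  then obtain z where "z \<in> carrier L" "loc a s \<otimes>\<^bsub>L\<^esub> z = \<one>\<^bsub>L\<^esub>"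
    unfolding Units_def by blast
  then obtain b t where bt: "b \<in> carrier R" "t \<in> S" "loc a s \<otimes>\<^bsub>L\<^esub> loc b t = loc \<one> \<one>"
    by (metis L_cases L_one)
  then have "loc_rel (a \<otimes> b) (s \<otimes> t) \<one> \<one>"
    using assms loc_eq_iff[OF _ _ mult_S one_S, of "a \<otimes> b" \<one> s t] by (simp add: L_mult)
  then obtain u where u: "u \<in> S" "u \<otimes> (a \<otimes> b \<otimes> \<one>) = u \<otimes> (\<one> \<otimes> (s \<otimes> t))"
    unfolding loc_rel_def by blast
  show "a \<notin> I"
  proof
    assume "a \<in> I"
    then have "u \<otimes> (a \<otimes> b \<otimes> \<one>) \<in> I" using u(1) bt S_carrier by (simp add: I_l_closed I_r_closed)
    moreover have "u \<otimes> (\<one> \<otimes> (s \<otimes> t)) \<in> S" using u(1) bt assms mult_S one_S by blast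
    ultimately show False using u by simp
  qed
next
  assume "a \<notin> I"
  interpret L: cring L by (rule localization_cring)
  have "loc a s \<otimes>\<^bsub>L\<^esub> loc s a = \<one>\<^bsub>L\<^esub>"
    unfolding L_one using assms \<open>a \<notin> I\<close> S_carrier one_S mult_S
    by (simp add: L_mult) (intro loc_eqI, simp_all add: m_comm)
  then show "loc a s \<in> Units L"
    using assms \<open>a \<notin> I\<close> L.m_comm[of "loc a s" "loc s a"] unfolding Units_def
    by (auto intro!: bexI[of _ "loc s a"])
qed

text \<open>The assumptions are the axioms of \<open>almost_dvr\<close> for the localization at \<open>I\<close> and the uniformizer \<open>w / 1\<close>, with
denominators cleared; the right-hand side is the existence of a regular non-unit in the same form.\<close>

theorem cohen_macaulay_local_localization_iff:
  assumes w: "w \<in> I"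
    and not_nilpotent: "\<And>(j::nat) u. u \<in> S \<Longrightarrow> u \<otimes> w [^] j \<noteq> \<zero>"
    and divides_power: "\<And>a. a \<in> carrier R \<Longrightarrow>
      (\<exists>k::nat. a [^] k = \<zero>) \<or> (\<exists>j::nat. \<exists>u\<in>S. \<exists>y\<in>carrier R. u \<otimes> w [^] j = y \<otimes> a)"
    and power_divided: "\<And>a. a \<in> I \<Longrightarrow> \<exists>k::nat. \<exists>y\<in>carrier R. a [^] k = y \<otimes> w"
  shows "cohen_macaulay_local L \<longleftrightarrow>
    (\<exists>a\<in>I. \<forall>b\<in>carrier R. (\<exists>u\<in>S. u \<otimes> (a \<otimes> b) = \<zero>) \<longrightarrow> (\<exists>u\<in>S. u \<otimes> b = \<zero>))"
proof -
  have wc: "w \<in> carrier R" using w by (rule Icarr)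
  interpret L: cring L by (rule localization_cring)
  interpret A: almost_dvr L "loc w \<one>"
  proof
    show "loc w \<one> \<in> carrier L" using wc one_S by blast
    show "loc w \<one> \<notin> Units L" using loc_mem_Units_iff wc one_S w by blast
    show "loc w \<one> [^]\<^bsub>L\<^esub> j \<noteq> \<zero>\<^bsub>L\<^esub>" for j :: nat
      using not_nilpotent loc_eq_zero_iff[of "w [^] j" \<one>] wc one_S by (simp add: loc_pow)
  next
    fix z assume "z \<in> carrier L"
    then obtain a s where as: "a \<in> carrier R" "s \<in> S" "z = loc a s" by (rule L_cases)
    show "(\<exists>k::nat. z [^]\<^bsub>L\<^esub> k = \<zero>\<^bsub>L\<^esub>) \<or> (\<exists>j::nat. \<exists>y\<in>carrier L. loc w \<one> [^]\<^bsub>L\<^esub> j = y \<otimes>\<^bsub>L\<^esub> z)"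
      using divides_power[OF as(1)]
    proof (elim disjE exE bexE)
      fix k :: nat assume "a [^] k = \<zero>"
      then have "z [^]\<^bsub>L\<^esub> k = \<zero>\<^bsub>L\<^esub>"
        using as loc_eq_zero_iff[of "a [^] k" "s [^] k"] pow_S one_S S_carrier[OF one_S]
        by (auto simp: loc_pow intro!: bexI[of _ \<one>])
      then show ?thesis by blast
    next
      fix j :: nat and u y assume u: "u \<in> S" "y \<in> carrier R" "u \<otimes> w [^] j = y \<otimes> a"
      have "loc (y \<otimes> s) u \<otimes>\<^bsub>L\<^esub> z = loc (y \<otimes> s \<otimes> a) (u \<otimes> s)"
        using u as S_carrier by (simp add: L_mult)
      also have "\<dots> = loc (w [^] j) \<one>"
      proof (rule loc_eqI)
        have c: "u \<in> carrier R" "s \<in> carrier R" using u as by blast+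
        have "y \<otimes> s \<otimes> a \<otimes> \<one> = (y \<otimes> a) \<otimes> s"
          using c u(2) as(1) by (simp add: m_ac)
        also have "\<dots> = w [^] j \<otimes> (u \<otimes> s)"
          using c wc by (simp add: m_ac flip: u(3))
        finally show "y \<otimes> s \<otimes> a \<otimes> \<one> = w [^] j \<otimes> (u \<otimes> s)" .
      qed (use u as S_carrier wc mult_S one_S in simp_all)
      also have "\<dots> = loc w \<one> [^]\<^bsub>L\<^esub> j"
        using wc one_S by (simp add: loc_pow)
      finally show ?thesis using u as S_carrier loc_closed[of "y \<otimes> s" u] by (metis m_closed)
    qed
  next
    fix z assume z: "z \<in> carrier L" "z \<notin> Units L"
    then obtain a s where as: "a \<in> carrier R" "s \<in> S" "z = loc a s" by (elim L_cases)
    then have "a \<in> I" using z loc_mem_Units_iff by blast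
    then obtain k :: nat and y where y: "y \<in> carrier R" "a [^] k = y \<otimes> w"
      using power_divided by blast
    have "loc y (s [^] k) \<otimes>\<^bsub>L\<^esub> loc w \<one> = z [^]\<^bsub>L\<^esub> k"
      using as y wc one_S pow_S by (simp add: L_mult loc_pow)
    then show "\<exists>k::nat. \<exists>y\<in>carrier L. z [^]\<^bsub>L\<^esub> k = y \<otimes>\<^bsub>L\<^esub> loc w \<one>"
      using y as pow_S loc_closed by metis
  qed
  have regular_iff: "(\<forall>y\<in>carrier L. loc a s \<otimes>\<^bsub>L\<^esub> y = \<zero>\<^bsub>L\<^esub> \<longrightarrow> y = \<zero>\<^bsub>L\<^esub>) \<longleftrightarrow>
      (\<forall>b\<in>carrier R. (\<exists>u\<in>S. u \<otimes> (a \<otimes> b) = \<zero>) \<longrightarrow> (\<exists>u\<in>S. u \<otimes> b = \<zero>))"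
    if as: "a \<in> carrier R" "s \<in> S" for a s
  proof -
    have zero: "loc a s \<otimes>\<^bsub>L\<^esub> loc b t = \<zero>\<^bsub>L\<^esub> \<longleftrightarrow> (\<exists>u\<in>S. u \<otimes> (a \<otimes> b) = \<zero>)"
      "loc b t = \<zero>\<^bsub>L\<^esub> \<longleftrightarrow> (\<exists>u\<in>S. u \<otimes> b = \<zero>)" if "b \<in> carrier R" "t \<in> S" for b t
      using that as loc_eq_zero_iff[of "a \<otimes> b" "s \<otimes> t"] loc_eq_zero_iff[of b t] mult_S
      by (simp_all add: L_mult)
    have "(\<forall>y\<in>carrier L. loc a s \<otimes>\<^bsub>L\<^esub> y = \<zero>\<^bsub>L\<^esub> \<longrightarrow> y = \<zero>\<^bsub>L\<^esub>) \<longleftrightarrow>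
        (\<forall>b\<in>carrier R. \<forall>t\<in>S. loc a s \<otimes>\<^bsub>L\<^esub> loc b t = \<zero>\<^bsub>L\<^esub> \<longrightarrow> loc b t = \<zero>\<^bsub>L\<^esub>)"
      unfolding L_carrier by blast
    also have "\<dots> \<longleftrightarrow> (\<forall>b\<in>carrier R. \<forall>t\<in>S. (\<exists>u\<in>S. u \<otimes> (a \<otimes> b) = \<zero>) \<longrightarrow> (\<exists>u\<in>S. u \<otimes> b = \<zero>))"
      by (intro ball_cong refl) (simp only: zero)
    finally show ?thesis using one_S by blast
  qed
  have ex_iff: "(\<exists>z\<in>A.nonunits. P z) \<longleftrightarrow> (\<exists>a\<in>I. \<exists>s\<in>S. P (loc a s))" for P
  proof
    assume "\<exists>z\<in>A.nonunits. P z"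
    then obtain z where z: "z \<in> carrier L" "z \<notin> Units L" "P z" by blast
    then obtain a s where "a \<in> carrier R" "s \<in> S" "z = loc a s" by (elim L_cases)
    then show "\<exists>a\<in>I. \<exists>s\<in>S. P (loc a s)" using z loc_mem_Units_iff by blast
  next
    assume "\<exists>a\<in>I. \<exists>s\<in>S. P (loc a s)"
    then obtain a s where "a \<in> I" "s \<in> S" "P (loc a s)" by blast
    then show "\<exists>z\<in>A.nonunits. P z"
      using loc_mem_Units_iff[OF Icarr] loc_closed[OF Icarr] by blast
  qed
  have "cohen_macaulay_local L \<longleftrightarrow>
      (\<exists>a\<in>I. \<exists>s\<in>S. \<forall>y\<in>carrier L. loc a s \<otimes>\<^bsub>L\<^esub> y = \<zero>\<^bsub>L\<^esub> \<longrightarrow> y = \<zero>\<^bsub>L\<^esub>)"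
    unfolding A.cohen_macaulay_local_iff by (rule ex_iff)
  also have "\<dots> \<longleftrightarrow> (\<exists>a\<in>I. \<exists>s\<in>S. \<forall>b\<in>carrier R. (\<exists>u\<in>S. u \<otimes> (a \<otimes> b) = \<zero>) \<longrightarrow> (\<exists>u\<in>S. u \<otimes> b = \<zero>))"
    using regular_iff Icarr S_carrier by (intro bex_cong refl) simp
  also have "\<dots> \<longleftrightarrow> (\<exists>a\<in>I. \<forall>b\<in>carrier R. (\<exists>u\<in>S. u \<otimes> (a \<otimes> b) = \<zero>) \<longrightarrow> (\<exists>u\<in>S. u \<otimes> b = \<zero>))"
    using one_S by blast
  finally show ?thesis .
qed

end

section \<open>Quotients of commutative rings\<close>

text \<open>Polynomials live in a type class, whereas ideals, quotients and localizations are those of explicit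
carriers. The next facts let membership in an ideal be treated with class operations.\<close>

abbreviation type_ring :: "'a::comm_ring_1 ring" where
  "type_ring \<equiv> ring_of_type_algebra"

lemma type_ring_simps [simp]:
  "carrier type_ring = (UNIV :: 'a::comm_ring_1 set)"
  "x \<otimes>\<^bsub>type_ring\<^esub> y = x * y" "x \<oplus>\<^bsub>type_ring\<^esub> y = x + y"
  "\<one>\<^bsub>type_ring\<^esub> = (1 :: 'a::comm_ring_1)" "\<zero>\<^bsub>type_ring\<^esub> = (0 :: 'a::comm_ring_1)"
  by (simp_all add: ring_of_type_algebra_def)

lemma type_ring_cring: "cring (type_ring :: 'a::comm_ring_1 ring)"
  by (rule cring_from_type_algebra)

lemma type_ring_ring: "ring (type_ring :: 'a::comm_ring_1 ring)"
  by (rule ring_from_type_algebra)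

lemma type_ring_uminus [simp]: "\<ominus>\<^bsub>type_ring\<^esub> x = - (x :: 'a::comm_ring_1)"
proof -
  interpret cring "type_ring :: 'a ring" by (rule type_ring_cring)
  show ?thesis using minus_equality[of "- x" x] by simp
qed

lemma ideal_type_ring_iff:
  "ideal I type_ring \<longleftrightarrow>
     (0 :: 'a::comm_ring_1) \<in> I \<and> (\<forall>a\<in>I. \<forall>b\<in>I. a + b \<in> I) \<and> (\<forall>a\<in>I. \<forall>x. x * a \<in> I)"
proof
  assume "ideal I (type_ring :: 'a ring)"
  then interpret ideal I "type_ring :: 'a ring" .
  have "0 \<in> I"
    using additive_subgroup.zero_closed[OF is_additive_subgroup] unfolding type_ring_simps .
  moreover have "a + b \<in> I" if "a \<in> I" "b \<in> I" for a b
    using additive_subgroup.a_closed[OF is_additive_subgroup that] unfolding type_ring_simps .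
  moreover have "x * a \<in> I" if "a \<in> I" for a x
    using I_l_closed[OF that, of x] unfolding type_ring_simps by simp
  ultimately show "0 \<in> I \<and> (\<forall>a\<in>I. \<forall>b\<in>I. a + b \<in> I) \<and> (\<forall>a\<in>I. \<forall>x. x * a \<in> I)"
    by blast
next
  assume I: "0 \<in> I \<and> (\<forall>a\<in>I. \<forall>b\<in>I. a + b \<in> I) \<and> (\<forall>a\<in>I. \<forall>x. x * a \<in> I)"
  interpret R: cring "type_ring :: 'a ring" by (rule type_ring_cring)
  have neg: "- a \<in> I" if "a \<in> I" for a
  proof -
    have "- 1 * a \<in> I" using I that by blast
    then show ?thesis by simp
  qed
  show "ideal I (type_ring :: 'a ring)"
  proof (rule idealI)
    show "subgroup I (add_monoid (type_ring :: 'a ring))"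
    proof
      show "inv\<^bsub>add_monoid type_ring\<^esub> x \<in> I" if "x \<in> I" for x
        using neg[OF that] type_ring_uminus[of x] unfolding a_inv_def by metis
    qed (use I in auto)
  qed (use I in \<open>auto simp: mult.commute intro: R.ring_axioms\<close>)
qed

lemma Idl_subsetI:
  "ideal I type_ring \<Longrightarrow> A \<subseteq> I \<Longrightarrow> Idl\<^bsub>type_ring\<^esub> A \<subseteq> (I :: 'a::comm_ring_1 set)"
  using ring.genideal_minimal[OF type_ring_ring] by blast

lemma ideal_Idl: "ideal (Idl\<^bsub>type_ring\<^esub> A) (type_ring :: 'a::comm_ring_1 ring)"
  using ring.genideal_ideal[OF type_ring_ring, of A] by simp

lemma Idl_superset: "A \<subseteq> Idl\<^bsub>type_ring\<^esub> (A :: 'a::comm_ring_1 set)"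
  using ring.genideal_self[OF type_ring_ring, of A] by simp

text \<open>Ideals of the quotient by \<open>J\<close> are handled through their preimages in the ambient ring, and elements
through representatives, \<open>cls f\<close> being the residue class of \<open>f\<close>.\<close>

locale ring_quotient =
  fixes J :: "'a::comm_ring_1 set"
  assumes J_ideal: "ideal J type_ring"
begin

sublocale J: ideal J "type_ring :: 'a ring" by (rule J_ideal)

lemma J_zero: "0 \<in> J" and J_add: "a \<in> J \<Longrightarrow> b \<in> J \<Longrightarrow> a + b \<in> J"
  and J_mult: "a \<in> J \<Longrightarrow> x * a \<in> J"
  using J_ideal unfolding ideal_type_ring_iff by auto

lemma J_mult_right: "a \<in> J \<Longrightarrow> a * x \<in> J"
  using J_mult[of a x] by (simp add: mult.commute)

lemma J_uminus: "a \<in> J \<Longrightarrow> - a \<in> J"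
  using J_mult[of a "- 1"] by simp

lemma J_diff: "a \<in> J \<Longrightarrow> b \<in> J \<Longrightarrow> a - b \<in> J"
  using J_add[of a "- b"] J_uminus by simp

abbreviation "Q \<equiv> type_ring Quot J"

definition cls :: "'a \<Rightarrow> 'a set" where
  "cls f = J +>\<^bsub>type_ring\<^esub> f"

lemma Q_cring: "cring Q"
  by (rule J.quotient_is_cring[OF type_ring_cring])

sublocale Q: cring Q by (rule Q_cring)

lemma Q_carrier: "carrier Q = range cls"
  by (auto simp: FactRing_def A_RCOSETS_def' cls_def)

lemma cls_closed [simp]: "cls f \<in> carrier Q"
  unfolding Q_carrier by blast

lemma cls_mult: "cls f \<otimes>\<^bsub>Q\<^esub> cls g = cls (f * g)"
  by (simp add: cls_def FactRing_def J.rcoset_mult_add)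

lemma cls_add: "cls f \<oplus>\<^bsub>Q\<^esub> cls g = cls (f + g)"
  by (simp add: cls_def FactRing_def J.a_rcos_sum)

lemma Q_one: "\<one>\<^bsub>Q\<^esub> = cls 1"
  by (simp add: cls_def FactRing_def)

lemma cls_pow: "cls f [^]\<^bsub>Q\<^esub> (k::nat) = cls (f ^ k)"
  by (induction k) (simp_all add: Q_one cls_mult mult.commute)

lemma cls_eq_zero_iff: "cls f = \<zero>\<^bsub>Q\<^esub> \<longleftrightarrow> f \<in> J"
  using J.a_rcos_const[of f] J.a_rcos_self[of f] by (auto simp: cls_def FactRing_def)

lemma Q_zero: "\<zero>\<^bsub>Q\<^esub> = cls 0"
  using cls_eq_zero_iff[of 0] J_zero by blast

lemma cls_minus: "cls f \<ominus>\<^bsub>Q\<^esub> cls g = cls (f - g)"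
proof -
  have "cls (- g) \<oplus>\<^bsub>Q\<^esub> cls g = \<zero>\<^bsub>Q\<^esub>"
    using J_zero by (simp add: cls_add cls_eq_zero_iff)
  then have "\<ominus>\<^bsub>Q\<^esub> cls g = cls (- g)"
    using Q.minus_equality by simp
  then show ?thesis by (simp add: Q.minus_eq cls_add)
qed

lemma cls_eq_iff: "cls f = cls g \<longleftrightarrow> f - g \<in> J"
  using Q.r_right_minus_eq[OF cls_closed cls_closed, of f g] unfolding cls_minus cls_eq_zero_iff ..

lemma ideal_vimage_cls:
  assumes "ideal I Q"
  shows "ideal (cls -` I) type_ring"
proof -
  interpret I: ideal I Q by fact
  have "cls 0 \<in> I" using I.zero_closed cls_eq_zero_iff[of 0] J_zero by simp
  moreover have "cls (a + b) \<in> I" if "cls a \<in> I" "cls b \<in> I" for a b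
    using I.a_closed[OF that] by (simp add: cls_add)
  moreover have "cls (x * a) \<in> I" if "cls a \<in> I" for a x
    using I.I_l_closed[OF that, of "cls x"] by (simp add: cls_mult)
  ultimately show ?thesis by (simp add: ideal_type_ring_iff)
qed

lemma subset_vimage_cls: "ideal I Q \<Longrightarrow> J \<subseteq> cls -` I"
proof
  fix f assume I: "ideal I Q" and "f \<in> J"
  then have "cls f = \<zero>\<^bsub>Q\<^esub>" using cls_eq_zero_iff by blast
  then show "f \<in> cls -` I" using additive_subgroup.zero_closed[OF ideal.axioms(1)[OF I]] by simp
qed

lemma noetherian_quotient:
  assumes "\<And>I. ideal I type_ring \<Longrightarrow> J \<subseteq> I \<Longrightarrow> \<exists>B. finite B \<and> B \<subseteq> I \<and> I \<subseteq> Idl\<^bsub>type_ring\<^esub> (B \<union> J)"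
  shows "noetherian_ring Q"
proof (rule Q.noetherian_ringI)
  fix I assume I: "ideal I Q"
  obtain B where B: "finite B" "B \<subseteq> cls -` I" "cls -` I \<subseteq> Idl\<^bsub>type_ring\<^esub> (B \<union> J)"
    using assms[OF ideal_vimage_cls[OF I] subset_vimage_cls[OF I]] by blast
  have gen: "ideal (Idl\<^bsub>Q\<^esub> (cls ` B)) Q"
    by (intro Q.genideal_ideal) auto
  have "B \<subseteq> cls -` (Idl\<^bsub>Q\<^esub> (cls ` B))"
    using Q.genideal_self[of "cls ` B"] cls_closed by blast
  then have "Idl\<^bsub>type_ring\<^esub> (B \<union> J) \<subseteq> cls -` (Idl\<^bsub>Q\<^esub> (cls ` B))"
    using Idl_subsetI[OF ideal_vimage_cls[OF gen]] subset_vimage_cls[OF gen] by simp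
  then have "cls -` I \<subseteq> cls -` (Idl\<^bsub>Q\<^esub> (cls ` B))" using B by blast
  moreover have "I \<subseteq> range cls" using ideal.Icarr[OF I] Q_carrier by blast
  ultimately have "I \<subseteq> Idl\<^bsub>Q\<^esub> (cls ` B)" by blast
  moreover have "Idl\<^bsub>Q\<^esub> (cls ` B) \<subseteq> I" using B(2) by (intro Q.genideal_minimal[OF I]) blast
  ultimately show "\<exists>A\<subseteq>carrier Q. finite A \<and> I = Idl\<^bsub>Q\<^esub> A"
    using B(1) by (intro exI[of _ "cls ` B"]) auto
qed

lemma maximal_inverse:
  assumes m: "maximalideal m Q" and f: "cls f \<notin> m"
  shows "\<exists>g. cls (f * g - 1) \<in> m"
proof -
  interpret m: maximalideal m Q by fact
  let ?I = "PIdl\<^bsub>Q\<^esub> (cls f) <+>\<^bsub>Q\<^esub> m"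
  have id: "ideal ?I Q" by (intro Q.add_ideals Q.cgenideal_ideal m.is_ideal) simp
  have fI: "x \<oplus>\<^bsub>Q\<^esub> y \<in> ?I" if "x \<in> PIdl\<^bsub>Q\<^esub> (cls f)" "y \<in> m" for x y
    using that by (auto simp: set_add_defs)
  have "m \<subseteq> ?I"
  proof
    fix y assume "y \<in> m"
    then show "y \<in> ?I"
      using fI[of "\<zero>\<^bsub>Q\<^esub>" y] additive_subgroup.zero_closed[OF ideal.axioms(1)[OF Q.cgenideal_ideal[of "cls f"]]] m.Icarr
      by simp
  qed
  moreover have "cls f \<in> ?I"
    using fI[OF Q.cgenideal_self m.zero_closed, of] by simp
  ultimately have "?I = carrier Q"
    using m.I_maximal[OF id] f ideal.Icarr[OF id] by blast
  then have "\<one>\<^bsub>Q\<^esub> \<in> ?I" by simp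
  then obtain x y where xy: "x \<in> PIdl\<^bsub>Q\<^esub> (cls f)" "y \<in> m" "\<one>\<^bsub>Q\<^esub> = x \<oplus>\<^bsub>Q\<^esub> y"
    by (auto simp: set_add_defs)
  then obtain g where g: "x = cls g \<otimes>\<^bsub>Q\<^esub> cls f"
    by (auto simp: cgenideal_def Q_carrier)
  obtain h where h: "y = cls h" using m.Icarr[OF xy(2)] Q_carrier by blast
  have "cls 1 = cls (f * g + h)"
    using xy(3) by (simp add: g h cls_mult cls_add Q_one mult.commute)
  then have "f * g - 1 + h \<in> J"
    using J_uminus by (force simp: cls_eq_iff algebra_simps)
  then have "cls (f * g - 1) = cls (- h)" by (simp add: cls_eq_iff)
  also have "\<dots> = cls (- 1) \<otimes>\<^bsub>Q\<^esub> y" by (simp add: cls_mult h)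
  also have "\<dots> \<in> m" using m.I_l_closed[OF xy(2)] by simp
  finally show ?thesis by blast
qed

lemma maximal_image:
  assumes M: "ideal M type_ring" "J \<subseteq> M" "1 \<notin> M" and inverse: "\<And>f. f \<notin> M \<Longrightarrow> \<exists>g. f * g - 1 \<in> M"
  shows "maximalideal (cls ` M) Q" "cls f \<in> cls ` M \<longleftrightarrow> f \<in> M"
proof -
  have "ring_quotient M" by (rule ring_quotient.intro) (rule M)
  note M_zero = ring_quotient.J_zero[OF this] and M_add = ring_quotient.J_add[OF this]
    and M_mult = ring_quotient.J_mult[OF this] and M_mult_right = ring_quotient.J_mult_right[OF this]
    and M_uminus = ring_quotient.J_uminus[OF this]
  have mem: "cls f \<in> cls ` M \<longleftrightarrow> f \<in> M" for f
  proof
    assume "cls f \<in> cls ` M"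
    then obtain g where "g \<in> M" "f - g \<in> M" using M(2) by (auto simp: cls_eq_iff)
    then show "f \<in> M" using M_add[of "f - g" g] by simp
  qed auto
  then show "cls f \<in> cls ` M \<longleftrightarrow> f \<in> M" .
  show "maximalideal (cls ` M) Q"
  proof (rule maximalidealI)
    show "ideal (cls ` M) Q"
    proof (rule idealI[OF Q.ring_axioms])
      show "subgroup (cls ` M) (add_monoid Q)"
      proof
        show "cls ` M \<subseteq> carrier (add_monoid Q)" by auto
        show "x \<otimes>\<^bsub>add_monoid Q\<^esub> y \<in> cls ` M" if "x \<in> cls ` M" "y \<in> cls ` M" for x y
          using that M_add by (auto simp: cls_add)
        show "\<one>\<^bsub>add_monoid Q\<^esub> \<in> cls ` M"
          using imageI[OF M_zero, of cls] unfolding Q_zero[symmetric] by (simp only: monoid.simps)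
        show "inv\<^bsub>add_monoid Q\<^esub> x \<in> cls ` M" if x: "x \<in> cls ` M" for x
        proof -
          obtain f where f: "f \<in> M" "x = cls f" using x by blast
          have "\<ominus>\<^bsub>Q\<^esub> x = cls (- f)"
            using cls_minus[of 0 f] f(2) unfolding Q_zero[symmetric] by (simp add: Q.minus_eq)
          then show ?thesis using M_uminus[OF f(1)] by (simp add: a_inv_def)
        qed
      qed
      show "x \<otimes>\<^bsub>Q\<^esub> a \<in> cls ` M" if "a \<in> cls ` M" "x \<in> carrier Q" for a x
        using that M_mult by (auto simp: Q_carrier cls_mult)
      then show "a \<otimes>\<^bsub>Q\<^esub> x \<in> cls ` M" if "a \<in> cls ` M" "x \<in> carrier Q" for a x
        using that M_mult_right by (auto simp: Q_carrier cls_mult)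
    qed
    show "carrier Q \<noteq> cls ` M" using mem[of 1] M(3) cls_closed by metis
    fix I assume I: "ideal I Q" "cls ` M \<subseteq> I" "I \<subseteq> carrier Q"
    interpret I: ideal I Q by fact
    show "I = cls ` M \<or> I = carrier Q"
    proof (cases "I \<subseteq> cls ` M")
      case False
            then obtain x where x: "x \<in> I" "x \<notin> cls ` M" by (metis subsetI)
      then obtain f where "x = cls f" using I(3) Q_carrier by blast
      then have f: "cls f \<in> I" "f \<notin> M" using x mem by simp_all
      then obtain g where "f * g - 1 \<in> M" using inverse by blast
      then have 1: "cls (1 - f * g) \<in> I" using I(2) M_uminus by (metis image_subset_iff minus_diff_eq)
      have "cls (f * g) \<in> I" using I.I_r_closed[OF f(1), of "cls g"] by (simp add: cls_mult)
      then have "cls 1 \<in> I" using I.a_closed[OF 1, of "cls (f * g)"] by (simp add: cls_add)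
      then show ?thesis using I.one_imp_carrier by (simp add: Q_one)
    qed (use I in blast)
  qed
qed

end

section \<open>Lines with nilpotents\<close>

lemma poly_split_power:
  fixes w p :: "'k::field poly"
  assumes "\<not> is_unit w" "w \<noteq> 0" "p \<noteq> 0"
  shows "\<exists>k v. p = w ^ k * v \<and> \<not> w dvd v"
  using assms(3)
proof (induction "degree p" arbitrary: p rule: less_induct)
  case less
  show ?case
  proof (cases "w dvd p")
    case False
    then show ?thesis by (intro exI[of _ 0] exI[of _ p]) simp
  next
    case True
    then obtain q where q: "p = w * q" by (elim dvdE)
    have "degree w \<noteq> 0" using assms(1,2) is_unit_iff_degree by blast
    then have "degree q < degree p" using q less.prems assms(2) by (simp add: degree_mult_eq)
    then obtain k v where "q = w ^ k * v" "\<not> w dvd v" using less q by fastforce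
    then show ?thesis using q by (intro exI[of _ "Suc k"] exI[of _ v]) (simp add: mult.assoc)
  qed
qed

text \<open>The quotient by \<open>J\<close> is the coordinate ring of a line with nilpotents: modulo its nilradical it is the
polynomial ring \<open>K[x]\<close>, embedded by \<open>e\<close>.\<close>

locale thickened_line = ring_quotient J for J :: "'a::comm_ring_1 set" +
  fixes e :: "'k::field poly \<Rightarrow> 'a"
  assumes e_add: "e (p + q) = e p + e q" and e_mult: "e (p * q) = e p * e q" and e_one: "e 1 = 1"
    and nilpotent_remainder: "\<exists>p N. (f - e p) ^ N \<in> J"
    and e_inj: "e p \<in> J \<Longrightarrow> p = 0"
begin

lemma e_zero [simp]: "e 0 = 0"
  using e_add[of 0 0] by simp

lemma e_diff: "e (p - q) = e p - e q"
  using e_add[of "p - q" q] by simp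

lemma e_pow: "e (p ^ k) = e p ^ k"
  by (induction k) (simp_all add: e_one e_mult)

lemma diff_power_dvd: "\<exists>h. (a - b) ^ N = h * a + (- b) ^ N" for a b :: 'a
proof -
  have "a - b - (- b) dvd (a - b) ^ N - (- b) ^ N"
    using power_diff_sumr2[of "a - b" N "- b"] by simp
  then obtain h where "(a - b) ^ N - (- b) ^ N = a * h" by auto
  then show ?thesis by (intro exI[of _ h]) (simp add: algebra_simps)
qed

context
  fixes m assumes m: "maximalideal m Q"
begin

lemma m_prime: "primeideal m Q"
  by (rule Q.maximalideal_prime[OF m])

lemma m_ideal: "ideal m Q"
  by (rule maximalideal.axioms(1)[OF m])

definition "M = cls -` m"

lemma mem_M_iff: "f \<in> M \<longleftrightarrow> cls f \<in> m"
  by (simp add: M_def)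

lemma M_ring_quotient: "ring_quotient M"
  unfolding M_def by (rule ring_quotient.intro) (rule ideal_vimage_cls[OF m_ideal])

lemmas M_diff = ring_quotient.J_diff[OF M_ring_quotient]
  and M_mult = ring_quotient.J_mult[OF M_ring_quotient]
  and M_uminus = ring_quotient.J_uminus[OF M_ring_quotient]

lemma J_subset_M: "J \<subseteq> M"
  unfolding M_def by (rule subset_vimage_cls[OF m_ideal])

lemma one_notin_M: "1 \<notin> M"
  using ideal.one_imp_carrier[OF m_ideal] primeideal.I_notcarr[OF m_prime] Q_one mem_M_iff by metis

lemma M_power: "f ^ k \<in> M \<Longrightarrow> f \<in> M"
  using primeideal.power_mem_imp_mem[OF m_prime cls_closed, of f k] by (simp add: mem_M_iff cls_pow)

lemma M_inverse: "f \<notin> M \<Longrightarrow> \<exists>g. f * g - 1 \<in> M"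
  using maximal_inverse[OF m, of f] by (simp add: mem_M_iff)

lemma remainder_in_M: "\<exists>p N. (f - e p) ^ N \<in> J \<and> f - e p \<in> M"
  using nilpotent_remainder M_power J_subset_M by blast

text \<open>A maximal ideal meets \<open>K[x]\<close> in a nonzero ideal: if \<open>x\<close> itself is outside, it has an inverse modulo the
maximal ideal, which may be chosen in \<open>K[x]\<close>, and \<open>x p - 1\<close> is never zero. An element of least degree
generates this ideal.\<close>

lemma exists_line_generator:
  "\<exists>w. w \<noteq> 0 \<and> e w \<in> M \<and> (\<forall>p. e p \<in> M \<longrightarrow> w dvd p)"
proof -
  have "\<exists>p. p \<noteq> 0 \<and> e p \<in> M"
  proof (cases "e [:0, 1:] \<in> M")
    case False
    then obtain g where g: "e [:0, 1:] * g - 1 \<in> M" using M_inverse by blast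
    obtain p where p: "g - e p \<in> M" using remainder_in_M by blast
    have "e ([:0, 1:] * p - 1) = (e [:0, 1:] * g - 1) - e [:0, 1:] * (g - e p)"
      by (simp only: e_diff e_mult e_one) (simp add: algebra_simps)
    then have "e ([:0, 1:] * p - 1) \<in> M"
      using M_diff[OF g M_mult[OF p]] by simp
    moreover have "[:0, 1:] * p - 1 \<noteq> 0"
    proof
      assume "[:0, 1:] * p - 1 = 0"
      then have "coeff ([:0, 1:] * p - 1) 0 = 0" by simp
      then show False by (simp add: coeff_pCons)
    qed
    ultimately show ?thesis by blast
  next
    case True
    then show ?thesis by (intro exI[of _ "[:0, 1:]"]) simp
  qed
  then obtain w where w: "w \<noteq> 0" "e w \<in> M"
    and min: "\<And>p. p \<noteq> 0 \<Longrightarrow> e p \<in> M \<Longrightarrow> degree w \<le> degree p"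
    using ex_has_least_nat[of "\<lambda>p. p \<noteq> 0 \<and> e p \<in> M" _ degree] by blast
  have "w dvd p" if "e p \<in> M" for p
  proof -
    have "p mod w = p - w * (p div w)" by (simp add: minus_mult_div_eq_mod)
    then have "e (p mod w) = e p - e (p div w) * e w" by (simp add: e_diff e_mult mult.commute)
    then have "e (p mod w) \<in> M" using that w M_diff M_mult by simp
    then have "p mod w = 0" using min[of "p mod w"] degree_mod_less[OF w(1), of p] by force
    then show ?thesis by auto
  qed
  then show ?thesis using w by blast
qed

text \<open>The generator \<open>w\<close> of the ideal cut out on the line is the uniformizer. An element \<open>f\<close> differs by a
nilpotent from some \<open>e p\<close> with \<open>p = w\<^bsup>k\<^esup> v\<close> and \<open>v\<close> not divisible by \<open>w\<close>; so, if \<open>p \<noteq> 0\<close>, \<open>f\<close> divides a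
power of \<open>w\<close> up to a factor outside the maximal ideal. The condition on the right is that some \<open>a\<close> in
the maximal ideal becomes regular in the localization.\<close>

lemma cohen_macaulay_local_at_maximal_iff:
  shows "cohen_macaulay_local (localization Q m) \<longleftrightarrow>
    (\<exists>a\<in>M. \<forall>b. (\<exists>u. u \<notin> M \<and> u * (a * b) \<in> J) \<longrightarrow> (\<exists>u. u \<notin> M \<and> u * b \<in> J))"
proof -
  obtain w where w: "w \<noteq> 0" "e w \<in> M" "\<And>p. e p \<in> M \<Longrightarrow> w dvd p"
    using exists_line_generator by blast
  have w_nonunit: "\<not> is_unit w"
  proof
    assume "is_unit w"
    then obtain v where "1 = w * v" by (elim dvdE)
    then have "e 1 = e v * e w" using e_mult[of w v] by (simp only: mult.commute)
    then show False using one_notin_M M_mult[OF w(2), of "e v"] by (simp add: e_one)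
  qed
  have S: "x \<in> carrier Q - m \<longleftrightarrow> (\<exists>u. u \<notin> M \<and> x = cls u)" for x
    by (auto simp: Q_carrier M_def)
  have "cohen_macaulay_local (localization Q m) \<longleftrightarrow>
    (\<exists>a\<in>m. \<forall>b\<in>carrier Q. (\<exists>u\<in>carrier Q - m. u \<otimes>\<^bsub>Q\<^esub> (a \<otimes>\<^bsub>Q\<^esub> b) = \<zero>\<^bsub>Q\<^esub>) \<longrightarrow>
       (\<exists>u\<in>carrier Q - m. u \<otimes>\<^bsub>Q\<^esub> b = \<zero>\<^bsub>Q\<^esub>))"
  proof (rule primeideal.cohen_macaulay_local_localization_iff[OF m_prime, where w = "cls (e w)"])
    show "cls (e w) \<in> m" using w(2) by (simp add: M_def)
  next
    fix j :: nat and x assume "x \<in> carrier Q - m"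
    then obtain u where u: "u \<notin> M" "x = cls u" using S by blast
    obtain p N where p: "(u - e p) ^ N \<in> J" "u - e p \<in> M" using remainder_in_M by blast
    have "p \<noteq> 0" using p u by auto
    show "x \<otimes>\<^bsub>Q\<^esub> cls (e w) [^]\<^bsub>Q\<^esub> j \<noteq> \<zero>\<^bsub>Q\<^esub>"
    proof
      assume "x \<otimes>\<^bsub>Q\<^esub> cls (e w) [^]\<^bsub>Q\<^esub> j = \<zero>\<^bsub>Q\<^esub>"
      then have J: "u * e w ^ j \<in> J"
        by (simp add: u cls_pow cls_mult cls_eq_zero_iff)
      obtain h where h: "(u * e w ^ j - e p * e w ^ j) ^ N
          = h * (u * e w ^ j) + (- (e p * e w ^ j)) ^ N"
        using diff_power_dvd by blast
      have "(u * e w ^ j - e p * e w ^ j) ^ N = (e w ^ j) ^ N * (u - e p) ^ N"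
        by (simp add: algebra_simps flip: power_mult_distrib)
      also have "\<dots> \<in> J" using p by (intro J_mult)
      finally have "(- (e p * e w ^ j)) ^ N \<in> J"
        using h J_mult[OF J, of h] J_diff by (metis add_diff_cancel_left')
      then have "(-1) ^ N * (- (e p * e w ^ j)) ^ N \<in> J" by (rule J_mult)
      then have "e ((p * w ^ j) ^ N) \<in> J"
        by (simp add: e_mult e_pow flip: power_mult_distrib)
      then have "(p * w ^ j) ^ N = 0" by (rule e_inj)
      then show False using \<open>p \<noteq> 0\<close> w(1) by simp
    qed
  next
    fix x assume "x \<in> carrier Q"
    then obtain f where x: "x = cls f" by (auto simp: Q_carrier)
    obtain p N where p: "(f - e p) ^ N \<in> J" "f - e p \<in> M" using remainder_in_M by blast
    show "(\<exists>k::nat. x [^]\<^bsub>Q\<^esub> k = \<zero>\<^bsub>Q\<^esub>) \<or>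
        (\<exists>j::nat. \<exists>u\<in>carrier Q - m. \<exists>y\<in>carrier Q. u \<otimes>\<^bsub>Q\<^esub> cls (e w) [^]\<^bsub>Q\<^esub> j = y \<otimes>\<^bsub>Q\<^esub> x)"
    proof (cases "p = 0")
      case True
      then have "x [^]\<^bsub>Q\<^esub> N = \<zero>\<^bsub>Q\<^esub>" using p by (simp add: x cls_pow cls_eq_zero_iff)
      then show ?thesis by blast
    next
      case False
      then obtain k v where v: "p = w ^ k * v" "\<not> w dvd v"
        using poly_split_power[OF w_nonunit w(1)] by blast
      have ev: "e v \<notin> M" using w(3) v(2) by blast
      obtain h where h: "(f - e p) ^ N = h * f + (- e p) ^ N"
        using diff_power_dvd by blast
      \<comment> \<open>Expanding the power of \<open>f - e p\<close> that lies in \<open>J\<close>, everything but the power of \<open>e p\<close> is a multiple of \<open>f\<close>.\<close>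
      define u where "u = (- e v) ^ N"
      have u: "u \<notin> M" using ev M_power[of "- e v" N] M_uminus[of "- e v"] by (auto simp: u_def)
      have "(- e p) ^ N = u * e w ^ (k * N)"
        using arg_cong[OF v(1), of "\<lambda>q. (- e q) ^ N"]
        by (simp add: u_def e_mult e_pow power_mult flip: power_mult_distrib) (simp add: mult.commute)
      then have "u * e w ^ (k * N) - (- h) * f \<in> J" using p h by (simp add: algebra_simps)
      then have "cls u \<otimes>\<^bsub>Q\<^esub> cls (e w) [^]\<^bsub>Q\<^esub> (k * N) = cls (- h) \<otimes>\<^bsub>Q\<^esub> x"
        by (simp add: x cls_pow cls_mult cls_eq_iff)
      then show ?thesis using u S by (metis cls_closed)
    qed
  next
    fix x assume "x \<in> m"
    then obtain f where x: "x = cls f" "f \<in> M" using ideal.Icarr[OF m_ideal] by (force simp: Q_carrier M_def)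
    obtain p N where p: "(f - e p) ^ N \<in> J" "f - e p \<in> M" using remainder_in_M by blast
    have "e p \<in> M" using M_diff[OF x(2) p(2)] by simp
    then obtain v where v: "p = w * v" using w(3) by (blast elim: dvdE)
    obtain h where h: "(e p - f) ^ N = h * e p + (- f) ^ N"
      using diff_power_dvd by blast
    have "f ^ N - ((-1) ^ N * (- h) * e v) * e w = (f - e p) ^ N"
    proof -
      have "(f - e p) ^ N = (-1) ^ N * (e p - f) ^ N" by (simp flip: power_mult_distrib)
      also have "\<dots> = (-1) ^ N * h * e p + (-1) ^ N * (- f) ^ N" by (simp add: h algebra_simps)
      also have "(-1) ^ N * (- f) ^ N = f ^ N" by (simp flip: power_mult_distrib)
      finally show ?thesis by (simp add: v e_mult mult_ac)
    qed
    then have "x [^]\<^bsub>Q\<^esub> N = cls ((-1) ^ N * (- h) * e v) \<otimes>\<^bsub>Q\<^esub> cls (e w)"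
      using p by (simp add: x cls_pow cls_mult cls_eq_iff)
    then show "\<exists>k::nat. \<exists>y\<in>carrier Q. x [^]\<^bsub>Q\<^esub> k = y \<otimes>\<^bsub>Q\<^esub> cls (e w)"
      by (intro exI[of _ N] bexI[OF _ cls_closed])
  qed
  also have "\<dots> \<longleftrightarrow> (\<exists>a\<in>M. \<forall>b. (\<exists>u. u \<notin> M \<and> u * (a * b) \<in> J) \<longrightarrow> (\<exists>u. u \<notin> M \<and> u * b \<in> J))"
  proof -
    have 1: "(\<exists>a\<in>m. P a) \<longleftrightarrow> (\<exists>a\<in>M. P (cls a))" for P
      using ideal.Icarr[OF m_ideal] by (force simp: Q_carrier M_def)
    have 2: "(\<forall>b\<in>carrier Q. P b) \<longleftrightarrow> (\<forall>b. P (cls b))" for P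
      by (auto simp: Q_carrier)
    have "carrier Q - m = cls ` (- M)" by (auto simp: Q_carrier M_def)
    then have 3: "(\<exists>u\<in>carrier Q - m. P u) \<longleftrightarrow> (\<exists>u. u \<notin> M \<and> P (cls u))" for P
      by auto
    show ?thesis unfolding 1 2 3 by (simp only: cls_mult cls_eq_zero_iff)
  qed
  finally show ?thesis .
qed

end

text \<open>A maximal ideal contains some \<open>e w\<close> with \<open>w \<noteq> 0\<close>, which stays regular after localization.\<close>

theorem cohen_macaulay_if_line_regular:
  assumes regular: "\<And>p f. p \<noteq> 0 \<Longrightarrow> e p * f \<in> J \<Longrightarrow> f \<in> J"
    and noetherian: "noetherian_ring Q"
  shows "cohen_macaulay Q"
  unfolding cohen_macaulay_def
proof (intro conjI allI impI)
  fix m assume m: "maximalideal m Q"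
  obtain w where w: "w \<noteq> 0" "e w \<in> M m"
    using exists_line_generator[OF m] by blast
  have "u * b \<in> J" if "u * (e w * b) \<in> J" for u b
    using regular[OF w(1), of "u * b"] that by (simp add: mult_ac)
  then show "cohen_macaulay_local (localization Q m)"
    unfolding cohen_macaulay_local_at_maximal_iff[OF m] using w(2) by blast
qed (use noetherian Q_cring in auto)

text \<open>A nonzero element \<open>g\<close> killed by the whole maximal ideal survives in the localization, since everything
outside the maximal ideal is invertible modulo it; so no element of the maximal ideal is regular there.\<close>

theorem not_cohen_macaulay_if_socle:
  assumes M0: "ideal M0 type_ring" "J \<subseteq> M0" "1 \<notin> M0" and inverse: "\<And>f. f \<notin> M0 \<Longrightarrow> \<exists>g. f * g - 1 \<in> M0"
    and g: "g \<notin> J" "\<And>f. f \<in> M0 \<Longrightarrow> f * g \<in> J"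
  shows "\<not> cohen_macaulay Q"
proof
  assume "cohen_macaulay Q"
  note M0_image = maximal_image[OF M0 inverse]
  have M: "M (cls ` M0) = M0" using mem_M_iff[OF M0_image(1)] M0_image(2) by blast
  have "cohen_macaulay_local (localization Q (cls ` M0))"
    using \<open>cohen_macaulay Q\<close> M0_image(1) by (simp add: cohen_macaulay_def)
  then obtain a where a: "a \<in> M0" "\<forall>b. (\<exists>u. u \<notin> M0 \<and> u * (a * b) \<in> J) \<longrightarrow> (\<exists>u. u \<notin> M0 \<and> u * b \<in> J)"
    using cohen_macaulay_local_at_maximal_iff[OF M0_image(1)] unfolding M by blast
  have "1 * (a * g) \<in> J" using g(2)[OF a(1)] by simp
  then obtain u where u: "u \<notin> M0" "u * g \<in> J" using a(2) M0(3) by blast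
  then obtain v where "u * v - 1 \<in> M0" using inverse by blast
  then have "(u * v - 1) * g \<in> J" by (rule g(2))
  moreover have "v * (u * g) \<in> J" using u(2) by (rule J_mult)
  ultimately have "v * (u * g) - (u * v - 1) * g \<in> J" by (intro J_diff)
  then show False using g(1) by (simp add: algebra_simps)
qed

end

section \<open>Polynomials paired with functions on monomials\<close>

type_synonym expo = "4 \<Rightarrow>\<^sub>0 nat"

abbreviation "lookup \<equiv> Poly_Mapping.lookup"
abbreviation "single \<equiv> Poly_Mapping.single"
abbreviation "keys \<equiv> Poly_Mapping.keys"

lemma UNIV_4: "(UNIV :: 4 set) = {1, 2, 3, 4}"
  by (rule card_seteq[symmetric]) simp_all

lemma all_4: "(\<forall>i::4. P i) \<longleftrightarrow> P 1 \<and> P 2 \<and> P 3 \<and> P 4"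
  using UNIV_4 by (metis UNIV_I empty_iff insert_iff)

lemma sum_4: "(\<Sum>i\<in>(UNIV::4 set). g i) = g 1 + g 2 + g 3 + g 4"
  unfolding UNIV_4 by (simp add: add.assoc)

text \<open>All ideals below arise as annihilators of sets of functions on monomials. If such a set is closed
under translation of the argument, its annihilator is an ideal, because multiplication by a monomial
is adjoint to translation.\<close>

definition pairing :: "'k::field mpoly4 \<Rightarrow> (expo \<Rightarrow> 'k) \<Rightarrow> 'k" where
  "pairing f h = (\<Sum>m\<in>keys f. lookup f m * h m)"

lemma pairing_superset:
  "finite A \<Longrightarrow> keys f \<subseteq> A \<Longrightarrow> pairing f h = (\<Sum>m\<in>A. lookup f m * h m)"
  unfolding pairing_def by (rule sum.mono_neutral_left) (auto simp: in_keys_iff)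

lemma pairing_zero [simp]: "pairing 0 h = 0"
  by (simp add: pairing_def)

lemma pairing_add: "pairing (f + g) h = pairing f h + pairing g h"
proof -
  let ?A = "keys f \<union> keys g"
  have "pairing (f + g) h = (\<Sum>m\<in>?A. lookup (f + g) m * h m)"
    using Poly_Mapping.keys_add[of f g] by (intro pairing_superset) auto
  also have "\<dots> = (\<Sum>m\<in>?A. lookup f m * h m) + (\<Sum>m\<in>?A. lookup g m * h m)"
    by (simp add: lookup_add distrib_right sum.distrib)
  also have "\<dots> = pairing f h + pairing g h"
    by (simp add: pairing_superset[of ?A f] pairing_superset[of ?A g])
  finally show ?thesis .
qed

lemma pairing_uminus: "pairing (- f) h = - pairing f h"
  using pairing_add[of f "- f" h] by (simp add: eq_neg_iff_add_eq_0 add.commute)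

lemma pairing_diff: "pairing (f - g) h = pairing f h - pairing g h"
  using pairing_add[of f "- g" h] by (simp add: pairing_uminus)

lemma pairing_sum: "pairing (\<Sum>i\<in>A. f i) h = (\<Sum>i\<in>A. pairing (f i) h)"
  by (induction A rule: infinite_finite_induct) (simp_all add: pairing_add)

lemma pairing_single [simp]: "pairing (single m c) h = c * h m"
  by (simp add: pairing_def)

lemma sum_monomials: "f = (\<Sum>m\<in>keys f. single m (lookup f m))"
  for f :: "'k::field mpoly4"
proof (rule poly_mapping_eqI)
  fix k
  have "lookup (\<Sum>m\<in>keys f. single m (lookup f m)) k
      = (\<Sum>m\<in>keys f. if m = k then lookup f m else 0)"
    by (simp add: lookup_sum lookup_single when_def)
  also have "\<dots> = lookup f k" by (simp add: in_keys_iff)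
  finally show "lookup f k = lookup (\<Sum>m\<in>keys f. single m (lookup f m)) k" by simp
qed

lemma pairing_single_mult:
  "pairing (single u c * f) h = c * pairing f (\<lambda>m. h (u + m))"
proof -
  have "single u c * f = (\<Sum>m\<in>keys f. single (u + m) (c * lookup f m))"
    by (subst sum_monomials[of f]) (simp add: sum_distrib_left mult_single)
  then show ?thesis
    by (simp add: pairing_sum) (simp add: pairing_def sum_distrib_left mult.assoc)
qed

lemma pairing_mult:
  "pairing (g * f) h = (\<Sum>u\<in>keys g. lookup g u * pairing f (\<lambda>m. h (u + m)))"
proof -
  have "g * f = (\<Sum>u\<in>keys g. single u (lookup g u) * f)"
    by (subst sum_monomials[of g]) (simp add: sum_distrib_right)
  then show ?thesis by (simp add: pairing_sum pairing_single_mult)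
qed

definition annihilator :: "(expo \<Rightarrow> 'k::field) set \<Rightarrow> 'k mpoly4 set" where
  "annihilator H = {f. \<forall>h\<in>H. pairing f h = 0}"

lemma annihilator_ideal:
  assumes "\<And>h u. h \<in> H \<Longrightarrow> (\<lambda>m. h (u + m)) \<in> H"
  shows "ideal (annihilator H) type_ring"
  unfolding ideal_type_ring_iff
  using assms by (auto simp: annihilator_def pairing_add pairing_mult intro!: sum.neutral)

section \<open>Weights, maximal monomials and the ideals of the curve\<close>

definition weight :: "(4 \<Rightarrow> nat) \<Rightarrow> expo \<Rightarrow> nat" where
  "weight n m = (\<Sum>i\<in>UNIV. lookup m i * n i)"

lemma weight_add: "weight n (m + u) = weight n m + weight n u"
  by (simp add: weight_def lookup_add distrib_right sum.distrib)

lemma weight_single [simp]: "weight n (single i k) = k * n i"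
proof -
  have "weight n (single i k) = (\<Sum>j\<in>UNIV. if i = j then k * n j else 0)"
    unfolding weight_def by (intro sum.cong) (auto simp: lookup_single when_def)
  then show ?thesis by simp
qed

lemma total_degree_add: "total_degree (m + u) = total_degree m + total_degree u"
  by (simp add: total_degree_def lookup_add sum.distrib)

lemma total_degree_single [simp]: "total_degree (single i k) = k"
proof -
  have "total_degree (single i k) = (\<Sum>j\<in>UNIV. if i = j then k else 0)"
    unfolding total_degree_def by (intro sum.cong) (auto simp: lookup_single when_def)
  then show ?thesis by simp
qed

lemma prod_monom_power:
  "finite A \<Longrightarrow> (\<Prod>i\<in>A. (Polynomial.monom (1::'k::field) (n i)) ^ g i) = Polynomial.monom 1 (\<Sum>i\<in>A. g i * n i)"
  by (induction A rule: finite_induct) (simp_all add: monom_power mult_monom mult.commute)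

lemma coeff_curve_hom:
  "coeff (curve_hom n f) s = pairing f (\<lambda>m. if weight n m = s then 1 else 0)"
  by (simp add: curve_hom_def prod_monom_power coeff_sum pairing_def weight_def mult.commute)

definition weight_tests :: "(4 \<Rightarrow> nat) \<Rightarrow> (expo \<Rightarrow> 'k::field) set" where
  "weight_tests n = {h. \<forall>m m'. weight n m = weight n m' \<longrightarrow> h m = h m'}"

lemma weight_tests_eq: "h \<in> weight_tests n \<Longrightarrow> weight n m = weight n m' \<Longrightarrow> h m = h m'"
  unfolding weight_tests_def by blast

text \<open>The image of \<open>f\<close> in \<open>K[t]\<close> records the sums of its coefficients over monomials of equal weight.\<close>

lemma curve_ideal_eq: "(curve_ideal n :: 'k::field mpoly4 set) = annihilator (weight_tests n)"
proof (intro equalityI subsetI)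
  fix f :: "'k mpoly4"
  assume "f \<in> curve_ideal n"
  then have 0: "pairing f (\<lambda>m. if weight n m = s then 1 else 0) = 0" for s
    using coeff_curve_hom[of n f s] by (simp add: curve_ideal_def)
  have "pairing f h = 0" if h: "h \<in> weight_tests n" for h
  proof -
    have "pairing f h = (\<Sum>s\<in>weight n ` keys f. \<Sum>m\<in>{m \<in> keys f. weight n m = s}. lookup f m * h m)"
      unfolding pairing_def by (rule sum.image_gen) simp
    also have "\<dots> = 0"
    proof (rule sum.neutral, clarify)
      fix m0 assume "m0 \<in> keys f"
      have "(\<Sum>m\<in>{m \<in> keys f. weight n m = weight n m0}. lookup f m * h m)
          = (\<Sum>m\<in>{m \<in> keys f. weight n m = weight n m0}. lookup f m) * h m0"
        unfolding sum_distrib_right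
        by (intro sum.cong refl arg_cong2[of _ _ _ _ "(*)"] weight_tests_eq[OF h]) simp
      also have "(\<Sum>m\<in>{m \<in> keys f. weight n m = weight n m0}. lookup f m)
          = pairing f (\<lambda>m. if weight n m = weight n m0 then 1 else 0)"
        unfolding pairing_def by (simp add: sum.inter_filter[symmetric] if_distrib cong: if_cong)
      finally show "(\<Sum>m\<in>{m \<in> keys f. weight n m = weight n m0}. lookup f m * h m) = 0"
        using 0 by simp
    qed
    finally show ?thesis .
  qed
  then show "f \<in> annihilator (weight_tests n)" by (simp add: annihilator_def)
next
  fix f :: "'k mpoly4"
  assume "f \<in> annihilator (weight_tests n)"
  then have "coeff (curve_hom n f) s = 0" for s
    unfolding coeff_curve_hom by (auto simp: annihilator_def weight_tests_def)
  then show "f \<in> curve_ideal n" by (auto simp: curve_ideal_def poly_eq_iff)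
qed

definition maximal :: "(4 \<Rightarrow> nat) \<Rightarrow> expo \<Rightarrow> bool" where
  "maximal n m \<longleftrightarrow> (\<forall>m'. weight n m' = weight n m \<longrightarrow> total_degree m' \<le> total_degree m)"

text \<open>A better monomial of the weight of \<open>m\<close> could be substituted in \<open>u + m\<close>.\<close>

lemma maximal_summand:
  assumes "maximal n (u + m)"
  shows "maximal n m"
  unfolding maximal_def
proof (intro allI impI)
  fix m' assume "weight n m' = weight n m"
  then have "total_degree (u + m') \<le> total_degree (u + m)"
    using assms unfolding maximal_def by (simp add: weight_add)
  then show "total_degree m' \<le> total_degree m" by (simp add: total_degree_add)
qed

lemma maximal_cong:
  "weight n m = weight n m' \<Longrightarrow> total_degree m = total_degree m' \<Longrightarrow> maximal n m \<longleftrightarrow> maximal n m'"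
  by (simp add: maximal_def)

lemma maximal_total_degree_eq:
  "maximal n m \<Longrightarrow> maximal n m' \<Longrightarrow> weight n m = weight n m' \<Longrightarrow> total_degree m = total_degree m'"
  by (simp add: maximal_def antisym)

text \<open>The functions that live on maximal monomials and depend only on the weight there; they turn out to
define the ideal of initial forms.\<close>

definition cone_tests :: "(4 \<Rightarrow> nat) \<Rightarrow> (expo \<Rightarrow> 'k::field) set" where
  "cone_tests n = {h. (\<forall>m. \<not> maximal n m \<longrightarrow> h m = 0) \<and>
     (\<forall>m m'. maximal n m \<longrightarrow> maximal n m' \<longrightarrow> weight n m = weight n m' \<longrightarrow> h m = h m')}"

lemma cone_tests_zero: "h \<in> cone_tests n \<Longrightarrow> \<not> maximal n m \<Longrightarrow> h m = 0"
  by (simp add: cone_tests_def)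

lemma cone_tests_eq:
  "h \<in> cone_tests n \<Longrightarrow> maximal n m \<Longrightarrow> maximal n m' \<Longrightarrow> weight n m = weight n m' \<Longrightarrow> h m = h m'"
  unfolding cone_tests_def by blast

definition cone_ideal :: "(4 \<Rightarrow> nat) \<Rightarrow> 'k::field mpoly4 set" where
  "cone_ideal n = annihilator (cone_tests n)"

text \<open>For maximal monomials of equal weight, whether \<open>u + m\<close> is still maximal depends only on the weight.\<close>

lemma cone_tests_shift: "h \<in> cone_tests n \<Longrightarrow> (\<lambda>m. h (u + m)) \<in> cone_tests n"
proof -
  assume h: "h \<in> cone_tests n"
  have 1: "h (u + m) = 0" if "\<not> maximal n m" for m
    using cone_tests_zero[OF h] that maximal_summand by blast
  have 2: "h (u + m) = h (u + m')"
    if "maximal n m" "maximal n m'" "weight n m = weight n m'" for m m'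
  proof -
    have w: "weight n (u + m) = weight n (u + m')" using that(3) by (simp add: weight_add)
    moreover have "total_degree (u + m) = total_degree (u + m')"
      using maximal_total_degree_eq[OF that] by (simp add: total_degree_add)
    ultimately have "maximal n (u + m) \<longleftrightarrow> maximal n (u + m')" by (rule maximal_cong)
    then show ?thesis
      using cone_tests_eq[OF h _ _ w] cone_tests_zero[OF h, of "u + m"] cone_tests_zero[OF h, of "u + m'"]
      by (cases "maximal n (u + m)") simp_all
  qed
  show ?thesis
    unfolding cone_tests_def mem_Collect_eq
    by (intro conjI allI impI) (rule 1, assumption, rule 2, assumption+)
qed

lemma cone_ideal_ideal: "ideal (cone_ideal n) type_ring"
  unfolding cone_ideal_def by (rule annihilator_ideal) (rule cone_tests_shift)

text \<open>The coordinate of the class of \<open>f\<close> at the basis element \<open>t\<^bsup>s\<^esup>\<close> of the tangent cone.\<close>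

definition cone_coeff :: "(4 \<Rightarrow> nat) \<Rightarrow> 'k::field mpoly4 \<Rightarrow> nat \<Rightarrow> 'k" where
  "cone_coeff n f s = pairing f (\<lambda>m. if maximal n m \<and> weight n m = s then 1 else 0)"

lemma cone_coeff_test: "(\<lambda>m. if maximal n m \<and> weight n m = s then 1 else 0) \<in> cone_tests n"
  by (auto simp: cone_tests_def)

text \<open>On the monomials of one weight, a test function is a multiple of the function that defines the coordinate.\<close>

lemma mem_cone_ideal_iff: "f \<in> cone_ideal n \<longleftrightarrow> (\<forall>s. cone_coeff n f s = 0)"
proof
  assume "f \<in> cone_ideal n"
  then show "\<forall>s. cone_coeff n f s = 0"
    using cone_coeff_test by (force simp: cone_ideal_def annihilator_def cone_coeff_def)
next
  assume 0: "\<forall>s. cone_coeff n f s = 0"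
  have "pairing f h = 0" if h: "h \<in> cone_tests n" for h
  proof -
    have "pairing f h = (\<Sum>s\<in>weight n ` keys f. \<Sum>m\<in>{m \<in> keys f. weight n m = s}. lookup f m * h m)"
      unfolding pairing_def by (rule sum.image_gen) simp
    also have "\<dots> = 0"
    proof (rule sum.neutral, rule ballI)
      fix s assume "s \<in> weight n ` keys f"
      \<comment> \<open>The constant value of \<open>h\<close> on the maximal monomials of weight \<open>s\<close>.\<close>
      define c where "c = (if \<exists>m. maximal n m \<and> weight n m = s then h (SOME m. maximal n m \<and> weight n m = s) else 0)"
      have hc: "h m = (if maximal n m \<and> weight n m = s then 1 else 0) * c" if "weight n m = s" for m
      proof (cases "maximal n m")
        case True
        then have ex: "\<exists>m. maximal n m \<and> weight n m = s" using that by blast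
        then have "h m = h (SOME m. maximal n m \<and> weight n m = s)"
          using cone_tests_eq[OF h True] that someI_ex[OF ex] by simp
        then show ?thesis using ex True that by (simp add: c_def)
      qed (simp add: cone_tests_zero[OF h])
      have "(\<Sum>m\<in>{m \<in> keys f. weight n m = s}. lookup f m * h m)
          = (\<Sum>m\<in>keys f. lookup f m * (if maximal n m \<and> weight n m = s then 1 else 0) * c)"
        by (rule sum.mono_neutral_cong_left) (auto simp: hc)
      also have "\<dots> = cone_coeff n f s * c"
        unfolding cone_coeff_def pairing_def sum_distrib_right ..
      finally show "(\<Sum>m\<in>{m \<in> keys f. weight n m = s}. lookup f m * h m) = 0"
        using 0 by simp
    qed
    finally show ?thesis .
  qed
  then show "f \<in> cone_ideal n" by (simp add: cone_ideal_def annihilator_def)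
qed

lemma single_mem_cone_ideal_iff: "single m (1 :: 'k::field) \<in> cone_ideal n \<longleftrightarrow> \<not> maximal n m"
  by (auto simp: mem_cone_ideal_iff cone_coeff_def)

lemma binomial_mem_curve_ideal:
  assumes "weight n m = weight n m'"
  shows "single m c - single m' c \<in> curve_ideal n"
  unfolding curve_ideal_eq annihilator_def mem_Collect_eq
proof
  fix h :: "expo \<Rightarrow> 'a" assume "h \<in> weight_tests n"
  then show "pairing (single m c - single m' c) h = 0"
    using weight_tests_eq[of h n m m'] assms by (simp add: pairing_diff)
qed

section \<open>The tangent cone of a monomial curve\<close>

lemma single_one_add: "single i (Suc 0) + single i k = (single i (Suc k) :: expo)"
  by (simp flip: single_add)

lemma indet_power: "indet i ^ k = (single (single i k) 1 :: 'k::field mpoly4)"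
  by (induction k) (simp_all add: indet_def mult_single single_one_add)

text \<open>The inclusion of \<open>K[x\<^sub>1]\<close>.\<close>

definition line_poly :: "'k::field poly \<Rightarrow> 'k mpoly4" where
  "line_poly p = (\<Sum>j\<le>degree p. single (single 1 j) (coeff p j))"

lemma line_poly_bound:
  assumes "degree p \<le> N"
  shows "line_poly p = (\<Sum>j\<le>N. single (single 1 j) (coeff p j))"
  unfolding line_poly_def using assms
  by (intro sum.mono_neutral_left) (auto simp: coeff_eq_0)

lemma line_poly_add: "line_poly (p + q) = line_poly p + line_poly q"
proof -
  let ?N = "max (degree p) (degree q)"
  have "degree (p + q) \<le> ?N" by (rule degree_add_le) simp_all
  then have "line_poly (p + q) = (\<Sum>j\<le>?N. single (single 1 j) (coeff (p + q) j))"
    by (rule line_poly_bound)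
  also have "\<dots> = (\<Sum>j\<le>?N. single (single 1 j) (coeff p j)) + (\<Sum>j\<le>?N. single (single 1 j) (coeff q j))"
    by (simp add: single_add sum.distrib)
  also have "\<dots> = line_poly p + line_poly q"
    by (simp add: line_poly_bound[of _ ?N])
  finally show ?thesis .
qed

lemma line_poly_smult: "line_poly (smult a p) = single 0 a * line_poly p"
  using line_poly_bound[of "smult a p" "degree p"]
  by (simp add: line_poly_def sum_distrib_left mult_single)

lemma line_poly_pCons: "line_poly (pCons a p) = single 0 a + single (single 1 1) 1 * line_poly p"
proof -
  have "line_poly (pCons a p) = (\<Sum>j\<le>Suc (degree p). single (single 1 j) (coeff (pCons a p) j))"
    by (rule line_poly_bound) (rule degree_pCons_le)
  also have "\<dots> = single 0 a + (\<Sum>j\<le>degree p. single (single 1 (Suc j)) (coeff p j))"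
    by (subst sum.atMost_Suc_shift) simp
  also have "(\<Sum>j\<le>degree p. single (single 1 (Suc j)) (coeff p j))
      = single (single 1 1) 1 * line_poly p"
    by (simp add: line_poly_def sum_distrib_left mult_single single_one_add)
  finally show ?thesis .
qed

lemma line_poly_0 [simp]: "line_poly 0 = 0"
  by (simp add: line_poly_def)

lemma line_poly_mult: "line_poly (p * q) = line_poly p * line_poly q"
  by (induction p rule: pCons_induct)
    (simp_all add: mult_pCons_left line_poly_add line_poly_smult line_poly_pCons distrib_right mult.assoc)

lemma line_poly_1: "line_poly 1 = 1"
  by (simp add: line_poly_def)

lemma pairing_line_poly_mult:
  "pairing (line_poly p * f) h = (\<Sum>j\<le>degree p. coeff p j * pairing f (\<lambda>m. h (single 1 j + m)))"
  by (simp add: line_poly_def sum_distrib_right pairing_sum pairing_single_mult)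

lemma type_ring_pow: "a [^]\<^bsub>type_ring\<^esub> (k::nat) = (a :: 'a::comm_ring_1) ^ k"
proof -
  interpret cring "type_ring :: 'a ring" by (rule type_ring_cring)
  show ?thesis by (induction k) (simp_all add: mult.commute)
qed

lemma power_add_mem_ideal:
  assumes "ideal J type_ring" "a ^ k \<in> J" "b ^ l \<in> J"
  shows "(a + b :: 'a::comm_ring_1) ^ (k + l) \<in> J"
  using cring.mult_power_add_mem[OF type_ring_cring assms(1), of a b 1 k l] assms(2,3)
  by (simp add: type_ring_pow)

locale monomial_curve =
  fixes n :: "4 \<Rightarrow> nat"
  assumes n_pos: "0 < n i" and first_least: "i \<noteq> 1 \<Longrightarrow> n 1 < n i"
begin

lemma total_degree_le_weight: "n 1 * total_degree m \<le> weight n m"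
proof -
  have "n 1 \<le> n i" for i using first_least[of i] by (cases "i = 1") auto
  then show ?thesis
    unfolding total_degree_def weight_def sum_distrib_left
    by (intro sum_mono) (simp add: mult.commute mult_le_mono2)
qed

lemma weight_eq_0_iff: "weight n m = 0 \<longleftrightarrow> m = 0"
proof
  assume "weight n m = 0"
  then have "lookup m i = 0" for i using n_pos by (simp add: weight_def) (metis gr_implies_not0)
  then show "m = 0" by (intro poly_mapping_eqI) simp
qed (simp add: weight_def)

lemma maximal_0: "maximal n 0"
proof -
  have "weight n 0 = 0" by (simp add: weight_def)
  then show ?thesis unfolding maximal_def using weight_eq_0_iff le_refl by metis
qed

lemma maximal_pure_1: "maximal n (single 1 k)"
  unfolding maximal_def
proof (intro allI impI)
  fix m assume "weight n m = weight n (single 1 k)"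
  then have "n 1 * total_degree m \<le> n 1 * k" using total_degree_le_weight[of m] by (simp add: mult.commute)
  then show "total_degree m \<le> total_degree (single 1 k)" using n_pos[of 1] by simp
qed

text \<open>The monomial \<open>x\<^sub>1\<^bsup>n i\<^esup>\<close> has the same weight and larger degree.\<close>

lemma not_maximal_power: "i \<noteq> 1 \<Longrightarrow> \<not> maximal n (single i (n 1))"
  unfolding maximal_def using first_least[of i]
  by (auto intro!: exI[of _ "single 1 (n i)"] simp: not_le)

lemma exists_maximal: "\<exists>m'. maximal n m' \<and> weight n m' = weight n m"
proof -
  have "total_degree m' \<le> weight n m" if "weight n m' = weight n m" for m'
    using total_degree_le_weight[of m'] n_pos[of 1] that
    by (metis One_nat_def Suc_leI le_trans mult_le_mono1 nat_mult_1)
  then obtain m' where "weight n m' = weight n m"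
    "\<And>m''. weight n m'' = weight n m \<Longrightarrow> total_degree m'' \<le> total_degree m'"
    using ex_has_greatest_nat[of "\<lambda>m'. weight n m' = weight n m" m total_degree "Suc (weight n m)"] by (auto simp: less_Suc_eq_le)
  then show ?thesis unfolding maximal_def by metis
qed

text \<open>If \<open>d\<close> is the least degree in \<open>f\<close>, a monomial of \<open>f\<close> has degree \<open>d\<close> and is maximal exactly when the maximal
monomials of its weight have degree \<open>d\<close>. So a test function restricted to degree \<open>d\<close> agrees on the
monomials of \<open>f\<close> with a function of the weight, and such functions annihilate \<open>f\<close>.\<close>

lemma initial_form_mem_cone_ideal:
  fixes f :: "'k::field mpoly4"
  assumes "f \<in> curve_ideal n"
  shows "initial_form f \<in> cone_ideal n"
proof (cases "f = 0")
  case True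
  then show ?thesis
    by (simp add: initial_form_def homogeneous_component_def cone_ideal_def annihilator_def)
next
  case False
  define d where "d = Min (total_degree ` keys f)"
  have d: "d \<le> total_degree m" if "m \<in> keys f" for m
    using that by (simp add: d_def)
  have "pairing (initial_form f) h = 0" if h: "h \<in> cone_tests n" for h
  proof -
    define g where "g = (\<lambda>m. if \<exists>m'. maximal n m' \<and> weight n m' = weight n m \<and> total_degree m' = d
      then h (SOME m'. maximal n m' \<and> weight n m' = weight n m) else 0)"
    have g: "g \<in> weight_tests n"
      unfolding weight_tests_def g_def by (intro CollectI allI impI) (simp only:)
    have eq: "(if total_degree m = d then h m else 0) = g m" if "m \<in> keys f" for m
    proof (cases "maximal n m")
      case True
      then have ex: "\<exists>m'. maximal n m' \<and> weight n m' = weight n m" by blast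
      have "total_degree m' = total_degree m" if "maximal n m'" "weight n m' = weight n m" for m'
        by (rule maximal_total_degree_eq[OF that(1) True that(2)])
      then have "(\<exists>m'. maximal n m' \<and> weight n m' = weight n m \<and> total_degree m' = d) \<longleftrightarrow> total_degree m = d"
        using True by metis
      moreover have "h (SOME m'. maximal n m' \<and> weight n m' = weight n m) = h m"
        using someI_ex[OF ex] True by (intro cone_tests_eq[OF h]) auto
      ultimately show ?thesis by (simp add: g_def)
    next
      case False
      then obtain m'' where m'': "weight n m'' = weight n m" "total_degree m < total_degree m''"
        by (auto simp: maximal_def not_le)
      have "total_degree m' \<noteq> d" if "maximal n m'" "weight n m' = weight n m" for m'
        using that m'' d[OF \<open>m \<in> keys f\<close>] unfolding maximal_def by (metis leD le_less_trans less_le_trans)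
      then show ?thesis using cone_tests_zero[OF h False] by (auto simp: g_def)
    qed
    have "pairing (initial_form f) h
        = (\<Sum>m\<in>{m \<in> keys f. total_degree m = d}. lookup f m * h m)"
      by (simp add: initial_form_def homogeneous_component_def pairing_sum d_def)
    also have "\<dots> = (\<Sum>m\<in>keys f. lookup f m * (if total_degree m = d then h m else 0))"
      by (intro sum.mono_neutral_cong_left) auto
    also have "\<dots> = pairing f g"
      unfolding pairing_def by (intro sum.cong refl) (simp only: eq)
    also have "\<dots> = 0"
      using assms g by (simp add: curve_ideal_eq annihilator_def)
    finally show ?thesis .
  qed
  then show ?thesis by (simp add: cone_ideal_def annihilator_def)
qed

lemma initial_form_homogeneous:
  fixes f :: "'k::field mpoly4"
  assumes "\<And>m. m \<in> keys f \<Longrightarrow> total_degree m = d"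
  shows "initial_form f = f"
proof (cases "f = 0")
  case False
  then obtain m0 where "m0 \<in> keys f" by (metis ex_in_conv keys_eq_empty)
  then have "total_degree ` keys f = {d}" using assms by (intro equalityI subsetI) (auto intro: rev_image_eqI)
  then have "initial_form f = (\<Sum>m\<in>{m \<in> keys f. total_degree m = d}. single m (lookup f m))"
    by (simp add: initial_form_def homogeneous_component_def)
  also have "{m \<in> keys f. total_degree m = d} = keys f" using assms by auto
  finally show ?thesis using sum_monomials[of f] by simp
qed (simp add: initial_form_def homogeneous_component_def)

lemma lookup_binomial:
  "lookup (single m (c::'k::field) - single m' c) x = (if x = m then c else 0) - (if x = m' then c else 0)"
  by (simp add: lookup_minus lookup_single when_def eq_commute)

text \<open>Conversely, modulo initial forms of binomials a polynomial can be rewritten in terms of one chosen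
maximal monomial for each weight; its coefficients are then the coordinates, which vanish.\<close>

lemma tangent_cone_ideal_eq: "tangent_cone_ideal (curve_ideal n) = (cone_ideal n :: 'k::field mpoly4 set)"
proof
  show "tangent_cone_ideal (curve_ideal n) \<subseteq> (cone_ideal n :: 'k mpoly4 set)"
    unfolding tangent_cone_ideal_def
    using initial_form_mem_cone_ideal by (intro Idl_subsetI cone_ideal_ideal) auto
next
  let ?T = "tangent_cone_ideal (curve_ideal n) :: 'k mpoly4 set"
  have T: "ring_quotient ?T"
    unfolding tangent_cone_ideal_def by (rule ring_quotient.intro) (rule ideal_Idl)
  note T_add = ring_quotient.J_add[OF T] and T_zero = ring_quotient.J_zero[OF T]
  have initial: "initial_form f \<in> ?T" if "f \<in> curve_ideal n" for f
    using Idl_superset[of "initial_form ` curve_ideal n"] that unfolding tangent_cone_ideal_def by blast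
  have non_maximal: "single m c \<in> ?T" if m: "\<not> maximal n m" for m c
  proof (cases "c = 0")
    case False
    obtain m' where m': "weight n m' = weight n m" "total_degree m < total_degree m'"
      using m by (auto simp: maximal_def not_le)
    let ?f = "single m c - single m' c"
    have ne: "m \<noteq> m'" using m' by auto
    have "keys ?f = {m, m'}"
      using False ne by (auto simp: in_keys_iff lookup_binomial split: if_splits)
    then have "initial_form ?f = (\<Sum>x\<in>{x \<in> {m, m'}. total_degree x = total_degree m}. single x (lookup ?f x))"
      using m' by (simp add: initial_form_def homogeneous_component_def min_def)
    also have "{x \<in> {m, m'}. total_degree x = total_degree m} = {m}" using m' by auto
    finally have "initial_form ?f = single m c" using ne by (simp add: lookup_binomial)
    then show ?thesis using initial[OF binomial_mem_curve_ideal[of n m m' c]] m' by simp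
  qed (simp add: T_zero)
  have binomial: "single m c - single m' c \<in> ?T"
    if "weight n m = weight n m'" "total_degree m = total_degree m'" for m m' c
  proof -
    have "initial_form (single m c - single m' c) = single m c - single m' c"
      by (rule initial_form_homogeneous[of _ "total_degree m"])
        (use that in \<open>auto simp: in_keys_iff lookup_binomial split: if_splits\<close>)
    then show ?thesis using initial[OF binomial_mem_curve_ideal[of n m m' c]] that by simp
  qed
  show "cone_ideal n \<subseteq> ?T"
  proof
    fix f :: "'k mpoly4" assume f: "f \<in> cone_ideal n"
    \<comment> \<open>The chosen maximal monomial of weight \<open>s\<close>.\<close>
    define r where "r s = (SOME m. maximal n m \<and> weight n m = s)" for s
    have r: "maximal n (r (weight n m))" "weight n (r (weight n m)) = weight n m" for m
      using someI_ex[OF exists_maximal[of m]] unfolding r_def by auto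
    define R where "R m = (if maximal n m then single (r (weight n m)) (lookup f m) else 0)" for m
    have "(\<Sum>m\<in>A. single m (lookup f m) - R m) \<in> ?T" if "finite A" for A
      using that
    proof (induction A rule: finite_induct)
      case (insert m A)
      have "single m (lookup f m) - R m \<in> ?T"
      proof (cases "maximal n m")
        case True
        then show ?thesis
          using r[of m] binomial[of m "r (weight n m)"] maximal_total_degree_eq[OF True r(1)[of m]]
          by (simp add: R_def)
      qed (simp add: R_def non_maximal)
      then show ?case using insert T_add by simp
    qed (simp add: T_zero)
    then have "(\<Sum>m\<in>keys f. single m (lookup f m)) - (\<Sum>m\<in>keys f. R m) \<in> ?T"
      by (simp add: sum_subtractf)
    moreover have "(\<Sum>m\<in>keys f. R m) = 0"
    proof (rule poly_mapping_eqI)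
      fix u
      have "lookup (\<Sum>m\<in>keys f. R m) u = pairing f (\<lambda>m. if maximal n m \<and> r (weight n m) = u then 1 else 0)"
        unfolding lookup_sum pairing_def R_def by (intro sum.cong) (auto simp: lookup_single when_def)
      also have "\<dots> = 0"
        using f by (auto simp: cone_ideal_def annihilator_def cone_tests_def)
      finally show "lookup (\<Sum>m\<in>keys f. R m) u = lookup 0 u" by simp
    qed
    ultimately show "f \<in> ?T" using sum_monomials[of f] by simp
  qed
qed

lemma indet_power_mem_cone_ideal:
  "i \<noteq> 1 \<Longrightarrow> (indet i :: 'k::field mpoly4) ^ n 1 \<in> cone_ideal n"
  by (simp add: indet_power single_mem_cone_ideal_iff not_maximal_power)

lemma split_variable:
  assumes "lookup m i \<noteq> 0"
  shows "\<exists>m'. m = single i 1 + (m' :: expo)"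
proof
  show "m = single i 1 + (m - single i 1)"
    using assms by (intro poly_mapping_eqI) (auto simp: lookup_add lookup_minus lookup_single when_def)
qed

text \<open>A monomial is either a power of \<open>x\<^sub>1\<close> or divisible by a nilpotent variable.\<close>

lemma nilpotent_line_remainder:
  fixes f :: "'k::field mpoly4"
  shows "\<exists>p N. (f - line_poly p) ^ N \<in> cone_ideal n"
proof -
  interpret ring_quotient "cone_ideal n :: 'k mpoly4 set"
    by (rule ring_quotient.intro) (rule cone_ideal_ideal)
  have monomial: "\<exists>p N. (single m c - line_poly p) ^ N \<in> cone_ideal n" for m and c :: 'k
  proof (cases "\<exists>i. i \<noteq> 1 \<and> lookup m i \<noteq> 0")
    case True
    then obtain i m' where i: "i \<noteq> 1" "m = single i 1 + m'" using split_variable by blast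
    then have "single m c = indet i * single m' c" by (simp add: indet_def mult_single)
    then have "single m c ^ n 1 = single m' c ^ n 1 * indet i ^ n 1"
      by (simp add: power_mult_distrib mult.commute)
    then have "(single m c - line_poly 0) ^ n 1 \<in> cone_ideal n"
      using J_mult[OF indet_power_mem_cone_ideal[OF i(1)]] by simp
    then show ?thesis by blast
  next
    case False
    then have m: "m = single 1 (lookup m 1)"
      by (intro poly_mapping_eqI) (metis lookup_single_eq lookup_single_not_eq)
    have "line_poly (Polynomial.monom c k) = single (single 1 k) c" for k
    proof -
      have "line_poly (Polynomial.monom c k) = (\<Sum>j\<le>k. if j = k then single (single 1 k) c else 0)"
        unfolding line_poly_bound[OF degree_monom_le] by (intro sum.cong) auto
      then show ?thesis by simp
    qed
    then have "single m c = line_poly (Polynomial.monom c (lookup m 1))"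
      using m by metis
    then have "(single m c - line_poly (Polynomial.monom c (lookup m 1))) ^ 1 \<in> cone_ideal n"
      using J_zero by simp
    then show ?thesis by blast
  qed
  have "\<exists>p N. ((\<Sum>m\<in>A. single m (lookup f m)) - line_poly p) ^ N \<in> cone_ideal n" if "finite A" for A
    using that
  proof (induction A rule: finite_induct)
    case empty
    have "(0 - line_poly 0 :: 'k mpoly4) ^ 1 \<in> cone_ideal n" using J_zero by simp
    then show ?case unfolding sum.empty by blast
  next
    case (insert m A)
    obtain p k where p: "((\<Sum>m\<in>A. single m (lookup f m)) - line_poly p) ^ k \<in> cone_ideal n"
      using insert.IH by blast
    obtain q l where q: "(single m (lookup f m) - line_poly q) ^ l \<in> cone_ideal n"
      using monomial by blast
    have "((\<Sum>m\<in>insert m A. single m (lookup f m)) - line_poly (q + p)) ^ (l + k) \<in> cone_ideal n"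
      using power_add_mem_ideal[OF cone_ideal_ideal q p] insert.hyps
      by (simp add: line_poly_add algebra_simps)
    then show ?case by blast
  qed
  from this[of "keys f"] show ?thesis using sum_monomials[of f] by simp
qed

lemma line_poly_inj_mod_cone_ideal:
  assumes "line_poly p \<in> cone_ideal n"
  shows "p = 0"
proof (rule poly_eqI)
  fix i
  have "pairing (line_poly p) (\<lambda>m. if maximal n m \<and> weight n m = i * n 1 then 1 else 0)
      = (\<Sum>j\<le>degree p. if j = i then coeff p j else 0)"
    unfolding line_poly_def pairing_sum using n_pos[of 1] maximal_pure_1
    by (intro sum.cong) auto
  also have "\<dots> = coeff p i" by (auto simp: coeff_eq_0)
  finally show "coeff p i = coeff 0 i"
    using assms by (simp add: mem_cone_ideal_iff cone_coeff_def)
qed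

sublocale thickened_line "cone_ideal n :: 'k::field mpoly4 set" line_poly
  by (intro thickened_line.intro ring_quotient.intro thickened_line_axioms.intro
      cone_ideal_ideal line_poly_add line_poly_mult line_poly_1
      nilpotent_line_remainder line_poly_inj_mod_cone_ideal)

end

section \<open>The Cohen--Macaulay property and multiplication by the first variable\<close>

context monomial_curve
begin

definition first_variable_regular :: bool where
  "first_variable_regular \<longleftrightarrow> (\<forall>m. maximal n m \<longrightarrow> maximal n (single 1 1 + m))"

lemma maximal_pure_shift_iff:
  assumes first_variable_regular
  shows "maximal n (single 1 k + m) \<longleftrightarrow> maximal n m"
proof (induction k)
  case (Suc k)
  have "single 1 (Suc k) + m = single 1 1 + (single 1 k + m)"
    using single_one_add[of 1 k] by (simp add: add.assoc[symmetric])
  then show ?case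
    using assms Suc maximal_summand[of n "single 1 1" "single 1 k + m"]
    unfolding first_variable_regular_def by metis
qed simp

lemma cone_coeff_diff: "cone_coeff n (f - g) t = cone_coeff n f t - cone_coeff n g t"
  by (simp add: cone_coeff_def pairing_diff)

text \<open>If \<open>x\<^sub>1\<close> preserves maximality, multiplication by \<open>x\<^sub>1\<^bsup>k\<^esup>\<close> shifts all coordinates by \<open>k * n 1\<close>.\<close>

lemma cone_coeff_shift:
  assumes first_variable_regular
  shows "pairing f (\<lambda>m. if maximal n (single 1 k + m) \<and> weight n (single 1 k + m) = t then 1 else 0)
    = (if k * n 1 \<le> t then cone_coeff n f (t - k * n 1) else 0)"
  unfolding cone_coeff_def maximal_pure_shift_iff[OF assms] weight_add weight_single
  by (auto simp: pairing_def intro!: sum.cong sum.neutral)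

lemma cone_coeff_single_mult:
  assumes first_variable_regular
  shows "cone_coeff n (single (single 1 k) a * f) t = (if k * n 1 \<le> t then a * cone_coeff n f (t - k * n 1) else 0)"
  using cone_coeff_shift[OF assms, of f k t] by (simp add: cone_coeff_def pairing_single_mult)

text \<open>The lowest coordinate of a product is the product of the lowest coordinate and the lowest coefficient.\<close>

lemma line_poly_regular:
  assumes reg: first_variable_regular and "p \<noteq> 0" "line_poly p * f \<in> cone_ideal n"
  shows "f \<in> cone_ideal n"
proof (rule ccontr)
  assume "f \<notin> cone_ideal n"
  then have "\<exists>s. cone_coeff n f s \<noteq> 0" by (simp add: mem_cone_ideal_iff)
  then obtain s where s: "cone_coeff n f s \<noteq> 0" "\<And>t. t < s \<Longrightarrow> cone_coeff n f t = 0"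
    using exists_least_iff[of "\<lambda>s. cone_coeff n f s \<noteq> 0"] by blast
  have "\<exists>i. coeff p i \<noteq> 0" using \<open>p \<noteq> 0\<close> by (auto simp: poly_eq_iff)
  then obtain i where i: "coeff p i \<noteq> 0" "\<And>j. j < i \<Longrightarrow> coeff p j = 0"
    using exists_least_iff[of "\<lambda>s. coeff p s \<noteq> 0"] by blast
  \<comment> \<open>At this coordinate the terms with larger \<open>j\<close> see \<open>f\<close> below \<open>s\<close>.\<close>
  let ?t = "s + i * n 1"
  have "cone_coeff n (line_poly p * f) ?t
      = (\<Sum>j\<le>degree p. coeff p j * (if j * n 1 \<le> ?t then cone_coeff n f (?t - j * n 1) else 0))"
    unfolding cone_coeff_def[of n "line_poly p * f"] pairing_line_poly_mult cone_coeff_shift[OF reg] ..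
  also have "\<dots> = (\<Sum>j\<le>degree p. if j = i then coeff p i * cone_coeff n f s else 0)"
  proof (intro sum.cong refl)
    fix j
    consider "j < i" | "j = i" | "i < j" by linarith
    then show "coeff p j * (if j * n 1 \<le> ?t then cone_coeff n f (?t - j * n 1) else 0)
        = (if j = i then coeff p i * cone_coeff n f s else 0)"
    proof cases
      case 3
      then have "i * n 1 < j * n 1" using n_pos[of 1] by simp
      then have "?t - j * n 1 < s" if "j * n 1 \<le> ?t" using that by linarith
      then show ?thesis using 3 s(2) by auto
    qed (use i in auto)
  qed
  also have "\<dots> = coeff p i * cone_coeff n f s"
    using i(1) by (simp add: le_degree)
  finally show False using assms(3) s(1) i(1) by (simp add: mem_cone_ideal_iff)
qed

lemma cone_coeff_eventually_zero: "\<exists>N. \<forall>t\<ge>N. cone_coeff n f t = 0"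
proof (intro exI allI impI)
  fix t assume "Suc (\<Sum>m\<in>keys f. weight n m) \<le> t"
  moreover have "weight n m \<le> (\<Sum>m\<in>keys f. weight n m)" if "m \<in> keys f" for m
    using that by (intro member_le_sum) auto
  ultimately have "weight n m \<noteq> t" if "m \<in> keys f" for m using that by fastforce
  then show "cone_coeff n f t = 0" by (auto simp: cone_coeff_def pairing_def)
qed

text \<open>Order the elements of \<open>I\<close> by their top coordinate. Since multiplication by \<open>x\<^sub>1\<close> raises it by \<open>n 1\<close>, it is
enough to take, for each residue class modulo \<open>n 1\<close>, one element of \<open>I\<close> whose top coordinate is smallest
in that class: the top coordinate of any other element can be cancelled by a multiple of one of these.\<close>

lemma finitely_generated_mod_cone_ideal:
  fixes I :: "'k::field mpoly4 set"
  assumes reg: first_variable_regular and I: "ideal I type_ring" "cone_ideal n \<subseteq> I"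
  shows "\<exists>B. finite B \<and> B \<subseteq> I \<and> I \<subseteq> Idl\<^bsub>type_ring\<^esub> (B \<union> cone_ideal n)"
proof -
  define top where "top f s \<longleftrightarrow> cone_coeff n f s \<noteq> 0 \<and> (\<forall>t>s. cone_coeff n f t = 0)" for f :: "'k mpoly4" and s
  define T where "T r = {s. s mod n 1 = r \<and> (\<exists>f\<in>I. top f s)}" for r
  define b where "b r = (SOME f. f \<in> I \<and> top f (LEAST s. s \<in> T r))" for r
  have b: "b r \<in> I \<and> top (b r) (LEAST s. s \<in> T r) \<and> (LEAST s. s \<in> T r) mod n 1 = r"
    if "T r \<noteq> {}" for r
  proof -
    have L: "(LEAST s. s \<in> T r) \<in> T r" using that by (metis LeastI ex_in_conv)
    then have "\<exists>f. f \<in> I \<and> top f (LEAST s. s \<in> T r)" unfolding T_def by blast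
    then have "b r \<in> I \<and> top (b r) (LEAST s. s \<in> T r)" unfolding b_def by (rule someI_ex)
    then show ?thesis using L by (simp add: T_def)
  qed
  define B where "B = b ` {r. r < n 1 \<and> T r \<noteq> {}}"
  let ?K = "Idl\<^bsub>type_ring\<^esub> (B \<union> cone_ideal n)"
  have K: "ring_quotient ?K" by (rule ring_quotient.intro) (rule ideal_Idl)
  have I': "ring_quotient I" by (rule ring_quotient.intro) (rule I)
  have "f \<in> ?K" if "f \<in> I" "\<forall>t\<ge>N. cone_coeff n f t = 0" for f N
    using that
  proof (induction N arbitrary: f)
    case 0
    then have "f \<in> cone_ideal n" by (simp add: mem_cone_ideal_iff)
    then show ?case using Idl_superset by blast
  next
    case (Suc N)
    show ?case
    proof (cases "cone_coeff n f N = 0")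
      case True
      then have "\<forall>t\<ge>N. cone_coeff n f t = 0" using Suc.prems(2) by (metis Suc_leI le_neq_implies_less)
      then show ?thesis using Suc.IH Suc.prems(1) by blast
    next
      case False
      let ?r = "N mod n 1"
      have top: "top f N" using False Suc.prems(2) by (simp add: top_def)
      then have N: "N \<in> T ?r" using Suc.prems(1) by (auto simp: T_def)
      define s where "s = (LEAST s. s \<in> T ?r)"
      have br: "b ?r \<in> I" "top (b ?r) s" "s mod n 1 = ?r" using b[of ?r] N by (auto simp: s_def)
      have "s \<le> N" unfolding s_def using N by (rule Least_le)
      then obtain k where k: "N = s + k * n 1"
        using br(3) by (metis mod_eq_nat2E mult.commute)
      define q :: "'k mpoly4" where "q = single (single 1 k) (cone_coeff n f N / cone_coeff n (b ?r) s)"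
      have "cone_coeff n (f - q * b ?r) t = 0" if "t \<ge> N" for t
      proof (cases "t = N")
        case True
        then show ?thesis using br(2) k
          by (simp add: cone_coeff_diff q_def cone_coeff_single_mult[OF reg] top_def)
      next
        case False
        then have "t - k * n 1 > s" "k * n 1 \<le> t" using that k by auto
        then show ?thesis using br(2) Suc.prems(2) False that
          by (simp add: cone_coeff_diff q_def cone_coeff_single_mult[OF reg] top_def)
      qed
      moreover have "f - q * b ?r \<in> I"
        using Suc.prems(1) br(1) ring_quotient.J_diff[OF I'] ring_quotient.J_mult[OF I'] by blast
      ultimately have "f - q * b ?r \<in> ?K" using Suc.IH by blast
      moreover have "b ?r \<in> B" using N n_pos[of 1] by (auto simp: B_def)
      then have "b ?r \<in> ?K" using Idl_superset by blast
      ultimately have "(f - q * b ?r) + q * b ?r \<in> ?K"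
        using ring_quotient.J_add[OF K] ring_quotient.J_mult[OF K] by blast
      then show ?thesis by simp
    qed
  qed
  then have "I \<subseteq> ?K" using cone_coeff_eventually_zero by blast
  moreover have "B \<subseteq> I" using b by (auto simp: B_def)
  moreover have "finite B" by (simp add: B_def)
  ultimately show ?thesis by blast
qed

text \<open>Among the maximal monomials that \<open>x\<^sub>1\<close> makes non-maximal, one with the largest exponents outside \<open>x\<^sub>1\<close>
works. These exponents are bounded because \<open>x\<^sub>i\<^bsup>n 1\<^esup>\<close> is not maximal.\<close>

lemma exists_socle_monomial:
  assumes "\<not> first_variable_regular"
  shows "\<exists>m. maximal n m \<and> (\<forall>i. \<not> maximal n (single i 1 + m))"
proof -
  let ?P = "\<lambda>m. maximal n m \<and> \<not> maximal n (single 1 1 + m)"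
  define \<mu> where "\<mu> m = lookup m 2 + lookup m 3 + lookup m 4" for m :: expo
  have small: "lookup m i < n 1" if "maximal n m" "i \<noteq> 1" for m i
  proof (rule ccontr)
    assume "\<not> lookup m i < n 1"
    then have "m = (m - single i (n 1)) + single i (n 1)"
      by (intro poly_mapping_eqI) (auto simp: lookup_add lookup_minus lookup_single when_def)
    then have "maximal n (single i (n 1))" using that(1) maximal_summand by metis
    then show False using not_maximal_power[OF that(2)] by blast
  qed
  have bound: "\<mu> m < 3 * n 1" if "?P m" for m
    using small[of m 2] small[of m 3] small[of m 4] that by (simp add: \<mu>_def)
  obtain m0 where m0: "?P m0" using assms unfolding first_variable_regular_def by blast
  have "\<exists>m. ?P m \<and> (\<forall>m'. ?P m' \<longrightarrow> \<mu> m' \<le> \<mu> m)"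
    by (rule ex_has_greatest_nat[where b = "3 * n 1"]) (use m0 bound in auto)
  then obtain m where m: "?P m" "\<And>m'. ?P m' \<Longrightarrow> \<mu> m' \<le> \<mu> m" by blast
  have "\<not> maximal n (single i 1 + m)" for i
  proof (cases "i = 1")
    case False
    show ?thesis
    proof
      assume max: "maximal n (single i 1 + m)"
      have "\<not> maximal n (single 1 1 + (single i 1 + m))"
        using m(1) maximal_summand[of n "single i 1" "single 1 1 + m"] by (metis add.left_commute)
      then have "\<mu> (single i 1 + m) \<le> \<mu> m" using max m(2) by blast
      moreover have "i = 2 \<or> i = 3 \<or> i = 4" using False UNIV_4 by (metis UNIV_I empty_iff insert_iff)
      ultimately show False by (auto simp: \<mu>_def lookup_add lookup_single when_def)
    qed
  qed (use m in simp)
  then show ?thesis using m(1) by blast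
qed

definition origin_ideal :: "'k::field mpoly4 set" where
  "origin_ideal = annihilator {h. \<forall>m. m \<noteq> 0 \<longrightarrow> h m = 0}"

lemma pairing_at_origin:
  assumes "\<forall>m. m \<noteq> 0 \<longrightarrow> h m = 0"
  shows "pairing f h = lookup f 0 * h 0"
proof -
  have "pairing f h = (\<Sum>m\<in>insert 0 (keys f). lookup f m * h m)"
    by (rule pairing_superset) auto
  also have "\<dots> = (\<Sum>m\<in>insert 0 (keys f). if m = 0 then lookup f 0 * h 0 else 0)"
    using assms by (intro sum.cong) auto
  finally show ?thesis by simp
qed

lemma mem_origin_ideal_iff: "f \<in> origin_ideal \<longleftrightarrow> lookup f 0 = 0"
proof
    assume f: "f \<in> origin_ideal"
    have "pairing f (\<lambda>m. if m = 0 then 1 else 0) = 0"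
      using f unfolding origin_ideal_def annihilator_def by simp
    then show "lookup f 0 = 0" using pairing_at_origin[of "\<lambda>m. if m = 0 then 1 else 0" f] by simp
  next
    assume "lookup f 0 = 0"
    then show "f \<in> origin_ideal" by (auto simp: origin_ideal_def annihilator_def pairing_at_origin)
qed

lemma origin_ideal_ideal: "ideal (origin_ideal :: 'k::field mpoly4 set) type_ring"
  unfolding origin_ideal_def
proof (rule annihilator_ideal, clarify)
  fix h :: "expo \<Rightarrow> 'k" and u m :: expo
  assume h: "\<forall>m. m \<noteq> 0 \<longrightarrow> h m = 0" and "m \<noteq> 0"
  have "u + m \<noteq> 0"
  proof
    assume "u + m = 0"
    then have "lookup m i = 0" for i by (metis add_is_0 lookup_add lookup_zero)
    then show False using \<open>m \<noteq> 0\<close> by (auto intro!: poly_mapping_eqI)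
  qed
  then show "h (u + m) = 0" using h by blast
qed

lemma cone_ideal_subset_origin: "cone_ideal n \<subseteq> origin_ideal"
proof
  fix f :: "'k::field mpoly4" assume f: "f \<in> cone_ideal n"
  have "(\<lambda>m. if m = 0 then 1 else 0 :: 'k) \<in> cone_tests n"
    unfolding cone_tests_def mem_Collect_eq
  proof (intro conjI allI impI)
    show "(if m = 0 then 1 else 0 :: 'k) = 0" if "\<not> maximal n m" for m
      using that maximal_0 by (cases "m = 0") simp_all
    show "(if m = 0 then 1 else 0 :: 'k) = (if m' = 0 then 1 else 0)" if "weight n m = weight n m'" for m m'
      using weight_eq_0_iff[of m] weight_eq_0_iff[of m'] that by simp
  qed
  then have "pairing f (\<lambda>m. if m = 0 then 1 else 0) = 0"
    using f by (simp add: cone_ideal_def annihilator_def)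
  then show "f \<in> origin_ideal"
    using pairing_at_origin[of "\<lambda>m. if m = 0 then 1 else 0" f] by (simp add: mem_origin_ideal_iff)
qed

lemma origin_ideal_inverse:
  fixes f :: "'k::field mpoly4"
  assumes "f \<notin> origin_ideal"
  shows "\<exists>g. f * g - 1 \<in> origin_ideal"
proof
  have c: "lookup f 0 \<noteq> 0" using assms by (simp add: mem_origin_ideal_iff)
  have "lookup (single 0 a * f) 0 = a * lookup f 0" for a
    using pairing_single_mult[of 0 a f "\<lambda>m. if m = 0 then 1 else 0"]
    by (simp add: pairing_at_origin)
  then show "f * single 0 (1 / lookup f 0) - 1 \<in> origin_ideal"
    using c by (simp add: mem_origin_ideal_iff lookup_minus mult.commute)
qed

theorem cohen_macaulay_tangent_cone_iff:
  "cohen_macaulay_tangent_cone (curve_ideal n :: 'k::field mpoly4 set) \<longleftrightarrow> first_variable_regular"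
proof -
  have "cohen_macaulay (type_ring Quot (cone_ideal n :: 'k mpoly4 set)) \<longleftrightarrow> first_variable_regular"
  proof
    assume reg: first_variable_regular
    show "cohen_macaulay (type_ring Quot (cone_ideal n :: 'k mpoly4 set))"
    proof (rule cohen_macaulay_if_line_regular)
      show "f \<in> cone_ideal n" if "p \<noteq> 0" "line_poly p * f \<in> cone_ideal n" for p and f :: "'k mpoly4"
        using line_poly_regular[OF reg that] .
      show "noetherian_ring (type_ring Quot (cone_ideal n :: 'k mpoly4 set))"
        using finitely_generated_mod_cone_ideal[OF reg] by (rule noetherian_quotient)
    qed
  next
    assume CM: "cohen_macaulay (type_ring Quot (cone_ideal n :: 'k mpoly4 set))"
    show first_variable_regular
    proof (rule ccontr)
      assume "\<not> first_variable_regular"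
      then obtain m where m: "maximal n m" "\<And>i. \<not> maximal n (single i 1 + m)"
        using exists_socle_monomial by blast
      have kill: "single u c * single m 1 \<in> (cone_ideal n :: 'k mpoly4 set)" if "u \<noteq> 0" for u c
      proof -
        have "\<exists>i. lookup u i \<noteq> 0" using that by (metis lookup_zero poly_mapping_eqI)
        then obtain i u' where u: "u = single i 1 + u'" using split_variable by blast
        have "single (single i 1 + m) 1 \<in> (cone_ideal n :: 'k mpoly4 set)"
          using m(2) single_mem_cone_ideal_iff by blast
        then have "single u' c * single (single i 1 + m) 1 \<in> (cone_ideal n :: 'k mpoly4 set)"
          by (rule J_mult)
        then show ?thesis by (simp add: u mult_single add_ac)
      qed
      have "f * single m 1 \<in> (cone_ideal n :: 'k mpoly4 set)" if f: "f \<in> origin_ideal" for f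
      proof -
        have "0 \<notin> keys f" using f by (simp add: mem_origin_ideal_iff in_keys_iff)
        have "(\<Sum>u\<in>A. single u (lookup f u) * single m 1) \<in> (cone_ideal n :: 'k mpoly4 set)"
          if "finite A" "0 \<notin> A" for A
          using that by (induction A rule: finite_induct) (auto simp: J_zero intro!: J_add kill)
        from this[OF finite_keys \<open>0 \<notin> keys f\<close>] show ?thesis
          by (simp add: sum_distrib_right[symmetric] sum_monomials[symmetric])
      qed
      moreover have "single m (1 :: 'k) \<notin> cone_ideal n" using m(1) single_mem_cone_ideal_iff by blast
      moreover have "(1 :: 'k mpoly4) \<notin> origin_ideal" by (simp add: mem_origin_ideal_iff)
      ultimately have "\<not> cohen_macaulay (type_ring Quot (cone_ideal n :: 'k mpoly4 set))"
        using not_cohen_macaulay_if_socle[OF origin_ideal_ideal cone_ideal_subset_origin _ origin_ideal_inverse]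
        by blast
      then show False using CM by blast
    qed
  qed
  then show ?thesis unfolding cohen_macaulay_tangent_cone_def tangent_cone_ideal_eq .
qed

end

section \<open>Exponents of a Gorenstein curve\<close>

type_synonym quad = "nat \<times> nat \<times> nat \<times> nat"

text \<open>Newman's lemma: the first steps of the two reductions are joined by local confluence, the rest by
induction along the terminating relation.\<close>

lemma newman:
  assumes wf: "wf {(y, x). step x y}"
    and local: "\<And>x y z. step x y \<Longrightarrow> step x z \<Longrightarrow> \<exists>v. step\<^sup>*\<^sup>* y v \<and> step\<^sup>*\<^sup>* z v"
  shows "step\<^sup>*\<^sup>* x y \<Longrightarrow> step\<^sup>*\<^sup>* x z \<Longrightarrow> \<exists>v. step\<^sup>*\<^sup>* y v \<and> step\<^sup>*\<^sup>* z v"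
proof (induction x arbitrary: y z rule: wf_induct_rule[OF wf])
  case (1 x)
  show ?case
  proof (cases "x = y \<or> x = z")
    case True
    then show ?thesis using 1 by auto
  next
    case False
    then obtain y1 z1 where y1: "step x y1" "step\<^sup>*\<^sup>* y1 y" and z1: "step x z1" "step\<^sup>*\<^sup>* z1 z"
      using 1 by (metis converse_rtranclpE)
    obtain u where u: "step\<^sup>*\<^sup>* y1 u" "step\<^sup>*\<^sup>* z1 u" using local y1(1) z1(1) by blast
    obtain v where v: "step\<^sup>*\<^sup>* y v" "step\<^sup>*\<^sup>* u v" using 1(1)[of y1 y u] y1 u by auto
    have "step\<^sup>*\<^sup>* z1 v" using u(2) v(2) by simp
    then obtain t where "step\<^sup>*\<^sup>* z t" "step\<^sup>*\<^sup>* v t" using 1(1)[of z1 z v] z1 by auto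
    then show ?thesis using v(1) by (meson rtranclp_trans)
  qed
qed

text \<open>Monomials are written as quadruples of exponents from here on. The five weight equations say that the
five binomials vanish on the curve.\<close>

locale bresinsky =
  fixes n1 n2 n3 n4 a1 a2 a3 a4 a12 a13 a23 a24 a31 a34 a41 a42 :: nat
  assumes n_pos: "0 < n1" "0 < n2" "0 < n3" "0 < n4"
    and n_less: "n1 < n2" "n2 < n3" "n3 < n4"
    and exps: "0 < a12" "a12 < a2" "0 < a13" "a13 < a3" "0 < a23" "a23 < a3"
      "0 < a24" "a24 < a4" "0 < a31" "a31 < a1" "0 < a34" "a34 < a4"
      "0 < a41" "a41 < a1" "0 < a42" "a42 < a2"
    and weight_f1: "a1 * n1 = a12 * n2 + a13 * n3"
    and weight_f2: "a2 * n2 = a23 * n3 + a24 * n4"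
    and weight_f3: "a3 * n3 = a31 * n1 + a34 * n4"
    and weight_f4: "a4 * n4 = a41 * n1 + a42 * n2"
    and weight_f5: "a41 * n1 + a23 * n3 = a12 * n2 + a34 * n4"
begin

fun wt :: "quad \<Rightarrow> nat" where "wt (p, q, r, s) = p * n1 + q * n2 + r * n3 + s * n4"
fun deg :: "quad \<Rightarrow> nat" where "deg (p, q, r, s) = p + q + r + s"

text \<open>Invariance under the five moves, stated for predicates so that connectedness of weight classes can be
used by exhibiting a predicate.\<close>

definition invariant :: "(quad \<Rightarrow> bool) \<Rightarrow> bool" where
  "invariant P \<longleftrightarrow> (\<forall>p q r s.
     (P (p + a1, q, r, s) \<longleftrightarrow> P (p, q + a12, r + a13, s)) \<and>
     (P (p, q + a2, r, s) \<longleftrightarrow> P (p, q, r + a23, s + a24)) \<and>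
     (P (p, q, r + a3, s) \<longleftrightarrow> P (p + a31, q, r, s + a34)) \<and>
     (P (p, q, r, s + a4) \<longleftrightarrow> P (p + a41, q + a42, r, s)) \<and>
     (P (p + a41, q, r + a23, s) \<longleftrightarrow> P (p, q + a12, r, s + a34)))"

end

locale connected_bresinsky = bresinsky +
  assumes connected: "invariant P \<Longrightarrow> wt x = wt y \<Longrightarrow> P x \<Longrightarrow> P y"
    and a34_le: "a34 \<le> a24"
begin

text \<open>Each move applies to a pure power \<open>x\<^sub>i\<^bsup>k\<^esup>\<close> only through \<open>x\<^sub>i\<^bsup>a\<^sub>i\<^esup>\<close>, so for \<open>k < a\<^sub>i\<close> it is alone
in its weight class.\<close>

lemma pure_power_minimal:
  assumes "wt x = wt y" "x \<noteq> y"
  shows "x = (p, 0, 0, 0) \<Longrightarrow> a1 \<le> p" "x = (0, q, 0, 0) \<Longrightarrow> a2 \<le> q"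
    "x = (0, 0, r, 0) \<Longrightarrow> a3 \<le> r" "x = (0, 0, 0, s) \<Longrightarrow> a4 \<le> s"
proof -
  have ni: "\<not> invariant (\<lambda>z. z = x)" using connected[of "\<lambda>z. z = x" x y] assms by auto
  show "a1 \<le> p" if "x = (p, 0, 0, 0)"
    by (rule ccontr) (use ni that exps in \<open>auto simp: invariant_def\<close>)
  show "a2 \<le> q" if "x = (0, q, 0, 0)"
    by (rule ccontr) (use ni that exps in \<open>auto simp: invariant_def\<close>)
  show "a3 \<le> r" if "x = (0, 0, r, 0)"
    by (rule ccontr) (use ni that exps in \<open>auto simp: invariant_def\<close>)
  show "a4 \<le> s" if "x = (0, 0, 0, s)"
    by (rule ccontr) (use ni that exps in \<open>auto simp: invariant_def\<close>)
qed

text \<open>Combining the weight of \<open>f\<^sub>5\<close> with those of the others expresses \<open>x\<^sub>1\<^bsup>a31 + a41\<^esup>\<close> and its analogues by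
the other variables, and minimality gives four inequalities. Substituting back, the excesses satisfy
\<open>x * n1 + y * n3 = 0\<close> and \<open>u * n2 + v * n4 = 0\<close>.\<close>

lemma exponent_relations: "a1 = a31 + a41" "a2 = a12 + a42" "a3 = a13 + a23" "a4 = a24 + a34"
proof -
  obtain d1 d2 d3 d4 where d: "a1 = d1 + a41" "a2 = d2 + a12" "a3 = d3 + a23" "a4 = d4 + a34"
    using exps by (metis less_imp_add_positive add.commute)
  note w = weight_f1 weight_f2 weight_f3 weight_f4 weight_f5
  have e1: "(a31 + a41) * n1 = a12 * n2 + d3 * n3"
    using w(3,5) unfolding d by (simp add: add_mult_distrib)
  have e2: "(a12 + a42) * n2 = a23 * n3 + d4 * n4"
    using w(4,5) unfolding d by (simp add: add_mult_distrib)
  have e3: "(a13 + a23) * n3 = d1 * n1 + a34 * n4"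
    using w(1,5) unfolding d by (simp add: add_mult_distrib)
  have e4: "(a24 + a34) * n4 = a41 * n1 + d2 * n2"
    using w(2,5) unfolding d by (simp add: add_mult_distrib)
  have m1: "a1 \<le> a31 + a41"
    using pure_power_minimal(1)[of "(a31 + a41, 0, 0, 0)" "(0, a12, d3, 0)"] e1 exps by auto
  have m2: "a2 \<le> a12 + a42"
    using pure_power_minimal(2)[of "(0, a12 + a42, 0, 0)" "(0, 0, a23, d4)"] e2 exps by auto
  have m3: "a3 \<le> a13 + a23"
    using pure_power_minimal(3)[of "(0, 0, a13 + a23, 0)" "(d1, 0, 0, a34)"] e3 exps by auto
  have m4: "a4 \<le> a24 + a34"
    using pure_power_minimal(4)[of "(0, 0, 0, a24 + a34)" "(a41, d2, 0, 0)"] e4 exps by auto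
  obtain x y where xy: "a31 + a41 = a1 + x" "a13 + a23 = a3 + y"
    using m1 m3 by (metis le_Suc_ex)
  have a13: "a13 = d3 + y" using xy(2) d(3) by simp
  have "x * n1 + y * n3 = 0"
    using e1 w(1) unfolding xy(1) a13 by (simp add: add_mult_distrib)
  then have "x = 0" "y = 0" using n_pos by auto
  then show "a1 = a31 + a41" "a3 = a13 + a23" using xy by auto
  obtain u v where uv: "a12 + a42 = a2 + u" "a24 + a34 = a4 + v"
    using m2 m4 by (metis le_Suc_ex)
  have a24: "a24 = d4 + v" using uv(2) d(4) by simp
  have "u * n2 + v * n4 = 0"
    using e2 w(2) unfolding uv(1) a24 by (simp add: add_mult_distrib)
  then have "u = 0" "v = 0" using n_pos by auto
  then show "a2 = a12 + a42" "a4 = a24 + a34" using uv by auto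
qed

definition max_deg :: "quad \<Rightarrow> bool" where
  "max_deg x \<longleftrightarrow> (\<forall>y. wt y = wt x \<longrightarrow> deg y \<le> deg x)"

definition regular :: bool where
  "regular \<longleftrightarrow> (\<forall>p q r s. max_deg (p, q, r, s) \<longrightarrow> max_deg (Suc p, q, r, s))"

lemma deg_le_wt: "deg x \<le> wt x"
proof (cases x)
  case (fields p q r s)
  have "p \<le> p * n1" "q \<le> q * n2" "r \<le> r * n3" "s \<le> s * n4" using n_pos by simp_all
  then show ?thesis unfolding fields wt.simps deg.simps by linarith
qed

text \<open>A largest monomial \<open>y\<close> of the weight of \<open>(p, q, r, s)\<close> gives the multiple \<open>x\<^sub>1 y\<close> of largest degree in the
weight class of \<open>x\<close>, and \<open>P\<close> holds on that class.\<close>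

lemma regularD:
  assumes regular and "invariant P" "P x" and w: "wt x = wt (Suc p, q, r, s)"
  shows "\<exists>p q r s. P (Suc p, q, r, s) \<and> deg x \<le> deg (Suc p, q, r, s)"
proof -
  have "\<exists>y. wt y = wt (p, q, r, s) \<and> (\<forall>z. wt z = wt (p, q, r, s) \<longrightarrow> deg z \<le> deg y)"
    by (rule ex_has_greatest_nat[where b = "Suc (wt (p, q, r, s))" and k = "(p, q, r, s)"])
      (use deg_le_wt in \<open>auto simp: less_Suc_eq_le simp del: wt.simps deg.simps\<close>, metis)
  then obtain p' q' r' s' where y: "wt (p', q', r', s') = wt (p, q, r, s)" "max_deg (p', q', r', s')"
    unfolding max_deg_def by (metis prod_cases4)
  have "max_deg (Suc p', q', r', s')" using y(2) \<open>regular\<close> unfolding regular_def by blast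
  moreover have "wt x = wt (Suc p', q', r', s')" using w y(1) by simp
  ultimately show ?thesis
    using connected[OF assms(2) _ assms(3)] unfolding max_deg_def by metis
qed

text \<open>The weight class of \<open>x\<^sub>3\<^bsup>a3\<^esup>\<close> consists of the two terms of \<open>f\<^sub>3\<close> only.\<close>

lemma regular_imp_cond1:
  assumes regular shows "a3 \<le> a31 + a34"
proof -
  let ?P = "\<lambda>x. x = (0, 0, a3, 0) \<or> x = (a31, 0, 0, a34)"
  have inv: "invariant ?P" using exps a34_le by (auto simp: invariant_def)
  obtain b where b: "a31 = Suc b" using exps by (cases a31) auto
  have "wt (0, 0, a3, 0) = wt (Suc b, 0, 0, a34)" using weight_f3 unfolding b[symmetric] by simp
  then obtain p q r s where "?P (Suc p, q, r, s)" "deg (0, 0, a3, 0) \<le> deg (Suc p, q, r, s)"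
    using regularD[OF assms inv, of "(0, 0, a3, 0)"] by blast
  then show ?thesis by auto
qed

text \<open>The weight class of \<open>x\<^sub>2\<^bsup>a12\<^esup> x\<^sub>4\<^bsup>a34\<^esup>\<close> consists of the two terms of \<open>f\<^sub>5\<close> only.\<close>

lemma regular_imp_cond2:
  assumes regular shows "a12 + a34 \<le> a41 + a23"
proof -
  let ?P = "\<lambda>x. x = (0, a12, 0, a34) \<or> x = (a41, 0, a23, 0)"
  have inv: "invariant ?P" using exps a34_le by (auto simp: invariant_def)
  obtain b where b: "a41 = Suc b" using exps by (cases a41) auto
  have "wt (0, a12, 0, a34) = wt (Suc b, 0, a23, 0)" using weight_f5 unfolding b[symmetric] by simp
  then obtain p q r s where "?P (Suc p, q, r, s)" "deg (0, a12, 0, a34) \<le> deg (Suc p, q, r, s)"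
    using regularD[OF assms inv, of "(0, a12, 0, a34)"] by blast
  then show ?thesis by auto
qed

text \<open>The weight class of \<open>x\<^sub>2\<^bsup>a2 + a12\<^esup>\<close>: applying \<open>f\<^sub>2\<close> and then \<open>f\<^sub>5\<close> leads to
\<open>x\<^sub>1\<^bsup>a41\<^esup> x\<^sub>3\<^bsup>2 a23\<^esup> x\<^sub>4\<^bsup>a24 - a34\<^esup>\<close>, from which \<open>f\<^sub>3\<close> may be used backwards \<open>j\<close> times
(\<open>E_chain j\<close>) or, if \<open>a13 \<le> a23\<close>, once forwards.\<close>

definition E_chain :: "nat \<Rightarrow> quad \<Rightarrow> bool" where
  "E_chain j x \<longleftrightarrow> (case x of (p, q, r, s) \<Rightarrow>
     p + j * a31 = a41 \<and> q = 0 \<and> r = 2 * a23 + j * a3 \<and> s + a34 + j * a34 = a24)"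

definition x2_class :: "quad \<Rightarrow> bool" where
  "x2_class x \<longleftrightarrow> x = (0, a2 + a12, 0, 0) \<or> x = (0, a12, a23, a24) \<or>
     (a13 \<le> a23 \<and> x = (a1, 0, a23 - a13, a24)) \<or> (\<exists>j. E_chain j x)"

lemma x2_class_invariant: "invariant x2_class"
  unfolding invariant_def
proof (intro allI conjI)
  note rel = exponent_relations
  fix p q r s
  show "x2_class (p + a1, q, r, s) \<longleftrightarrow> x2_class (p, q + a12, r + a13, s)"
    using exps by (auto simp: x2_class_def E_chain_def)
  show "x2_class (p, q + a2, r, s) \<longleftrightarrow> x2_class (p, q, r + a23, s + a24)"
    using exps by (auto simp: x2_class_def E_chain_def)
  show "x2_class (p, q, r, s + a4) \<longleftrightarrow> x2_class (p + a41, q + a42, r, s)"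
    using exps by (auto simp: x2_class_def E_chain_def)
  show "x2_class (p + a41, q, r + a23, s) \<longleftrightarrow> x2_class (p, q + a12, r, s + a34)"
  proof
    assume "x2_class (p + a41, q, r + a23, s)"
    then obtain j where j: "E_chain j (p + a41, q, r + a23, s)"
      using exps by (auto simp: x2_class_def)
    then have "p + j * a31 = 0" by (simp add: E_chain_def)
    then have "j = 0" using exps by simp
    then show "x2_class (p, q + a12, r, s + a34)" using j by (simp add: x2_class_def E_chain_def)
  next
    assume "x2_class (p, q + a12, r, s + a34)"
    then have "p = 0" "q = 0" "r = a23" "s + a34 = a24"
      using exps by (auto simp: x2_class_def E_chain_def)
    then have "E_chain 0 (p + a41, q, r + a23, s)" by (simp add: E_chain_def)
    then show "x2_class (p + a41, q, r + a23, s)" unfolding x2_class_def by blast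
  qed
  show "x2_class (p, q, r + a3, s) \<longleftrightarrow> x2_class (p + a31, q, r, s + a34)"
  proof
    assume "x2_class (p, q, r + a3, s)"
    then obtain j where j: "E_chain j (p, q, r + a3, s)"
      using exps by (auto simp: x2_class_def)
    show "x2_class (p + a31, q, r, s + a34)"
    proof (cases j)
      case 0
      then have "p = a41" "q = 0" "r + a3 = 2 * a23" "s + a34 = a24"
        using j by (auto simp: E_chain_def)
      moreover from this have "p + a31 = a1" "a13 \<le> a23" "r = a23 - a13"
        using rel by linarith+
      ultimately show ?thesis by (simp add: x2_class_def)
    next
      case (Suc i)
      then have "E_chain i (p + a31, q, r, s + a34)" using j by (simp add: E_chain_def)
      then show ?thesis unfolding x2_class_def by blast
    qed
  next
    assume "x2_class (p + a31, q, r, s + a34)"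
    then consider "a13 \<le> a23" "(p + a31, q, r, s + a34) = (a1, 0, a23 - a13, a24)"
      | j where "E_chain j (p + a31, q, r, s + a34)"
      using exps by (auto simp: x2_class_def)
    then have "\<exists>j. E_chain j (p, q, r + a3, s)"
    proof cases
      case 1
      then have "p + a31 = a1" "q = 0" "r = a23 - a13" "s + a34 = a24" by auto
      then have "p = a41" "r + a3 = 2 * a23" using 1(1) rel by linarith+
      then have "E_chain 0 (p, q, r + a3, s)"
        using \<open>q = 0\<close> \<open>s + a34 = a24\<close> by (simp add: E_chain_def)
      then show ?thesis ..
    next
      case (2 j)
      then have "E_chain (Suc j) (p, q, r + a3, s)" by (simp add: E_chain_def)
      then show ?thesis ..
    qed
    then show "x2_class (p, q, r + a3, s)" unfolding x2_class_def by blast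
  qed
qed

text \<open>By the first condition, a backward use of \<open>f\<^sub>3\<close> never raises the degree. So the largest multiple of \<open>x\<^sub>1\<close>
in the class is the forward one if it exists, and the start of the chain otherwise.\<close>

lemma regular_imp_cond3:
  assumes regular
  shows "a23 < a13 \<and> a2 + a12 + a34 \<le> a41 + 2 * a23 + a24 \<or>
    a13 \<le> a23 \<and> a2 + a12 + a13 \<le> a1 + a23 + a24"
proof -
  have 1: "a3 \<le> a31 + a34" by (rule regular_imp_cond1[OF assms])
  obtain b where b: "a41 = Suc b" using exps by (cases a41) auto
  obtain d where d: "a24 = a34 + d" using a34_le le_Suc_ex by blast
  have "wt (0, a2 + a12, 0, 0) = wt (Suc b, 0, 2 * a23, d)"
    using weight_f2 weight_f5 unfolding b[symmetric] d by (simp add: add_mult_distrib)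
  moreover have "x2_class (0, a2 + a12, 0, 0)" by (simp add: x2_class_def)
  ultimately obtain p q r s where P: "x2_class (Suc p, q, r, s)"
    and "deg (0, a2 + a12, 0, 0) \<le> deg (Suc p, q, r, s)"
    using regularD[OF assms x2_class_invariant] by blast
  then have le: "a2 + a12 \<le> Suc p + q + r + s" by simp
  from P consider "a13 \<le> a23" "(Suc p, q, r, s) = (a1, 0, a23 - a13, a24)"
    | j where "E_chain j (Suc p, q, r, s)"
    by (auto simp: x2_class_def)
  then show ?thesis
  proof cases
    case 1
    then show ?thesis using le by auto
  next
    case (2 j)
    have "j * a3 \<le> j * a31 + j * a34" using 1 by (metis add_mult_distrib2 mult_le_mono2)
    then have "a2 + a12 + a34 \<le> a41 + 2 * a23 + a24" using 2 le by (simp add: E_chain_def)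
    then show ?thesis using 1 exponent_relations by (cases "a23 < a13") auto
  qed
qed

text \<open>The target \<open>x\<^sub>1\<^bsup>c1\<^esup> x\<^sub>3\<^bsup>c3\<^esup> x\<^sub>4\<^bsup>c4\<^esup>\<close> of the sixth rule is the multiple of \<open>x\<^sub>1\<close> in the class of
\<open>x\<^sub>2\<^bsup>a2 + a12\<^esup>\<close> that has the largest degree under the first condition.\<close>

definition "c1 = (if a23 < a13 then a41 else a1)"
definition "c3 = (if a23 < a13 then 2 * a23 else a23 - a13)"
definition "c4 = (if a23 < a13 then a24 - a34 else a24)"
lemmas c_defs = c1_def c3_def c4_def

inductive step :: "quad \<Rightarrow> quad \<Rightarrow> bool" where
  r1: "a12 \<le> q \<Longrightarrow> a13 \<le> r \<Longrightarrow> step (p, q, r, s) (p + a1, q - a12, r - a13, s)"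
| r2: "a23 \<le> r \<Longrightarrow> a24 \<le> s \<Longrightarrow> step (p, q, r, s) (p, q + a2, r - a23, s - a24)"
| r3: "a3 \<le> r \<Longrightarrow> step (p, q, r, s) (p + a31, q, r - a3, s + a34)"
| r4: "a4 \<le> s \<Longrightarrow> step (p, q, r, s) (p + a41, q + a42, r, s - a4)"
| r5: "a12 \<le> q \<Longrightarrow> a34 \<le> s \<Longrightarrow> step (p, q, r, s) (p + a41, q - a12, r + a23, s - a34)"
| r6: "a2 + a12 \<le> q \<Longrightarrow> step (p, q, r, s) (p + c1, q - (a2 + a12), r + c3, s + c4)"

definition joinable :: "quad \<Rightarrow> quad \<Rightarrow> bool" where
  "joinable x y \<longleftrightarrow> (\<exists>v. step\<^sup>*\<^sup>* x v \<and> step\<^sup>*\<^sup>* y v)"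

lemma joinable_sym: "joinable x y \<Longrightarrow> joinable y x"
  unfolding joinable_def by blast

lemma joinable_refl: "joinable x x"
  unfolding joinable_def by blast

lemma joinable_step_right: "step y z \<Longrightarrow> z = x \<Longrightarrow> joinable x y"
  unfolding joinable_def by blast

lemma joinable_steps: "step x u \<Longrightarrow> step y v \<Longrightarrow> u = v \<Longrightarrow> joinable x y"
  unfolding joinable_def by blast

lemma joinable_step2_right: "step y z \<Longrightarrow> step z z' \<Longrightarrow> z' = x \<Longrightarrow> joinable x y"
  unfolding joinable_def by (meson converse_rtranclp_into_rtranclp rtranclp.rtrancl_refl)

end

section \<open>Rewriting monomials towards larger degree\<close>

context connected_bresinsky
begin

lemmas arith_facts = exponent_relations exps a34_le

lemma c_small: "a23 < a13 \<Longrightarrow> c1 = a41 \<and> c3 = 2 * a23 \<and> c4 = a24 - a34"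
  and c_large: "\<not> a23 < a13 \<Longrightarrow> c1 = a1 \<and> c3 = a23 - a13 \<and> c4 = a24"
  by (simp_all add: c_defs)

text \<open>For each pair of rules that apply to the same monomial, the two results are joinable. When the left-hand
sides share a variable, the pair is closed by the rules named in its proof; otherwise the two rules
commute.\<close>

lemma join_12:
  assumes "a12 \<le> q" "a13 \<le> r" "a23 \<le> r" "a24 \<le> s"
  shows "joinable (p + a1, q - a12, r - a13, s) (p, q + a2, r - a23, s - a24)"
proof (cases "a23 < a13")
  case True
  show ?thesis
    by (rule joinable_step2_right[OF r6 r3]) (use assms arith_facts c_small[OF True] True in auto)
next
  case False
  show ?thesis
    by (rule joinable_step_right[OF r6]) (use assms arith_facts c_large[OF False] False in auto)
qed

lemma join_13:
  assumes "a12 \<le> q" "a3 \<le> r"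
  shows "joinable (p + a1, q - a12, r - a13, s) (p + a31, q, r - a3, s + a34)"
  by (rule joinable_step_right[OF r5]) (use assms arith_facts in auto)

lemma join_14:
  assumes "a12 \<le> q" "a13 \<le> r" "a4 \<le> s"
  shows "joinable (p + a1, q - a12, r - a13, s) (p + a41, q + a42, r, s - a4)"
  by (rule joinable_steps[OF r4 r1]) (use assms in auto)

lemma join_15:
  assumes "a12 \<le> q" "a13 \<le> r" "a34 \<le> s"
  shows "joinable (p + a1, q - a12, r - a13, s) (p + a41, q - a12, r + a23, s - a34)"
  by (rule joinable_step_right[OF r3]) (use assms arith_facts in auto)

lemma join_16:
  assumes "a2 + a12 \<le> q" "a13 \<le> r"
  shows "joinable (p + a1, q - a12, r - a13, s) (p + c1, q - (a2 + a12), r + c3, s + c4)"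
proof (cases "a23 < a13")
  case True
  show ?thesis
    by (rule joinable_step2_right[OF r3 r2]) (use assms arith_facts c_small[OF True] True in auto)
next
  case False
  show ?thesis
    by (rule joinable_step_right[OF r2]) (use assms arith_facts c_large[OF False] False in auto)
qed

lemma join_23:
  assumes "a3 \<le> r" "a24 \<le> s"
  shows "joinable (p, q + a2, r - a23, s - a24) (p + a31, q, r - a3, s + a34)"
  by (rule joinable_steps[OF r1 r4]) (use assms arith_facts in auto)

lemma join_24:
  assumes "a23 \<le> r" "a4 \<le> s"
  shows "joinable (p + a41, q + a42, r, s - a4) (p, q + a2, r - a23, s - a24)"
  by (rule joinable_step_right[OF r5]) (use assms arith_facts in auto)

lemma join_25:
  assumes "a12 \<le> q" "a23 \<le> r" "a24 \<le> s"
  shows "joinable (p + a41, q - a12, r + a23, s - a34) (p, q + a2, r - a23, s - a24)"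
proof (cases "a23 < a13")
  case True
  show ?thesis
    by (rule joinable_step_right[OF r6]) (use assms arith_facts c_small[OF True] True in auto)
next
  case False
  show ?thesis
    by (rule joinable_steps[OF r3 r6]) (use assms arith_facts c_large[OF False] False in auto)
qed

lemma join_26:
  assumes "a23 \<le> r" "a24 \<le> s" "a2 + a12 \<le> q"
  shows "joinable (p, q + a2, r - a23, s - a24) (p + c1, q - (a2 + a12), r + c3, s + c4)"
  by (rule joinable_steps[OF r6 r2]) (use assms in auto)

lemma join_34:
  assumes "a3 \<le> r" "a4 \<le> s"
  shows "joinable (p + a31, q, r - a3, s + a34) (p + a41, q + a42, r, s - a4)"
  by (rule joinable_steps[OF r4 r3]) (use assms in auto)

lemma join_35:
  assumes "a3 \<le> r" "a12 \<le> q" "a34 \<le> s"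
  shows "joinable (p + a31, q, r - a3, s + a34) (p + a41, q - a12, r + a23, s - a34)"
  by (rule joinable_steps[OF r5 r3]) (use assms in auto)

lemma join_36:
  assumes "a3 \<le> r" "a2 + a12 \<le> q"
  shows "joinable (p + a31, q, r - a3, s + a34) (p + c1, q - (a2 + a12), r + c3, s + c4)"
  by (rule joinable_steps[OF r6 r3]) (use assms in auto)

lemma join_45:
  assumes "a12 \<le> q" "a4 \<le> s"
  shows "joinable (p + a41, q + a42, r, s - a4) (p + a41, q - a12, r + a23, s - a34)"
  by (rule joinable_step_right[OF r2]) (use assms arith_facts in auto)

lemma join_46:
  assumes "a4 \<le> s" "a2 + a12 \<le> q"
  shows "joinable (p + a41, q + a42, r, s - a4) (p + c1, q - (a2 + a12), r + c3, s + c4)"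
  by (rule joinable_steps[OF r6 r4]) (use assms in auto)

lemma join_56:
  assumes "a2 + a12 \<le> q" "a34 \<le> s"
  shows "joinable (p + a41, q - a12, r + a23, s - a34) (p + c1, q - (a2 + a12), r + c3, s + c4)"
proof (cases "a23 < a13")
  case True
  show ?thesis
    by (rule joinable_step_right[OF r2]) (use assms arith_facts c_small[OF True] True in auto)
next
  case False
  show ?thesis
    by (rule joinable_steps[OF r1 r4]) (use assms arith_facts c_large[OF False] False in auto)
qed

lemma locally_confluent:
  assumes "step x y" "step x z"
  shows "joinable y z"
proof -
  obtain p q r s where x: "x = (p, q, r, s)" by (metis prod_cases4)
  have cases: "(a12 \<le> q \<and> a13 \<le> r \<and> y = (p + a1, q - a12, r - a13, s)) \<or>
      (a23 \<le> r \<and> a24 \<le> s \<and> y = (p, q + a2, r - a23, s - a24)) \<or>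
      (a3 \<le> r \<and> y = (p + a31, q, r - a3, s + a34)) \<or>
      (a4 \<le> s \<and> y = (p + a41, q + a42, r, s - a4)) \<or>
      (a12 \<le> q \<and> a34 \<le> s \<and> y = (p + a41, q - a12, r + a23, s - a34)) \<or>
      (a2 + a12 \<le> q \<and> y = (p + c1, q - (a2 + a12), r + c3, s + c4))" if "step x y" for y
    using that unfolding x by (cases rule: step.cases) simp_all
  note joins = join_12 join_13 join_14 join_15 join_16 join_23 join_24 join_25 join_26
    join_34 join_35 join_36 join_45 join_46 join_56
  show ?thesis
    using cases[OF assms(1)] cases[OF assms(2)]
    by (elim disjE conjE)
      (simp only:, (rule joinable_refl | (rule joins; assumption) | (rule joinable_sym, rule joins; assumption)))+
qed

lemma step_weight: "step x y \<Longrightarrow> wt y = wt x"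
proof (induction rule: step.induct)
  note w = weight_f1 weight_f2 weight_f3 weight_f4 weight_f5
  case (r1 q r p s)
  obtain q' r' where "q = q' + a12" "r = r' + a13" using r1 by (metis le_add_diff_inverse2)
  then show ?case using w by (simp add: add_mult_distrib)
next
  note w = weight_f1 weight_f2 weight_f3 weight_f4 weight_f5
  case (r2 r s p q)
  obtain r' s' where "r = r' + a23" "s = s' + a24" using r2 by (metis le_add_diff_inverse2)
  then show ?case using w by (simp add: add_mult_distrib)
next
  note w = weight_f1 weight_f2 weight_f3 weight_f4 weight_f5
  case (r3 r p q s)
  obtain r' where "r = r' + a3" using r3 by (metis le_add_diff_inverse2)
  then show ?case using w by (simp add: add_mult_distrib)
next
  note w = weight_f1 weight_f2 weight_f3 weight_f4 weight_f5
  case (r4 s p q r)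
  obtain s' where "s = s' + a4" using r4 by (metis le_add_diff_inverse2)
  then show ?case using w by (simp add: add_mult_distrib)
next
  note w = weight_f1 weight_f2 weight_f3 weight_f4 weight_f5
  case (r5 q s p r)
  obtain q' s' where "q = q' + a12" "s = s' + a34" using r5 by (metis le_add_diff_inverse2)
  then show ?case using w by (simp add: add_mult_distrib)
next
  note w = weight_f1 weight_f2 weight_f3 weight_f4 weight_f5
  case (r6 q p r s)
  obtain q' where q: "q = q' + (a2 + a12)" using r6 by (metis le_add_diff_inverse2)
  have "(a2 + a12) * n2 = c1 * n1 + c3 * n3 + c4 * n4"
  proof (cases "a23 < a13")
    case True
    obtain d where d: "a24 = a34 + d" using a34_le le_Suc_ex by blast
    then show ?thesis using w c_small[OF True] by (simp add: add_mult_distrib)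
  next
    case False
    then obtain d where d: "a23 = a13 + d" by (metis le_Suc_ex not_less)
    then show ?thesis using w c_large[OF False] by (simp add: add_mult_distrib)
  qed
  then show ?case unfolding q by (simp add: add_mult_distrib)
qed

lemma steps_weight: "step\<^sup>*\<^sup>* x y \<Longrightarrow> wt y = wt x"
  by (induction rule: rtranclp_induct) (simp_all add: step_weight)

context
  assumes cond1: "a3 \<le> a31 + a34"
    and cond2: "a12 + a34 \<le> a41 + a23"
    and cond3: "a23 < a13 \<and> a2 + a12 + a34 \<le> a41 + 2 * a23 + a24 \<or>
      a13 \<le> a23 \<and> a2 + a12 + a13 \<le> a1 + a23 + a24"
begin

text \<open>The orientation of \<open>f\<^sub>1, f\<^sub>2, f\<^sub>4\<close> is forced by \<open>n1 < n2 < n3 < n4\<close>.\<close>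

lemma f1_degree: "a12 + a13 \<le> a1" and f2_degree: "a23 + a24 < a2" and f4_degree: "a4 < a41 + a42"
proof -
  have "(a12 + a13) * n1 \<le> a12 * n2 + a13 * n3"
    unfolding add_mult_distrib using n_less by (intro add_mono mult_le_mono) auto
  then have "(a12 + a13) * n1 \<le> a1 * n1" using weight_f1 by simp
  then show "a12 + a13 \<le> a1" using n_pos by simp
  have "a23 * n2 < a23 * n3" "a24 * n2 < a24 * n4" using exps n_less by simp_all
  then have "(a23 + a24) * n2 < a2 * n2" unfolding weight_f2 add_mult_distrib by linarith
  then show "a23 + a24 < a2" by simp
  have "a41 * n1 < a41 * n4" "a42 * n2 < a42 * n4" using exps n_less by simp_all
  then have "a4 * n4 < (a41 + a42) * n4" unfolding weight_f4 add_mult_distrib by linarith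
  then show "a4 < a41 + a42" by simp
qed

text \<open>Steps that keep the degree still raise the exponent of \<open>x\<^sub>1\<close>. Both are bounded by the weight, so
rewriting terminates.\<close>

lemma step_improves: "step x y \<Longrightarrow> deg x < deg y \<or> deg x = deg y \<and> fst x < fst y"
  and step_fst_mono: "step x y \<Longrightarrow> fst x \<le> fst y"
proof -
  have c: "0 < c1" "a2 + a12 \<le> c1 + c3 + c4"
    using exps cond3 a34_le by (auto simp: c_defs)
  show "step x y \<Longrightarrow> deg x < deg y \<or> deg x = deg y \<and> fst x < fst y"
    by (induction rule: step.induct)
      (use f1_degree f2_degree f4_degree cond1 cond2 exps c in auto)
  show "step x y \<Longrightarrow> fst x \<le> fst y"
    by (induction rule: step.induct) auto
qed

lemma fst_le_wt: "fst x \<le> wt x"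
  using deg_le_wt[of x] by (cases x) auto

lemma step_wf: "wf {(y, x). step x y}"
proof (rule wf_subset)
  show "wf (measures [\<lambda>x. wt x - deg x, \<lambda>x. wt x - fst x])" by (rule wf_measures)
  show "{(y, x). step x y} \<subseteq> measures [\<lambda>x. wt x - deg x, \<lambda>x. wt x - fst x]"
  proof clarify
    fix x y assume "step x y"
    then show "(y, x) \<in> measures [\<lambda>x. wt x - deg x, \<lambda>x. wt x - fst x]"
      using step_improves[of x y] step_weight[of x y] deg_le_wt[of y] fst_le_wt[of y]
      by (auto simp del: wt.simps deg.simps)
  qed
qed

lemma steps_mono: "step\<^sup>*\<^sup>* x y \<Longrightarrow> deg x \<le> deg y \<and> fst x \<le> fst y"
proof (induction rule: rtranclp_induct)
  case (step y z)
  then show ?case using step_improves[OF step.hyps(2)] step_fst_mono[OF step.hyps(2)] by linarith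
qed simp

lemma joinable_step_iff:
  assumes "step y z"
  shows "joinable x y \<longleftrightarrow> joinable x z"
proof
  assume "joinable x y"
  then obtain v where v: "step\<^sup>*\<^sup>* x v" "step\<^sup>*\<^sup>* y v" unfolding joinable_def by blast
  have "\<exists>u. step\<^sup>*\<^sup>* v u \<and> step\<^sup>*\<^sup>* z u"
    by (rule newman[OF step_wf _ v(2)]) (use locally_confluent assms in \<open>auto simp: joinable_def\<close>)
  then show "joinable x z" using v(1) unfolding joinable_def by (meson rtranclp_trans)
next
  assume "joinable x z"
  then show "joinable x y" using assms unfolding joinable_def by (meson converse_rtranclp_into_rtranclp)
qed

lemma joinable_invariant: "invariant (joinable x)"
  unfolding invariant_def
proof (intro allI conjI)
  fix p q r s
  show "joinable x (p + a1, q, r, s) \<longleftrightarrow> joinable x (p, q + a12, r + a13, s)"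
    using joinable_step_iff[OF r1[of "q + a12" "r + a13" p s], of x] by simp
  show "joinable x (p, q + a2, r, s) \<longleftrightarrow> joinable x (p, q, r + a23, s + a24)"
    using joinable_step_iff[OF r2[of "r + a23" "s + a24" p q], of x] by simp
  show "joinable x (p, q, r + a3, s) \<longleftrightarrow> joinable x (p + a31, q, r, s + a34)"
    using joinable_step_iff[OF r3[of "r + a3" p q s], of x] by simp
  show "joinable x (p, q, r, s + a4) \<longleftrightarrow> joinable x (p + a41, q + a42, r, s)"
    using joinable_step_iff[OF r4[of "s + a4" p q r], of x] by simp
  show "joinable x (p + a41, q, r + a23, s) \<longleftrightarrow> joinable x (p, q + a12, r, s + a34)"
    using joinable_step_iff[OF r5[of "q + a12" "s + a34" p r], of x] by simp
qed

text \<open>Two monomials of equal weight have a common reduct. If one is \<open>x\<^sub>1 m\<close> with \<open>m\<close> maximal, the reduct is \<open>x\<^sub>1 m'\<close>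
with \<open>m'\<close> of the weight of \<open>m\<close>, so its degree, and with it that of the other monomial, is at most that of
\<open>x\<^sub>1 m\<close>.\<close>

lemma conditions_imp_regular: regular
  unfolding regular_def
proof (intro allI impI)
  fix p q r s assume max: "max_deg (p, q, r, s)"
  show "max_deg (Suc p, q, r, s)"
    unfolding max_deg_def
  proof (intro allI impI)
    fix y assume y: "wt y = wt (Suc p, q, r, s)"
    have "joinable (Suc p, q, r, s) y"
      using connected[OF joinable_invariant y[symmetric] joinable_refl] .
    then obtain v where v: "step\<^sup>*\<^sup>* (Suc p, q, r, s) v" "step\<^sup>*\<^sup>* y v"
      unfolding joinable_def by blast
    obtain p' q' r' s' where v': "v = (p', q', r', s')" by (metis prod_cases4)
    have "Suc p \<le> p'" using steps_mono[OF v(1)] v' by simp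
    then obtain t where t: "p' = Suc t" by (metis Suc_le_D)
    have "wt (t, q', r', s') = wt (p, q, r, s)"
      using steps_weight[OF v(1)] by (simp add: v' t)
    then have "deg (t, q', r', s') \<le> deg (p, q, r, s)" using max unfolding max_deg_def by blast
    then have "deg v \<le> deg (Suc p, q, r, s)" by (simp add: v' t)
    then show "deg y \<le> deg (Suc p, q, r, s)" using steps_mono[OF v(2)] by linarith
  qed
qed

end

theorem regular_iff:
  "regular \<longleftrightarrow> a3 \<le> a31 + a34 \<and> a12 + a34 \<le> a41 + a23 \<and>
    (a23 < a13 \<and> a2 + a12 + a34 \<le> a41 + 2 * a23 + a24 \<or>
     a13 \<le> a23 \<and> a2 + a12 + a13 \<le> a1 + a23 + a24)"
  using regular_imp_cond1 regular_imp_cond2 regular_imp_cond3 conditions_imp_regular by blast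

end

section \<open>The criterion\<close>

definition monomial :: "quad \<Rightarrow> expo" where
  "monomial x = (case x of (p, q, r, s) \<Rightarrow> single 1 p + single 2 q + single 3 r + single 4 s)"

definition exponents :: "expo \<Rightarrow> quad" where
  "exponents m = (lookup m 1, lookup m 2, lookup m 3, lookup m 4)"

lemma exponents_monomial [simp]: "exponents (monomial x) = x"
  by (simp add: exponents_def monomial_def lookup_add lookup_single when_def split: prod.split)

lemma exponents_inj: "exponents m = exponents m' \<Longrightarrow> m = m'"
  using all_4[of "\<lambda>i. lookup m i = lookup m' i"] by (auto simp: exponents_def intro: poly_mapping_eqI)

lemma monomial_exponents [simp]: "monomial (exponents m) = m"
  by (rule exponents_inj) simp

lemma exponents_add:
  "exponents (m + m') = (lookup m 1 + lookup m' 1, lookup m 2 + lookup m' 2, lookup m 3 + lookup m' 3, lookup m 4 + lookup m' 4)"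
  by (simp add: exponents_def lookup_add)

lemma weight_eq_if_binomial_mem:
  assumes "single l 1 - single r (1 :: 'k::field) \<in> curve_ideal n"
  shows "weight n l = weight n r"
proof -
  have "(\<lambda>m. if weight n m = weight n l then 1 else 0 :: 'k) \<in> weight_tests n"
    by (simp add: weight_tests_def)
  then have "pairing (single l 1 - single r (1 :: 'k)) (\<lambda>m. if weight n m = weight n l then 1 else 0) = 0"
    using assms unfolding curve_ideal_eq annihilator_def by blast
  then show ?thesis by (simp add: pairing_diff split: if_splits)
qed

text \<open>The polynomials annihilated by all translates of the indicator function of \<open>P\<close> form an ideal, which contains
the generators by invariance of \<open>P\<close>. Hence it contains \<open>x\<^bsup>m\<^esup> - x\<^bsup>m'\<^esup>\<close>.\<close>

lemma invariant_constant_on_weights: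
  fixes B :: "(expo \<times> expo) set"
  assumes gen: "curve_ideal n \<subseteq> Idl\<^bsub>type_ring\<^esub> ((\<lambda>(l, r). single l 1 - single r 1) ` B :: 'k::field mpoly4 set)"
    and P: "\<And>l r u. (l, r) \<in> B \<Longrightarrow> P (u + l) \<longleftrightarrow> P (u + r)"
    and w: "weight n m = weight n m'"
  shows "P m \<longleftrightarrow> P m'"
proof -
  define h where "h m = (if P m then 1 else 0 :: 'k)" for m
  define H where "H = (\<lambda>u m. h (u + m)) ` UNIV"
  have "ideal (annihilator H) type_ring"
  proof (rule annihilator_ideal)
    fix g u assume "g \<in> H"
    then obtain v where "g = (\<lambda>m. h (v + m))" by (auto simp: H_def)
    then have "(\<lambda>m. g (u + m)) = (\<lambda>m. h (v + u + m))" by (simp add: add.assoc)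
    then show "(\<lambda>m. g (u + m)) \<in> H" unfolding H_def by blast
  qed
  moreover have "(\<lambda>(l, r). single l 1 - single r 1) ` B \<subseteq> annihilator H"
    using P by (auto simp: annihilator_def H_def h_def pairing_diff)
  ultimately have "curve_ideal n \<subseteq> annihilator H"
    using gen Idl_subsetI by blast
  then have "single m 1 - single m' 1 \<in> annihilator H"
    using binomial_mem_curve_ideal[OF w] by blast
  moreover have "(\<lambda>m. h (0 + m)) \<in> H" unfolding H_def by blast
  ultimately have "pairing (single m 1 - single m' 1) h = 0" by (simp add: annihilator_def)
  then show ?thesis by (simp add: pairing_diff h_def split: if_splits)
qed

theorem theorem3p18:
  fixes n :: "4 \<Rightarrow> nat"
    and a1 a2 a3 a4 a12 a13 a23 a24 a31 a34 a41 a42 :: nat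
    and I :: "'k::field mpoly4 set"
  assumes n_pos: "\<forall>i. 0 < n i"
    and n_gcd: "Gcd (range n) = 1"
    and n_less: "n 1 < n 2" "n 2 < n 3" "n 3 < n 4"
    and I_eq: "I = curve_ideal n"
    and not_ci: "\<not> complete_intersection I"
    and gorenstein: "gorenstein_curve n"
    and exps: "0 < a12 \<and> a12 < a2" "0 < a13 \<and> a13 < a3" "0 < a23 \<and> a23 < a3"
      "0 < a24 \<and> a24 < a4" "0 < a31 \<and> a31 < a1" "0 < a34 \<and> a34 < a4"
      "0 < a41 \<and> a41 < a1" "0 < a42 \<and> a42 < a2"
    and gens: "minimally_generates
      [indet 1 ^ a1 - indet 2 ^ a12 * indet 3 ^ a13,
       indet 2 ^ a2 - indet 3 ^ a23 * indet 4 ^ a24,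
       indet 3 ^ a3 - indet 1 ^ a31 * indet 4 ^ a34,
       indet 4 ^ a4 - indet 1 ^ a41 * indet 2 ^ a42,
       indet 1 ^ a41 * indet 3 ^ a23 - indet 2 ^ a12 * indet 4 ^ a34] I"
    and a34_le: "a34 \<le> a24"
  shows "cohen_macaulay_tangent_cone I \<longleftrightarrow>
    a3 \<le> a31 + a34 \<and>
    a12 + a34 \<le> a41 + a23 \<and>
    (a23 < a13 \<and> int a2 + int a12 \<le> int a41 + 2 * int a23 + int a24 - int a34 \<or>
     a13 \<le> a23 \<and> int a2 + int a12 \<le> int a1 + int a23 - int a13 + int a24)"
proof -
  define B :: "(expo \<times> expo) set" where "B =
    {(single 1 a1, single 2 a12 + single 3 a13),
     (single 2 a2, single 3 a23 + single 4 a24),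
     (single 3 a3, single 1 a31 + single 4 a34),
     (single 4 a4, single 1 a41 + single 2 a42),
     (single 1 a41 + single 3 a23, single 2 a12 + single 4 a34)}"
  let ?bin = "\<lambda>(l, r). single l 1 - single r 1 :: 'k mpoly4"
  have gen: "Idl\<^bsub>type_ring\<^esub> (?bin ` B) = curve_ideal n"
    using gens unfolding minimally_generates_def I_eq B_def
    by (simp add: indet_power mult_single)
  then have w: "weight n l = weight n r" if "(l, r) \<in> B" for l r
    using that Idl_superset[of "?bin ` B"] by (intro weight_eq_if_binomial_mem[where 'k = 'k]) force
  have "\<forall>(l, r)\<in>B. weight n l = weight n r" using w by blast
  then have weights: "a1 * n 1 = a12 * n 2 + a13 * n 3" "a2 * n 2 = a23 * n 3 + a24 * n 4"
    "a3 * n 3 = a31 * n 1 + a34 * n 4" "a4 * n 4 = a41 * n 1 + a42 * n 2"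
    "a41 * n 1 + a23 * n 3 = a12 * n 2 + a34 * n 4"
    unfolding B_def by (simp_all add: weight_add)
  interpret curve: monomial_curve n
  proof
    show "0 < n i" for i using n_pos by blast
    show "n 1 < n i" if "i \<noteq> 1" for i
      using all_4[of "\<lambda>i. i \<noteq> 1 \<longrightarrow> n 1 < n i"] n_less that by simp
  qed
  interpret bresinsky "n 1" "n 2" "n 3" "n 4" a1 a2 a3 a4 a12 a13 a23 a24 a31 a34 a41 a42
    by unfold_locales
      (use n_pos n_less exps weights in simp_all)
  have weight: "weight n m = wt (exponents m)" and degree: "total_degree m = deg (exponents m)" for m
    by (simp_all add: weight_def total_degree_def sum_4 exponents_def)
  interpret connected_bresinsky "n 1" "n 2" "n 3" "n 4" a1 a2 a3 a4 a12 a13 a23 a24 a31 a34 a41 a42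
  proof
    show "a34 \<le> a24" by (rule a34_le)
    fix P x y assume P: "invariant P" and xy: "wt x = wt y" "P x"
    have "P (exponents (u + l)) \<longleftrightarrow> P (exponents (u + r))" if "(l, r) \<in> B" for l r u
      using that P unfolding invariant_def B_def exponents_add
      by (auto simp: lookup_add lookup_single when_def)
    then have "P (exponents (monomial x)) \<longleftrightarrow> P (exponents (monomial y))"
      by (rule invariant_constant_on_weights[of n B "\<lambda>m. P (exponents m)", where 'k = 'k, rotated])
        (use gen xy in \<open>simp_all add: weight\<close>)
    then show "P y" using xy(2) by simp
  qed
  have maximal: "maximal n m \<longleftrightarrow> max_deg (exponents m)" for m
    unfolding maximal_def max_deg_def weight degree by (metis exponents_monomial)
  have "curve.first_variable_regular \<longleftrightarrow> regular"
  proof -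
    have "curve.first_variable_regular \<longleftrightarrow>
        (\<forall>x. max_deg x \<longrightarrow> max_deg (exponents (single 1 1 + monomial x)))"
      unfolding curve.first_variable_regular_def maximal by (metis exponents_monomial monomial_exponents)
    moreover have "exponents (single 1 1 + monomial (p, q, r, s)) = (Suc p, q, r, s)" for p q r s
      by (simp add: exponents_def monomial_def lookup_add lookup_single when_def)
    ultimately show ?thesis unfolding regular_def by simp
  qed
  then have "cohen_macaulay_tangent_cone I \<longleftrightarrow> regular"
    unfolding I_eq curve.cohen_macaulay_tangent_cone_iff .
  also note regular_iff
  also have "(a3 \<le> a31 + a34 \<and> a12 + a34 \<le> a41 + a23 \<and>
      (a23 < a13 \<and> a2 + a12 + a34 \<le> a41 + 2 * a23 + a24 \<or>
       a13 \<le> a23 \<and> a2 + a12 + a13 \<le> a1 + a23 + a24)) \<longleftrightarrow>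
    a3 \<le> a31 + a34 \<and>
    a12 + a34 \<le> a41 + a23 \<and>
    (a23 < a13 \<and> int a2 + int a12 \<le> int a41 + 2 * int a23 + int a24 - int a34 \<or>
     a13 \<le> a23 \<and> int a2 + int a12 \<le> int a1 + int a23 - int a13 + int a24)"
    by linarith
  finally show ?thesis .
qed

end
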